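(* Let $\mathbb P_0=\operatorname{FLim}(\mathcal{KP}_0)=(\omega,S_\omega)$ be the random polyhedron and, for $k\in\mathbb N\setminus\{0\}$, let $\mathbb P_0(k)=\operatorname{FLim}(\mathcal{KP}_0(k))=(\omega,S^k_\omega)$ be the random $k$-polyhedron. The following hold: (1) The universal minimal $\operatorname{Aut}(\mathbb P_0)$-flow is the metrizable $\operatorname{Aut}(\mathbb P_0)$-flow of $\mathcal{KP}$-admissible orderings on $\omega$. (2) For every $k\in\mathbb N\setminus\{0\}$, the universal minimal $\operatorname{Aut}(\mathbb P_0(k))$-flow is the metrizable $\operatorname{Aut}(\mathbb P_0(k))$-flow of $\mathcal{KP}(k)$-admissible orderings on $\omega$.
   Context: A polyhedron is a pair $(A,S_A)$ with $A$ a countable set and $S_A$ a hereditary family of finite subsets of $A$ ($u\subseteq v\in S_A$ implies $u\in S_A$) with $\bigcup S_A=A$. It is viewed as a structure in the signature $L_0$ with one $i$-ary relation symbol $R_i$ for each $i\geq1$, where $(a_1,\dots,a_i)\in R_i$ iff the $a_j$ are distinct and $\{a_1,\dots,a_i\}\in S_A$. An ordered polyhedron is a polyhedron with a total order on $A$, as a structure in $L=L_0\cup\{<\}$. $\mathcal{KP}$ is the class of finite ordered polyhedra; $\mathcal{KP}(k)$ is the class of those $(A,S_A)\in\mathcal{KP}$ with $|u|\leq k$ for all $u\in S_A$. $\mathcal{KP}_0$ and $\mathcal{KP}_0(k)$ are the classes of structures obtained from those in $\mathcal{KP}$ and $\mathcal{KP}(k)$ by dropping the order. These are Fraïssé classes;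 $\operatorname{FLim}$ denotes the Fraïssé limit, the unique (up to isomorphism) countable, locally finite, ultrahomogeneous structure with the given class as its age. The paper calls the Fraïssé limit of $\mathcal{KP}_0$ (resp. $\mathcal{KP}_0(k)$) the (non ordered) random polyhedron (resp. random $k$-polyhedron), written $(\omega,S_\omega)$ (resp. $(\omega,S^k_\omega)$), with universe $\omega$ (a countably infinite set). Let $\mathcal K$ be $\mathcal{KP}$ (resp. $\mathcal{KP}(k)$) and $\mathbb F_0$ be $\mathbb P_0$ (resp. $\mathbb P_0(k)$). A linear ordering $\prec$ on the universe of $\mathbb F_0$ is $\mathcal K$-admissible if for every finite substructure $\mathbb A_0\leq\mathbb F_0$ with universe $A_0$, $\langle\mathbb A_0,\prec\upharpoonright A_0\rangle\in\mathcal K$. The set of $\mathcal K$-admissible orderings is topologized as a subspace of $2^{\omega\times\omega}$, with the natural action of the automorphism group: $x\,(g\cdot\prec)\,y$ iff $g^{-1}(x)\prec g^{-1}(y)$. Automorphism groups carry the topology of pointwise convergence. For a topological group $G$, a $G$-flow is a compact Hausdorff space with a continuous $G$-action; it is minimal if every orbit is dense; the universal minimal $G$-flow is the minimal $G$-flow, unique up to isomorphism, that can be homomorphically mapped onto any other minimal $G$-flow. *)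

theory Defs
  imports "HOL-Analysis.Analysis" "HOL-Algebra.Group_Action"
begin

section \<open>Relational structures and their Fraisse limits\<close>

text \<open>
  A structure interprets every symbol of a relational signature \<open>'s\<close> by a set of tuples, written as
  lists, over its universe. The arities are carried by the classes of structures considered below.
\<close>

record ('s, 'a) rel_structure =
  universe :: "'a set"
  interp :: "'s \<Rightarrow> 'a list set"

definition substructure_on ::
    "('s, 'a) rel_structure \<Rightarrow> 'a set \<Rightarrow> ('s, 'a) rel_structure" where
  "substructure_on M A = \<lparr>universe = A, interp = (\<lambda>s. {xs \<in> interp M s. set xs \<subseteq> A})\<rparr>"

text \<open>
  As tuples are taken over the universe and \<open>f\<close> is a bijection, the equation between the relations
  says that \<open>f\<close> preserves and reflects them.
\<close>

definition structure_iso ::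
    "('a \<Rightarrow> 'b) \<Rightarrow> ('s, 'a) rel_structure \<Rightarrow> ('s, 'b) rel_structure \<Rightarrow> bool" where
  "structure_iso f M N \<longleftrightarrow>
     bij_betw f (universe M) (universe N) \<and> (\<forall>s. interp N s = map f ` interp M s)"

text \<open>
  The signature is relational, so every subset of the universe carries a substructure and the
  finitely generated substructures are the finite ones. In particular every structure is locally
  finite. The age is a class of structures closed under isomorphism; on an infinite type \<open>'b\<close> every
  isomorphism type of finite structures is represented.
\<close>

definition age :: "('s, 'a) rel_structure \<Rightarrow> ('s, 'b) rel_structure set" where
  "age M = {B. \<exists>A f. finite A \<and> A \<subseteq> universe M \<and> structure_iso f (substructure_on M A) B}"

definition ultrahomogeneous :: "('s, 'a) rel_structure \<Rightarrow> bool" where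
  "ultrahomogeneous M \<longleftrightarrow>
     (\<forall>A B f. finite A \<and> A \<subseteq> universe M \<and> B \<subseteq> universe M \<and>
        structure_iso f (substructure_on M A) (substructure_on M B) \<longrightarrow>
        (\<exists>g. structure_iso g M M \<and> (\<forall>x\<in>A. g x = f x)))"

definition is_Fraisse_limit ::
    "('s, 'b) rel_structure set \<Rightarrow> ('s, 'a) rel_structure \<Rightarrow> bool" where
  "is_Fraisse_limit K M \<longleftrightarrow> countable (universe M) \<and> ultrahomogeneous M \<and> age M = K"

section \<open>Polyhedra\<close>

definition abstract_polyhedron :: "'a set \<Rightarrow> 'a set set \<Rightarrow> bool" where
  "abstract_polyhedron A S \<longleftrightarrow>
     countable A \<and> (\<forall>u\<in>S. finite u) \<and> (\<forall>u v. u \<subseteq> v \<and> v \<in> S \<longrightarrow> u \<in> S) \<and> \<Union>S = A"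

text \<open>The symbol \<open>n\<close> stands for the relation symbol of arity \<open>n + 1\<close>, so that all arities are positive.\<close>

definition polyhedron_structure :: "'a set \<Rightarrow> 'a set set \<Rightarrow> (nat, 'a) rel_structure" where
  "polyhedron_structure A S =
     \<lparr>universe = A, interp = (\<lambda>n. {xs. length xs = Suc n \<and> distinct xs \<and> set xs \<in> S})\<rparr>"

datatype 's with_order = Rel 's | Less

definition expand_order ::
    "('s, 'a) rel_structure \<Rightarrow> 'a rel \<Rightarrow> ('s with_order, 'a) rel_structure" where
  "expand_order M r =
     \<lparr>universe = universe M,
      interp = (\<lambda>s. case s of Rel t \<Rightarrow> interp M t | Less \<Rightarrow> {[x, y] | x y. (x, y) \<in> r})\<rparr>"

definition drop_order ::
    "('s with_order, 'a) rel_structure \<Rightarrow> ('s, 'a) rel_structure" where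
  "drop_order N = \<lparr>universe = universe N, interp = (\<lambda>t. interp N (Rel t))\<rparr>"

definition KP :: "(nat with_order, 'a) rel_structure set" where
  "KP = {expand_order (polyhedron_structure A S) r | A S r.
           finite A \<and> abstract_polyhedron A S \<and> r \<subseteq> A \<times> A \<and> strict_linear_order_on A r}"

definition KP_bounded :: "nat \<Rightarrow> (nat with_order, 'a) rel_structure set" where
  "KP_bounded k = {expand_order (polyhedron_structure A S) r | A S r.
           finite A \<and> abstract_polyhedron A S \<and> (\<forall>u\<in>S. card u \<le> k) \<and>
           r \<subseteq> A \<times> A \<and> strict_linear_order_on A r}"

definition KP0 :: "(nat, 'a) rel_structure set" where
  "KP0 = drop_order ` KP"

definition KP0_bounded :: "nat \<Rightarrow> (nat, 'a) rel_structure set" where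
  "KP0_bounded k = drop_order ` KP_bounded k"

definition random_polyhedron :: "nat set set \<Rightarrow> bool" where
  "random_polyhedron S \<longleftrightarrow> abstract_polyhedron UNIV S \<and>
     is_Fraisse_limit (KP0 :: (nat, nat) rel_structure set) (polyhedron_structure UNIV S)"

definition random_k_polyhedron :: "nat \<Rightarrow> nat set set \<Rightarrow> bool" where
  "random_k_polyhedron k S \<longleftrightarrow> abstract_polyhedron UNIV S \<and>
     is_Fraisse_limit (KP0_bounded k :: (nat, nat) rel_structure set) (polyhedron_structure UNIV S)"

section \<open>Automorphism groups\<close>

definition Aut :: "('s, 'a) rel_structure \<Rightarrow> ('a \<Rightarrow> 'a) monoid" where
  "Aut M = BijGroup (universe M) \<lparr>carrier := {g \<in> Bij (universe M). structure_iso g M M}\<rparr>"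

text \<open>Pointwise convergence refers to the discrete topology on the universe.\<close>

definition Aut_topology :: "('s, 'a) rel_structure \<Rightarrow> ('a \<Rightarrow> 'a) topology" where
  "Aut_topology M =
     subtopology (product_topology (\<lambda>_. discrete_topology (universe M)) (universe M))
                 (carrier (Aut M))"

section \<open>Flows\<close>

definition topological_group :: "('g, 'm) monoid_scheme \<Rightarrow> 'g topology \<Rightarrow> bool" where
  "topological_group G T \<longleftrightarrow> group G \<and> topspace T = carrier G \<and>
     continuous_map (prod_topology T T) T (\<lambda>(g, h). g \<otimes>\<^bsub>G\<^esub> h) \<and>
     continuous_map T T (\<lambda>g. inv\<^bsub>G\<^esub> g)"

definition flow ::
    "('g, 'm) monoid_scheme \<Rightarrow> 'g topology \<Rightarrow> 'x topology \<Rightarrow> ('g \<Rightarrow> 'x \<Rightarrow> 'x) \<Rightarrow> bool" where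
  "flow G T X \<phi> \<longleftrightarrow> topological_group G T \<and> compact_space X \<and> Hausdorff_space X \<and>
     group_action G (topspace X) \<phi> \<and>
     continuous_map (prod_topology T X) X (\<lambda>(g, x). \<phi> g x)"

text \<open>Minimal flows are nonempty; without this condition the empty flow would count as minimal.\<close>

definition minimal_flow ::
    "('g, 'm) monoid_scheme \<Rightarrow> 'g topology \<Rightarrow> 'x topology \<Rightarrow> ('g \<Rightarrow> 'x \<Rightarrow> 'x) \<Rightarrow> bool" where
  "minimal_flow G T X \<phi> \<longleftrightarrow> flow G T X \<phi> \<and> topspace X \<noteq> {} \<and>
     (\<forall>x\<in>topspace X. X closure_of orbit G \<phi> x = topspace X)"

definition flow_hom ::
    "('g, 'm) monoid_scheme \<Rightarrow> 'x topology \<Rightarrow> ('g \<Rightarrow> 'x \<Rightarrow> 'x) \<Rightarrow>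
     'y topology \<Rightarrow> ('g \<Rightarrow> 'y \<Rightarrow> 'y) \<Rightarrow> ('x \<Rightarrow> 'y) \<Rightarrow> bool" where
  "flow_hom G X \<phi> Y \<psi> f \<longleftrightarrow> continuous_map X Y f \<and>
     (\<forall>g\<in>carrier G. \<forall>x\<in>topspace X. f (\<phi> g x) = \<psi> g (f x))"

text \<open>
  HOL cannot quantify over types inside a formula, so the type of the points of the competing flows
  is a parameter. A theorem in which \<open>'y\<close> is a free type variable covers all minimal flows.
\<close>

definition universal_minimal_flow ::
    "'y itself \<Rightarrow> ('g, 'm) monoid_scheme \<Rightarrow> 'g topology \<Rightarrow>
     'x topology \<Rightarrow> ('g \<Rightarrow> 'x \<Rightarrow> 'x) \<Rightarrow> bool" where
  "universal_minimal_flow TY G T X \<phi> \<longleftrightarrow> minimal_flow G T X \<phi> \<and>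
     (\<forall>(Y :: 'y topology) \<psi>. minimal_flow G T Y \<psi> \<longrightarrow>
        (\<exists>f. flow_hom G X \<phi> Y \<psi> f \<and> f ` topspace X = topspace Y))"

section \<open>Admissible orderings\<close>

text \<open>
  An ordering of \<open>\<omega>\<close> is given by its characteristic function, a point of the Cantor space
  \<open>2\<close> to the power \<open>\<omega> \<times> \<omega>\<close>. The structures are those with universe \<open>\<omega>\<close>, the type of natural numbers.
\<close>

definition admissible_orderings ::
    "('s with_order, nat) rel_structure set \<Rightarrow> ('s, nat) rel_structure \<Rightarrow> (nat \<times> nat \<Rightarrow> bool) set" where
  "admissible_orderings K M =
     {p. strict_linear_order_on UNIV (Collect p) \<and>
         (\<forall>A. finite A \<and> A \<subseteq> universe M \<longrightarrow>
            expand_order (substructure_on M A) (Collect p \<inter> A \<times> A) \<in> K)}"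

definition admissible_topology ::
    "('s with_order, nat) rel_structure set \<Rightarrow> ('s, nat) rel_structure \<Rightarrow> (nat \<times> nat \<Rightarrow> bool) topology" where
  "admissible_topology K M =
     subtopology (product_topology (\<lambda>_. discrete_topology UNIV) UNIV) (admissible_orderings K M)"

definition admissible_action ::
    "('s with_order, nat) rel_structure set \<Rightarrow> ('s, nat) rel_structure \<Rightarrow>
     (nat \<Rightarrow> nat) \<Rightarrow> (nat \<times> nat \<Rightarrow> bool) \<Rightarrow> (nat \<times> nat \<Rightarrow> bool)" where
  "admissible_action K M g =
     (\<lambda>p \<in> admissible_orderings K M. \<lambda>(x, y). p ((inv\<^bsub>Aut M\<^esub> g) x, (inv\<^bsub>Aut M\<^esub> g) y))"

end

theory Submission
  imports Defs "HOL-Library.Nat_Bijection"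
begin

text \<open>
  A finite subset of a random polyhedron always induces a finite polyhedron of the class, so every
  linear order of \<open>\<omega>\<close> is admissible, and both flows are the compact metrizable
  space of all linear orders, on which automorphisms act by transport. What remains is the
  argument of Kechris, Pestov and Todorcevic, which rests on two properties of the finite ordered
  polyhedra.

  The first is the Ramsey property, \<open>Ramsey_ordered_complexes\<close>. A family of subsets
  of \<open>{..<N}\<close>, one for each vertex of a complex, is described by the word whose
  letter at a point is the set of the vertices whose sets contain it. The letters are faces of the
  nerve of the family; conversely a word over the faces of a complex in which all of them occur
  describes a family whose nerve is this complex. Let the faces be numbered colexicographically.
  If new letters appear in increasing order, then the minima of the sets increase with the
  vertices, so the word is an ordered copy of the complex in the nerve of all subsets of
  \<open>{..<N}\<close>. An ordered embedding of \<open>A\<close> in \<open>B\<close>, read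
  backwards on faces, is a word of the same kind, and restricting a copy of \<open>B\<close> to
  \<open>A\<close> is substitution of words. Thus the Ramsey property is an instance of the dual
  Ramsey theorem of Graham and Rothschild, \<open>Graham_Rothschild\<close>, which is derived from
  the Hales-Jewett theorem by induction on the number of parameters. As faces of the nerve that
  are too large can be discarded without changing the copies of \<open>B\<close>, the bound on the
  dimension does no harm.

  The second is the ordering property, \<open>every_order_universal\<close>: every linear order of
  \<open>\<omega>\<close> contains every finite ordered complex. It follows from the first by
  colouring the non-adjacent pairs.

  By homogeneity the ordering property says that all orbits are dense, so the flow of linear
  orders is minimal. For universality let \<open>Y\<close> be a minimal flow. The Ramsey property
  and the compactness of \<open>Y\<close> give a point \<open>y\<close> with the following
  property: for every continuous real function there is a finite set such that the function is
  never below \<open>1 / 4\<close> at \<open>g y\<close> and above \<open>3 / 4\<close> at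
  \<open>h y\<close> if \<open>g\<close> and \<open>h\<close> carry the usual order
  \<open><\<close> to orders that agree on this set (\<open>order_blind_point\<close>). Hence
  \<open>g y\<close> has exactly one limit point as the order \<open>g <\<close> tends to a given
  order \<open>x\<close> (\<open>limit_point_unique\<close>), and sending \<open>x\<close> to this
  limit is the required homomorphism onto \<open>Y\<close>.
\<close>

section \<open>Words of restricted growth\<close>

text \<open>
  The words of restricted growth with \<open>d\<close> new letters: besides letters below \<open>t\<close> they contain exactly
  \<open>t, \<dots>, t + d - 1\<close>, whose first occurrences come in this order. They are the parameter words of
  Graham and Rothschild with \<open>t\<close> constants and \<open>d\<close> parameters; for \<open>t = 0\<close> they are the rigid
  surjections of an initial segment onto \<open>{..<d}\<close>.
\<close>

fun rg :: "nat \<Rightarrow> nat list \<Rightarrow> nat \<Rightarrow> bool" where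
  "rg t [] d \<longleftrightarrow> d = 0"
| "rg t (x # xs) d \<longleftrightarrow> (x < t \<and> rg t xs d) \<or> (x = t \<and> d > 0 \<and> rg (Suc t) xs (d - 1))"

text \<open>
  Substitution for parameters: constants, the letters below \<open>t\<close>, are kept, and the parameter \<open>t + i\<close>
  is replaced by the \<open>i\<close>-th entry of \<open>g\<close>.
\<close>

definition sub :: "nat \<Rightarrow> nat list \<Rightarrow> nat list \<Rightarrow> nat list" where
  "sub t g w = map (nth ([0..<t] @ g)) w"

lemma length_sub [simp]: "length (sub t g w) = length w"
  by (simp add: sub_def)

lemma rg_append:
  assumes "rg t u a" "rg (t + a) v b"
  shows "rg t (u @ v) (a + b)"
  using assms by (induction t u a rule: rg.induct) auto

lemma rg_letters: "rg t w 0 \<longleftrightarrow> set w \<subseteq> {..<t}"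
  by (induction w) auto

lemma rg_set: "rg t w d \<Longrightarrow> set w \<subseteq> {..<t + d}"
  by (induction t w d rule: rg.induct) fastforce+

lemma rg_upt: "rg t [t..<t+d] d"
proof (induction d)
  case (Suc d)
  have "rg (t + d) [t + d] 1" by simp
  from rg_append[OF Suc this] show ?case by simp
qed simp

text \<open>
  The maps between alphabets allowed here shift the parameters rigidly, which keeps the order of
  their first occurrences.
\<close>

lemma rg_map:
  assumes "rg t w d" "\<forall>x<t. s x < t'" "\<forall>j. s (t + j) = t' + j"
  shows "rg t' (map s w) d"
  using assms
proof (induction t w d arbitrary: t' rule: rg.induct)
  case (2 t x xs d)
  have st: "s t = t'" using 2(5)[rule_format, of 0] by simp
  show ?case
  proof (cases "x < t")
    case True
    then show ?thesis using 2 by auto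
  next
    case False
    then have x: "x = t" "d > 0" "rg (Suc t) xs (d - 1)" using 2(3) by auto
    have "\<forall>y<Suc t. s y < Suc t'" using 2(4) st by (auto simp: less_Suc_eq)
    moreover have "\<forall>j. s (Suc t + j) = Suc t' + j" using 2(5) by (metis add_Suc add_Suc_right)
    ultimately have "rg (Suc t') (map s xs) (d - 1)" using 2(2) x by blast
    then show ?thesis using x st by simp
  qed
qed simp

text \<open>
  Reading \<open>w\<close> from the left, one meets a new parameter only after all earlier ones. So the entries of
  \<open>g\<close> produced so far form an initial segment of \<open>g\<close>, and \<open>p\<close> bounds the letters in it.
\<close>

lemma rg_compose:
  assumes "rg t w d" "length g = t + d" "rg p (drop t g) k" "\<forall>i<t. g ! i < p"
  shows "rg p (map (nth g) w) k"
  using assms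
proof (induction t w d arbitrary: p k rule: rg.induct)
  case (2 t x xs d)
  show ?case
  proof (cases "x < t")
    case True
    then show ?thesis using 2 by auto
  next
    case False
    then have x: "x = t" "d > 0" "rg (Suc t) xs (d - 1)" using 2(3) by auto
    then have dr: "drop t g = g ! t # drop (Suc t) g" using 2(4)
      by (simp add: Cons_nth_drop_Suc)
    have len: "length g = Suc t + (d - 1)" using 2(4) x by simp
    show ?thesis
    proof (cases "g ! t < p")
      case True
      then have "rg p (drop (Suc t) g) k" using 2(5) dr by simp
      moreover have "\<forall>i<Suc t. g ! i < p" using 2(6) True by (auto simp: less_Suc_eq)
      ultimately show ?thesis using 2(2) x len True by auto
    next
      case False
      then have "rg (Suc p) (drop (Suc t) g) (k - 1)" "g ! t = p" "k > 0"
        using 2(5) dr by auto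
      moreover from this have "\<forall>i<Suc t. g ! i < Suc p" using 2(6) by (auto simp: less_Suc_eq)
      ultimately show ?thesis using 2(2) x len by auto
    qed
  qed
qed simp

lemma rg_sub:
  assumes "rg t w d" "length g = d" "rg t g k"
  shows "rg t (sub t g w) k"
  unfolding sub_def by (rule rg_compose[OF assms(1)]) (use assms in \<open>auto simp: nth_append\<close>)

lemma sub_sub:
  assumes "set w \<subseteq> {..<t + length g}"
  shows "sub t h (sub t g w) = sub t (sub t h g) w"
  unfolding sub_def map_map
proof (rule map_cong[OF refl])
  fix x assume "x \<in> set w"
  then have "x < t + length g" using assms by auto
  then show "((!) ([0..<t] @ h) \<circ> (!) ([0..<t] @ g)) x = ([0..<t] @ map ((!) ([0..<t] @ h)) g) ! x"
    by (auto simp: nth_append)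
qed

lemma sub_append: "sub t g (u @ v) = sub t g u @ sub t g v"
  by (simp add: sub_def)

text \<open>
  At its first parameter a word splits into a word of constants and a word in which this parameter
  counts as a further constant. This trades a parameter for a letter in the induction below.
\<close>

lemma rg_split_at:
  "set u \<subseteq> {..<t} \<Longrightarrow> rg t (u @ t # v) (Suc k) \<longleftrightarrow> rg (Suc t) v k"
  by (induction u) auto

lemma rg_first_occurrence:
  assumes "rg t w d" "j < d"
  shows "\<exists>u v. w = u @ (t + j) # v \<and> set u \<subseteq> {..<t + j} \<and> rg t u j"
  using assms
proof (induction t w d arbitrary: j rule: rg.induct)
  case (2 t x xs d)
  show ?case
  proof (cases "x < t")
    case True
    moreover have "rg t xs d" using 2(3) True by simp
    ultimately obtain u v where "xs = u @ (t + j) # v" "set u \<subseteq> {..<t + j}" "rg t u j"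
      using 2(1)[OF _ 2(4)] by blast
    then show ?thesis using True by (intro exI[of _ "x # u"] exI[of _ v]) auto
  next
    case False
    then have x: "x = t" "d > 0" "rg (Suc t) xs (d - 1)" using 2(3) by auto
    show ?thesis
    proof (cases j)
      case 0
      then show ?thesis using x by (intro exI[of _ "[]"] exI[of _ xs]) auto
    next
      case (Suc i)
      then obtain u v where "xs = u @ (Suc t + i) # v" "set u \<subseteq> {..<Suc t + i}" "rg (Suc t) u i"
        using 2(2)[OF x(3), of i] 2(4) by (metis less_diff_conv Suc_eq_plus1)
      then show ?thesis using x Suc by (intro exI[of _ "x # u"] exI[of _ v]) auto
    qed
  qed
qed simp

text \<open>
  The function \<open>h\<close> numbers the families of colours with indices in \<open>D\<close>. Colouring an object by such a
  family, one colour for each context \<open>d\<close> in which it may be placed, is thus a colouring with \<open>R\<close>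
  colours, and a set monochromatic for it is monochromatic in each context.
\<close>

definition encodes_families :: "'a set \<Rightarrow> nat \<Rightarrow> nat \<Rightarrow> (('a \<Rightarrow> nat) \<Rightarrow> nat) \<Rightarrow> bool" where
  "encodes_families D r R h \<longleftrightarrow>
     (\<forall>f. (\<forall>d\<in>D. f d < r) \<longrightarrow> h f < R) \<and>
     (\<forall>f f'. (\<forall>d\<in>D. f d < r) \<longrightarrow> (\<forall>d\<in>D. f' d < r) \<longrightarrow> h f = h f' \<longrightarrow> (\<forall>d\<in>D. f d = f' d))"

lemma encodes_families_less: "encodes_families D r R h \<Longrightarrow> \<forall>d\<in>D. f d < r \<Longrightarrow> h f < R"
  by (simp add: encodes_families_def)

lemma encodes_families_eq:
  "encodes_families D r R h \<Longrightarrow> \<forall>d\<in>D. f d < r \<Longrightarrow> \<forall>d\<in>D. f' d < r \<Longrightarrow> h f = h f' \<Longrightarrow> d \<in> D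
     \<Longrightarrow> f d = f' d"
  unfolding encodes_families_def by blast

lemma finite_encodes_families:
  assumes "finite D"
  shows "\<exists>R h. encodes_families D r R h"
  using assms
proof induction
  case empty
  have "encodes_families {} r 1 (\<lambda>_. 0)" by (simp add: encodes_families_def)
  then show ?case by blast
next
  case (insert a D)
  then obtain R h where h: "encodes_families D r R h" by blast
  define h' where "h' f = f a * R + h f" for f
  have "encodes_families (insert a D) r (r * R) h'" unfolding encodes_families_def
  proof (intro conjI allI impI)
    fix f :: "'a \<Rightarrow> nat" assume f: "\<forall>d\<in>insert a D. f d < r"
    have "h' f < f a * R + R" using encodes_families_less[OF h, of f] f by (simp add: h'_def)
    also have "\<dots> = Suc (f a) * R" by simp
    also have "\<dots> \<le> r * R" using f by (intro mult_le_mono1) auto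
    finally show "h' f < r * R" .
  next
    fix f f' :: "'a \<Rightarrow> nat"
    assume f: "\<forall>d\<in>insert a D. f d < r" "\<forall>d\<in>insert a D. f' d < r" and eq: "h' f = h' f'"
    have "h f < R" "h f' < R" using encodes_families_less[OF h] f by auto
    then have "f a = h' f div R" "h f = h' f mod R" "f' a = h' f' div R" "h f' = h' f' mod R"
      by (auto simp: h'_def)
    then have "f a = f' a" "h f = h f'" using eq by auto
    then show "\<forall>d\<in>insert a D. f d = f' d" using encodes_families_eq[OF h, of f f'] f by auto
  qed
  then show ?case by blast
qed

lemma finite_words: "finite {w. length w = n \<and> set w \<subseteq> {..<t::nat}}"
  using finite_lists_length_eq[of "{..<t}" n] by (simp add: conj_commute)

section \<open>The Hales-Jewett theorem\<close>

lemma rg_one: "rg t w 1 \<longleftrightarrow> set w \<subseteq> {..t} \<and> t \<in> set w"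
proof (induction w)
  case (Cons x w)
  have "rg (Suc t) w 0 \<longleftrightarrow> set w \<subseteq> {..t}"
    unfolding rg_letters by (simp add: lessThan_Suc_atMost)
  then show ?case using Cons by auto
qed simp

definition combinatorial_line :: "nat \<Rightarrow> nat \<Rightarrow> nat list \<Rightarrow> bool" where
  "combinatorial_line t n L \<longleftrightarrow> length L = n \<and> rg t L 1"

lemma combinatorial_line_iff:
  "combinatorial_line t n L \<longleftrightarrow> length L = n \<and> set L \<subseteq> {..t} \<and> t \<in> set L"
  by (simp only: combinatorial_line_def rg_one)

text \<open>
  Colour focusing. The point \<open>v\<close> is the common end, obtained for the letter \<open>t\<close>, of \<open>s\<close> lines whose
  other points have one colour each, with different colours for different lines. To gain a line, choose
  in a first block of coordinates a line \<open>L\<close> over the letters below \<open>t\<close> that the colouring does not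
  notice, whatever follows in the second block. Joining it to the given lines, and to the constant word
  \<open>v\<close>, gives \<open>s + 1\<close> lines with the common end \<open>L @ v\<close>. Their colours differ unless \<open>v\<close> has the colour
  of one of the given lines, and that line is then monochromatic.
\<close>

lemma focused_lines:
  fixes r t :: nat
  assumes t: "0 < t"
    and HJ: "\<And>r. \<exists>n. \<forall>\<kappa> :: nat list \<Rightarrow> nat. (\<forall>w. \<kappa> w < r) \<longrightarrow>
               (\<exists>L c. combinatorial_line t n L \<and> (\<forall>a<t. \<kappa> (sub t [a] L) = c))"
  shows "\<exists>n. \<forall>\<kappa> :: nat list \<Rightarrow> nat. (\<forall>w. \<kappa> w < r) \<longrightarrow>
           (\<exists>L c. combinatorial_line (Suc t) n L \<and> (\<forall>a<Suc t. \<kappa> (sub (Suc t) [a] L) = c)) \<or>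
           (\<exists>v K. length v = n \<and> set v \<subseteq> {..t} \<and> K \<subseteq> {..<r} \<and> card K = s \<and>
              (\<forall>c\<in>K. \<exists>L. combinatorial_line (Suc t) n L \<and> sub (Suc t) [t] L = v \<and>
                 (\<forall>a<t. \<kappa> (sub (Suc t) [a] L) = c)))"
proof (induction s)
  case 0
  show ?case by (intro exI[of _ 0] allI impI disjI2 exI[of _ "[]"] exI[of _ "{}"]) auto
next
  case (Suc s)
  then obtain n where n: "\<forall>\<kappa> :: nat list \<Rightarrow> nat. (\<forall>w. \<kappa> w < r) \<longrightarrow>
           (\<exists>L c. combinatorial_line (Suc t) n L \<and> (\<forall>a<Suc t. \<kappa> (sub (Suc t) [a] L) = c)) \<or>
           (\<exists>v K. length v = n \<and> set v \<subseteq> {..t} \<and> K \<subseteq> {..<r} \<and> card K = s \<and>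
              (\<forall>c\<in>K. \<exists>L. combinatorial_line (Suc t) n L \<and> sub (Suc t) [t] L = v \<and>
                 (\<forall>a<t. \<kappa> (sub (Suc t) [a] L) = c)))"
    by (rule exE)
  define D where "D = {w. length w = n \<and> set w \<subseteq> {..<Suc t}}"
  have "finite D" unfolding D_def by (rule finite_words)
  then obtain R h where h: "encodes_families D r R h" using finite_encodes_families by blast
  obtain m where m: "\<forall>\<kappa> :: nat list \<Rightarrow> nat. (\<forall>w. \<kappa> w < R) \<longrightarrow>
               (\<exists>L c. combinatorial_line t m L \<and> (\<forall>a<t. \<kappa> (sub t [a] L) = c))"
    using HJ by (rule exE)
  show ?case
  proof (intro exI[of _ "m + n"] allI impI)
    fix \<kappa> :: "nat list \<Rightarrow> nat" assume \<kappa>: "\<forall>w. \<kappa> w < r"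
    have "\<forall>w. h (\<lambda>v. \<kappa> (w @ v)) < R" using encodes_families_less[OF h] \<kappa> by simp
    from m[THEN spec, THEN mp, OF this] obtain L c where L: "combinatorial_line t m L"
      and c: "\<forall>a<t. h (\<lambda>v. \<kappa> (sub t [a] L @ v)) = c" by (elim exE conjE)
    have indep: "\<kappa> (sub t [a] L @ v) = \<kappa> (sub t [0] L @ v)" if "a < t" "v \<in> D" for a v
      using encodes_families_eq[OF h, of "\<lambda>v. \<kappa> (sub t [a] L @ v)" "\<lambda>v. \<kappa> (sub t [0] L @ v)"] \<kappa> c that t by simp
    define L' where "L' = map (\<lambda>x. if x < t then x else Suc x) L"
    have setL: "set L \<subseteq> {..t}" "t \<in> set L" "length L = m"
      using L by (auto simp: combinatorial_line_iff)
    have L': "set L' \<subseteq> {..Suc t}" "Suc t \<in> set L'" "length L' = m"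
      using setL by (auto simp: L'_def image_iff)
    have L'_a: "sub (Suc t) [a] L' = sub t [a] L" for a
      unfolding sub_def L'_def map_map
      by (rule map_cong[OF refl]) (use setL in \<open>auto simp: nth_append\<close>)
    have L_t: "sub t [t] L = L"
      unfolding sub_def by (rule map_idI) (use setL in \<open>auto simp: nth_append\<close>)
    have inD: "sub (Suc t) [a] M \<in> D" if "combinatorial_line (Suc t) n M" "a < Suc t" for a M
    proof -
      have "rg (Suc t) (sub (Suc t) [a] M) 0"
        by (rule rg_sub[of _ _ 1]) (use that in \<open>auto simp: combinatorial_line_def\<close>)
      then show ?thesis using that by (simp add: D_def rg_letters combinatorial_line_def)
    qed
    have join: "combinatorial_line (Suc t) (m + n) (L' @ M)"
      if "length M = n" "set M \<subseteq> {..Suc t}" for M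
      using that L' by (auto simp: combinatorial_line_iff)
    have lines: "length M = n \<and> set M \<subseteq> {..Suc t}" if "combinatorial_line (Suc t) n M" for M
      using that by (auto simp: combinatorial_line_iff)
    define \<kappa>' where "\<kappa>' v = \<kappa> (sub t [0] L @ v)" for v
    have \<kappa>': "\<kappa> (sub (Suc t) [a] (L' @ M)) = \<kappa>' (sub (Suc t) [a] M)"
      if "sub (Suc t) [a] M \<in> D" "a < t" for a M
      using indep[OF that(2,1)] by (simp add: sub_append L'_a \<kappa>'_def)
    let ?mono = "\<exists>L c. combinatorial_line (Suc t) (m + n) L \<and> (\<forall>a<Suc t. \<kappa> (sub (Suc t) [a] L) = c)"
    have lift_mono: ?mono
      if M: "combinatorial_line (Suc t) n M" and c: "\<forall>a<Suc t. \<kappa>' (sub (Suc t) [a] M) = c" for M c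
    proof (intro exI conjI)
      define M' where "M' = sub t [0] L @ M"
      have "set (sub t [0] L) \<subseteq> {..<t}"
        using rg_sub[of t L 1 "[0]" 0] L t by (simp add: combinatorial_line_def rg_letters)
      then show "combinatorial_line (Suc t) (m + n) M'"
        using M setL by (force simp: combinatorial_line_iff M'_def)
      have "sub (Suc t) [a] (sub t [0] L) = sub t [0] L" for a
        unfolding sub_def[of "Suc t"] using \<open>set (sub t [0] L) \<subseteq> {..<t}\<close>
        by (intro map_idI) (auto simp: nth_append)
      then show "\<forall>a<Suc t. \<kappa> (sub (Suc t) [a] M') = c"
        using c by (simp add: M'_def sub_append \<kappa>'_def)
    qed
    show "?mono \<or>
           (\<exists>v K. length v = m + n \<and> set v \<subseteq> {..t} \<and> K \<subseteq> {..<r} \<and> card K = Suc s \<and>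
              (\<forall>c\<in>K. \<exists>L. combinatorial_line (Suc t) (m + n) L \<and> sub (Suc t) [t] L = v \<and>
                 (\<forall>a<t. \<kappa> (sub (Suc t) [a] L) = c)))"
    proof (cases ?mono)
      case False
      have "\<forall>w. \<kappa>' w < r" using \<kappa> by (simp add: \<kappa>'_def)
      from n[THEN spec, THEN mp, OF this] show ?thesis
      proof (elim disjE exE conjE)
        fix M c assume "combinatorial_line (Suc t) n M" "\<forall>a<Suc t. \<kappa>' (sub (Suc t) [a] M) = c"
        then show ?thesis by (intro disjI1) (rule lift_mono)
      next
        fix v K assume vK: "length v = n" "set v \<subseteq> {..t}" "K \<subseteq> {..<r}" "card K = s"
          and KK: "\<forall>c\<in>K. \<exists>M. combinatorial_line (Suc t) n M \<and> sub (Suc t) [t] M = v \<and>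
            (\<forall>a<t. \<kappa>' (sub (Suc t) [a] M) = c)"
        have K: "\<exists>M. combinatorial_line (Suc t) n M \<and> sub (Suc t) [t] M = v \<and>
            (\<forall>a<t. \<kappa>' (sub (Suc t) [a] M) = c)" if "c \<in> K" for c using KK that by simp
      have v: "v \<in> D" using vK by (auto simp: D_def lessThan_Suc_atMost)
      have v_a: "sub (Suc t) [a] v = v" for a
        unfolding sub_def using vK by (intro map_idI) (auto simp: nth_append)
      have new: "\<kappa>' v \<notin> K"
      proof
        assume "\<kappa>' v \<in> K"
        then obtain M where "combinatorial_line (Suc t) n M" "sub (Suc t) [t] M = v"
          "\<forall>a<t. \<kappa>' (sub (Suc t) [a] M) = \<kappa>' v" by (elim K[THEN exE] conjE)
        then show False using lift_mono[of M "\<kappa>' v"] False by (auto simp: less_Suc_eq)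
      qed
      have fin: "finite K" using finite_subset[OF vK(3)] by simp
      have 1: "\<exists>M. combinatorial_line (Suc t) (m + n) M \<and> sub (Suc t) [t] M = L @ v \<and>
                 (\<forall>a<t. \<kappa> (sub (Suc t) [a] M) = c)" if "c \<in> insert (\<kappa>' v) K" for c
      proof (cases "c = \<kappa>' v")
        case True
        have "set v \<subseteq> {..Suc t}" using vK by force
        then have "combinatorial_line (Suc t) (m + n) (L' @ v)" using join[OF vK(1)] by simp
        moreover have "\<forall>a<t. \<kappa> (sub (Suc t) [a] (L' @ v)) = c"
          using True v v_a \<kappa>'[of _ v] by simp
        moreover have "sub (Suc t) [t] (L' @ v) = L @ v"
          by (simp only: sub_append L'_a L_t v_a)
        ultimately show ?thesis by (intro exI[of _ "L' @ v"] conjI)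
      next
        case False
        then have "c \<in> K" using that by simp
        then obtain M where M: "combinatorial_line (Suc t) n M"
          "sub (Suc t) [t] M = v" "\<forall>a<t. \<kappa>' (sub (Suc t) [a] M) = c" by (elim K[THEN exE] conjE)
        have "\<forall>a<t. \<kappa> (sub (Suc t) [a] (L' @ M)) = c"
        proof (intro allI impI)
          fix a assume "a < t"
          then show "\<kappa> (sub (Suc t) [a] (L' @ M)) = c"
            using M(3) \<kappa>'[OF inD[OF M(1)], of a] by simp
        qed
        moreover have "combinatorial_line (Suc t) (m + n) (L' @ M)"
          using join lines[OF M(1)] by simp
        moreover have "sub (Suc t) [t] (L' @ M) = L @ v"
          by (simp only: sub_append L'_a L_t M(2))
        ultimately show ?thesis by (intro exI[of _ "L' @ M"] conjI)
      qed
      have 2: "length (L @ v) = m + n" "set (L @ v) \<subseteq> {..t}" using setL vK by auto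
      have 3: "insert (\<kappa>' v) K \<subseteq> {..<r}" "card (insert (\<kappa>' v) K) = Suc s"
        using vK new fin \<kappa> by (auto simp: \<kappa>'_def)
      show ?thesis
        by (rule disjI2, rule exI[of _ "L @ v"], rule exI[of _ "insert (\<kappa>' v) K"])
          (intro conjI ballI 1 2 3)
      qed
    qed simp
  qed
qed

text \<open>
  Lines of \<open>r + 1\<close> different colours do not exist when there are only \<open>r\<close> colours.
\<close>

theorem Hales_Jewett:
  "\<exists>n. \<forall>\<kappa> :: nat list \<Rightarrow> nat. (\<forall>w. \<kappa> w < r) \<longrightarrow>
     (\<exists>L c. combinatorial_line t n L \<and> (\<forall>a<t. \<kappa> (sub t [a] L) = c))"
proof (induction t arbitrary: r)
  case 0
  show ?case by (intro exI[of _ 1] allI impI exI[of _ "[0]"]) (simp add: combinatorial_line_def)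
next
  case (Suc t)
  show ?case
  proof (cases "t = 0")
    case True
    then show ?thesis
      by (intro exI[of _ 1] allI impI) (rule exI[of _ "[1]"], auto simp: combinatorial_line_def)
  next
    case False
    then have t: "0 < t" by simp
    from focused_lines[OF t Suc.IH, of r "Suc r"] obtain n where
      n: "\<forall>\<kappa> :: nat list \<Rightarrow> nat. (\<forall>w. \<kappa> w < r) \<longrightarrow>
           (\<exists>L c. combinatorial_line (Suc t) n L \<and> (\<forall>a<Suc t. \<kappa> (sub (Suc t) [a] L) = c)) \<or>
           (\<exists>v K. length v = n \<and> set v \<subseteq> {..t} \<and> K \<subseteq> {..<r} \<and> card K = Suc r \<and>
              (\<forall>c\<in>K. \<exists>L. combinatorial_line (Suc t) n L \<and> sub (Suc t) [t] L = v \<and>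
                 (\<forall>a<t. \<kappa> (sub (Suc t) [a] L) = c)))"
      by (rule exE)
    have no: "\<not> (K \<subseteq> {..<r} \<and> card K = Suc r)" for K
      using card_mono[of "{..<r}" K] by auto
    show ?thesis
    proof (intro exI[of _ n] allI impI)
      fix \<kappa> :: "nat list \<Rightarrow> nat" assume "\<forall>w. \<kappa> w < r"
      from n[THEN spec, THEN mp, OF this]
      show "\<exists>L c. combinatorial_line (Suc t) n L \<and> (\<forall>a<Suc t. \<kappa> (sub (Suc t) [a] L) = c)"
      proof (elim disjE)
        assume "\<exists>v K. length v = n \<and> set v \<subseteq> {..t} \<and> K \<subseteq> {..<r} \<and> card K = Suc r \<and>
              (\<forall>c\<in>K. \<exists>L. combinatorial_line (Suc t) n L \<and> sub (Suc t) [t] L = v \<and>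
                 (\<forall>a<t. \<kappa> (sub (Suc t) [a] L) = c))"
        then obtain K where "K \<subseteq> {..<r}" "card K = Suc r" by (elim exE conjE)
        then show ?thesis using no[of K] by simp
      qed
    qed
  qed
qed

text \<open>
  First make the colour of a joint word independent of its first part, as the latter runs through a
  subspace of dimension \<open>d\<close>, for every second part; then take a line in the second part.
\<close>

theorem Hales_Jewett_multidim:
  "\<exists>n. \<forall>\<kappa> :: nat list \<Rightarrow> nat. (\<forall>w. \<kappa> w < r) \<longrightarrow>
     (\<exists>W c. length W = n \<and> rg t W d \<and> (\<forall>g. length g = d \<longrightarrow> rg t g 0 \<longrightarrow> \<kappa> (sub t g W) = c))"
proof (induction d arbitrary: r)
  case 0
  show ?case by (intro exI[of _ 0] allI impI exI[of _ "[]"] exI) (auto simp: sub_def)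
next
  case (Suc d)
  obtain n where n: "\<forall>\<kappa> :: nat list \<Rightarrow> nat. (\<forall>w. \<kappa> w < r) \<longrightarrow>
     (\<exists>L c. combinatorial_line t n L \<and> (\<forall>a<t. \<kappa> (sub t [a] L) = c))"
    using Hales_Jewett by (rule exE)
  define D where "D = {w. length w = n \<and> set w \<subseteq> {..<t}}"
  have "finite D" unfolding D_def by (rule finite_words)
  then obtain R h where h: "encodes_families D r R h" using finite_encodes_families by blast
  obtain m where m: "\<forall>\<kappa> :: nat list \<Rightarrow> nat. (\<forall>w. \<kappa> w < R) \<longrightarrow>
     (\<exists>W c. length W = m \<and> rg t W d \<and> (\<forall>g. length g = d \<longrightarrow> rg t g 0 \<longrightarrow> \<kappa> (sub t g W) = c))"
    using Suc by (rule exE)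
  show ?case
  proof (intro exI[of _ "m + n"] allI impI)
    fix \<kappa> :: "nat list \<Rightarrow> nat" assume \<kappa>: "\<forall>w. \<kappa> w < r"
    have "\<forall>w. h (\<lambda>v. \<kappa> (w @ v)) < R" using encodes_families_less[OF h] \<kappa> by simp
    from m[THEN spec, THEN mp, OF this] obtain W c where W: "length W = m" "rg t W d"
      and c': "\<forall>g. length g = d \<longrightarrow> rg t g 0 \<longrightarrow> h (\<lambda>v. \<kappa> (sub t g W @ v)) = c" by (elim exE conjE)
    have c: "h (\<lambda>v. \<kappa> (sub t g W @ v)) = c" if "length g = d" "rg t g 0" for g
      using c' that by simp
    have indep: "\<kappa> (sub t g W @ v) = \<kappa> (sub t g' W @ v)"
      if "length g = d" "rg t g 0" "length g' = d" "rg t g' 0" "v \<in> D" for g g' v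
      using encodes_families_eq[OF h, of "\<lambda>v. \<kappa> (sub t g W @ v)" "\<lambda>v. \<kappa> (sub t g' W @ v)" v] \<kappa> c that by simp
    define g0 where "g0 = replicate d (0::nat)"
    have "\<forall>v. \<kappa> (sub t g0 W @ v) < r" using \<kappa> by simp
    from n[THEN spec, THEN mp, OF this] obtain L c' where L: "combinatorial_line t n L"
      and c': "\<forall>a<t. \<kappa> (sub t g0 W @ sub t [a] L) = c'" by (elim exE conjE)
    define L' where "L' = map (\<lambda>x. if x < t then x else x + d) L"
    have "rg (t + d) L' 1" unfolding L'_def
      by (rule rg_map) (use L in \<open>auto simp: combinatorial_line_def\<close>)
    then have "rg t (W @ L') (Suc d)" using rg_append[OF W(2), of L' 1] by simp
    moreover have "length (W @ L') = m + n" using W L by (simp add: L'_def combinatorial_line_def)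
    moreover have "\<kappa> (sub t g (W @ L')) = c'" if g: "length g = Suc d" "rg t g 0" for g
    proof -
      obtain g1 a where ga: "g = g1 @ [a]" "length g1 = d"
        using g by (metis length_Suc_conv_rev)
      have a: "a < t" "rg t g1 0" using g ga by (auto simp: rg_letters)
      have "set L \<subseteq> {..t}" using L by (auto simp: combinatorial_line_iff)
      then have "sub t g L' = sub t [a] L" unfolding sub_def L'_def map_map
        by (intro map_cong[OF refl]) (use ga in \<open>auto simp: nth_append\<close>)
      moreover have "sub t g W = sub t g1 W" unfolding sub_def
        by (rule map_cong[OF refl]) (use rg_set[OF W(2)] ga in \<open>auto simp: nth_append\<close>)
      moreover have "sub t [a] L \<in> D"
        using rg_sub[of t L 1 "[a]" 0] L a by (simp add: combinatorial_line_def rg_letters D_def)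
      moreover have "rg t g0 0" using a by (auto simp: rg_letters g0_def)
      ultimately show ?thesis
        using indep[of g1 g0 "sub t [a] L"] c' a ga by (simp add: sub_append g0_def)
    qed
    ultimately show "\<exists>W c. length W = m + n \<and> rg t W (Suc d) \<and>
        (\<forall>g. length g = Suc d \<longrightarrow> rg t g 0 \<longrightarrow> \<kappa> (sub t g W) = c)"
      by (intro exI[of _ "W @ L'"]) (rule exI[of _ c'], simp)
  qed
qed

section \<open>Heads of parameter words\<close>

text \<open>
  The constants that precede the first parameter of a word.
\<close>

abbreviation head :: "nat \<Rightarrow> nat list \<Rightarrow> nat list" where
  "head t \<equiv> takeWhile (\<lambda>x. x < t)"

lemma head_append:
  "length (head t xs) < length xs \<Longrightarrow> head t (xs @ ys) = head t xs"
  by (induction xs) (auto split: if_splits)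

lemma head_letters: "set (head t xs) \<subseteq> {..<t}"
  by (auto dest: set_takeWhileD)

lemma head_stop: "set u \<subseteq> {..<t} \<Longrightarrow> t \<le> x \<Longrightarrow> head t (u @ x # v) = u"
  by (subst takeWhile_append2) auto

lemma head_split:
  assumes "length (head t xs) < length xs"
  shows "\<exists>u x v. xs = u @ x # v \<and> t \<le> x \<and> head t xs = u \<and> set u \<subseteq> {..<t}"
proof -
  have "\<exists>x v. xs = head t xs @ x # v \<and> t \<le> x" using assms
  proof (induction xs)
    case (Cons a xs)
    then show ?case by (cases "a < t") auto
  qed simp
  then show ?thesis using head_letters by blast
qed

lemma rg_head:
  assumes "rg t g (Suc k)"
  shows "\<exists>u v. g = u @ t # v \<and> head t g = u \<and> set u \<subseteq> {..<t} \<and> rg (Suc t) v k"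
proof -
  obtain u v where uv: "g = u @ t # v" "set u \<subseteq> {..<t}"
    using rg_first_occurrence[OF assms, of 0] by auto
  then have "head t g = u" "rg (Suc t) v k"
    using head_stop[of u t t v] rg_split_at[of u t v k] assms by auto
  then show ?thesis using uv by blast
qed

lemma rg_head_length:
  assumes "rg t g (Suc k)"
  shows "length (head t g) < length g"
proof -
  obtain u v where "g = u @ t # v" "head t g = u" using rg_head[OF assms] by blast
  then show ?thesis by simp
qed

lemma sub_cong:
  assumes "set w \<subseteq> {..<t + j}" "take j g = take j g'" "j \<le> length g" "j \<le> length g'"
  shows "sub t g w = sub t g' w"
  unfolding sub_def
proof (rule map_cong[OF refl])
  fix x assume "x \<in> set w"
  then have "x < t \<or> x - t < j" using assms(1) by auto
  moreover have "g ! (x - t) = g' ! (x - t)" if "x - t < j"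
    using arg_cong[OF assms(2), of "\<lambda>l. l ! (x - t)"] that by simp
  ultimately show "([0..<t] @ g) ! x = ([0..<t] @ g') ! x" by (auto simp: nth_append)
qed

lemma sub_letters:
  assumes "set w \<subseteq> {..<t + length g}" "set g \<subseteq> {..<p}" "t \<le> p"
  shows "set (sub t g w) \<subseteq> {..<p}"
proof
  fix y assume "y \<in> set (sub t g w)"
  then obtain x where x: "x \<in> set w" "y = ([0..<t] @ g) ! x" by (auto simp: sub_def)
  have "x < t + length g" using x assms by auto
  then have "y \<in> set ([0..<t] @ g)" using x nth_mem[of x "[0..<t] @ g"] by simp
  then show "y \<in> {..<p}" using assms by auto
qed

text \<open>
  Substituting \<open>g\<close> into \<open>w\<close>, the first parameter to be seen is the one in place of \<open>t + j\<close>, where \<open>j\<close> is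
  the length of the head of \<open>g\<close>. So the head of the result depends on the head of \<open>g\<close> only.
\<close>

lemma head_sub:
  assumes "rg t w d" "j < d"
  shows "\<exists>u. length u < length w \<and>
           (\<forall>g. length g = d \<longrightarrow> length (head t g) = j \<longrightarrow> head t (sub t g w) = sub t (head t g) u)"
proof -
  obtain u v where uv: "w = u @ (t + j) # v" "set u \<subseteq> {..<t + j}"
    using rg_first_occurrence[OF assms] by blast
  have "head t (sub t g w) = sub t (head t g) u" if g: "length g = d" "length (head t g) = j" for g
  proof -
    obtain g0 x g1 where x: "g = g0 @ x # g1" "t \<le> x" "head t g = g0" "set g0 \<subseteq> {..<t}"
      using head_split[of t g] g assms by auto
    have "([0..<t] @ g) ! (t + j) = x" using x g by (simp add: nth_append)
    moreover have u: "sub t g u = sub t g0 u"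
      by (rule sub_cong[OF uv(2)]) (use g x in auto)
    moreover have "set (sub t g0 u) \<subseteq> {..<t}"
      by (rule sub_letters) (use uv g x in auto)
    ultimately have "head t (sub t g u @ [x] @ sub t g v) = sub t g0 u"
      using head_stop[of "sub t g0 u" t x] x(2) by simp
    moreover have "sub t g w = sub t g u @ [x] @ sub t g v"
      using \<open>([0..<t] @ g) ! (t + j) = x\<close> by (simp add: sub_def uv(1))
    ultimately show ?thesis using x(3) by simp
  qed
  then show ?thesis using uv by (intro exI[of _ u]) auto
qed

lemma head_sub_length:
  assumes "rg t w d" "length g = d" "length (head t g) < d"
  shows "length (head t (sub t g w)) < length w"
  using head_sub[OF assms(1,3)] assms(2) by auto

lemma head_sub_last:
  assumes w: "rg t w d" and g: "length g = Suc d" "length (head t g) < d"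
  shows "head t (take d g) = head t g"
    and "head t (sub t g (w @ [t + d])) = head t (sub t (take d g) w)"
proof -
  obtain u x v where x: "g = u @ x # v" "t \<le> x" "head t g = u" "set u \<subseteq> {..<t}"
    using head_split[of t g] g by auto
  have "take d g = u @ x # take (d - Suc (length u)) v"
    using g x(1,3) by (cases "d - length u") (auto simp: take_Cons')
  then show 1: "head t (take d g) = head t g"
    using head_stop[of u t x] x by simp
  have "sub t g w = sub t (take d g) w"
    by (rule sub_cong[OF rg_set[OF w]]) (use g in auto)
  then show "head t (sub t g (w @ [t + d])) = head t (sub t (take d g) w)"
    using head_sub_length[OF w, of "take d g"] g 1 by (simp add: sub_append head_append)
qed

lemma head_sub_last_const:
  assumes w: "rg t w d" and g: "length g = Suc d" "length (head t g) = d"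
  shows "rg t (take d g) 0" and "head t (sub t g (w @ [t + d])) = sub t (take d g) w"
proof -
  obtain u x v where x: "g = u @ x # v" "t \<le> x" "head t g = u" "set u \<subseteq> {..<t}"
    using head_split[of t g] g by auto
  then have v: "v = []" "length u = d" using g by auto
  show "rg t (take d g) 0" using x v by (simp add: rg_letters)
  have "sub t g w = sub t (take d g) w"
    by (rule sub_cong[OF rg_set[OF w]]) (use g in auto)
  moreover have "set (sub t (take d g) w) \<subseteq> {..<t}"
    by (rule sub_letters) (use rg_set[OF w] x v in auto)
  moreover have "sub t g [t + d] = [x]" using x v by (simp add: sub_def nth_append)
  ultimately show "head t (sub t g (w @ [t + d])) = sub t (take d g) w"
    using head_stop[of "sub t (take d g) w" t x "[]"] x(2) by (simp add: sub_append)
qed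

text \<open>
  The level of a head is its length. The heads of the highest level are obtained by substituting
  constants for all previous parameters; they get the same colour by the Hales-Jewett theorem. Inside
  the subspace found there the lower levels are treated by the induction hypothesis.
\<close>

lemma level_homogeneous:
  "\<exists>n. \<forall>\<kappa> :: nat list \<Rightarrow> nat. (\<forall>w. \<kappa> w < r) \<longrightarrow>
     (\<exists>f C. length f = n \<and> rg t f m \<and>
        (\<forall>g. length g = m \<longrightarrow> length (head t g) < m \<longrightarrow>
           \<kappa> (head t (sub t g f)) = C (length (head t g))))"
proof (induction m)
  case 0
  show ?case by (rule exI[of _ 0]) simp
next
  case (Suc m)
  then obtain M where M: "\<forall>\<kappa> :: nat list \<Rightarrow> nat. (\<forall>w. \<kappa> w < r) \<longrightarrow>
     (\<exists>f C. length f = M \<and> rg t f m \<and>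
        (\<forall>g. length g = m \<longrightarrow> length (head t g) < m \<longrightarrow>
           \<kappa> (head t (sub t g f)) = C (length (head t g))))" by (rule exE)
  obtain N where N: "\<forall>\<kappa> :: nat list \<Rightarrow> nat. (\<forall>w. \<kappa> w < r) \<longrightarrow>
     (\<exists>W c. length W = N \<and> rg t W M \<and> (\<forall>g. length g = M \<longrightarrow> rg t g 0 \<longrightarrow> \<kappa> (sub t g W) = c))"
    using Hales_Jewett_multidim by (rule exE)
  show ?case
  proof (intro exI[of _ "Suc N"] allI impI)
    fix \<kappa> :: "nat list \<Rightarrow> nat" assume \<kappa>: "\<forall>w. \<kappa> w < r"
    from N[THEN spec, THEN mp, OF \<kappa>] obtain F c where F: "length F = N" "rg t F M"
      and c: "\<And>g. length g = M \<Longrightarrow> rg t g 0 \<Longrightarrow> \<kappa> (sub t g F) = c" by (elim exE conjE) metis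
    define \<kappa>' where "\<kappa>' u = \<kappa> (head t (sub t (u @ replicate (M - length u) t) F))" for u
    have "\<forall>w. \<kappa>' w < r" using \<kappa> by (simp add: \<kappa>'_def)
    from M[THEN spec, THEN mp, OF this] obtain f C where f: "length f = M" "rg t f m"
      and C: "\<And>g. length g = m \<Longrightarrow> length (head t g) < m \<Longrightarrow>
           \<kappa>' (head t (sub t g f)) = C (length (head t g))" by (elim exE conjE) metis
    define w where "w = sub t f F"
    have w: "rg t w m" unfolding w_def using rg_sub[OF F(2)] f by simp
    have w_sub: "sub t g w = sub t (sub t g f) F" for g
      unfolding w_def by (rule sub_sub) (use rg_set[OF F(2)] f in simp)
    have \<kappa>': "\<kappa>' (head t h) = \<kappa> (head t (sub t h F))"
      if h: "length h = M" "length (head t h) < M" for h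
    proof -
      obtain v where v: "\<And>g. length g = M \<Longrightarrow> length (head t g) = length (head t h) \<Longrightarrow>
        head t (sub t g F) = sub t (head t g) v" using head_sub[OF F(2) h(2)] by blast
      define h' where "h' = head t h @ replicate (M - length (head t h)) t"
      have "replicate (M - length (head t h)) t = t # replicate (M - length (head t h) - 1) t"
        using h(2) by (cases "M - length (head t h)") auto
      then have "head t h' = head t h" unfolding h'_def
        using head_stop[OF head_letters[of t h] order_refl] by simp
      moreover have "length h' = M" using h by (simp add: h'_def)
      ultimately have "head t (sub t h' F) = head t (sub t h F)" using v h(1) by simp
      then show ?thesis by (simp add: \<kappa>'_def h'_def)
    qed
    have "\<kappa> (head t (sub t g (w @ [t + m]))) = (if length (head t g) < m then C (length (head t g)) else c)"
      if g: "length g = Suc m" "length (head t g) < Suc m" for g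
    proof (cases "length (head t g) < m")
      case True
      have 1: "head t (take m g) = head t g"
        "head t (sub t g (w @ [t + m])) = head t (sub t (sub t (take m g) f) F)"
        using head_sub_last[OF w g(1) True] by (simp_all add: w_sub)
      have "length (head t (sub t (take m g) f)) < M"
        using head_sub_length[OF f(2), of "take m g"] g(1) True 1(1) f(1) by simp
      from \<kappa>'[OF _ this] f(1) have "\<kappa> (head t (sub t (sub t (take m g) f) F)) = \<kappa>' (head t (sub t (take m g) f))"
        by simp
      also have "\<dots> = C (length (head t g))" using C[of "take m g"] 1(1) g(1) True by simp
      finally show ?thesis using 1(2) True by simp
    next
      case False
      then have m: "length (head t g) = m" using g by simp
      have "rg t (sub t (take m g) f) 0"
        by (rule rg_sub[OF f(2)]) (use head_sub_last_const[OF w g(1) m] g in auto)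
      then have "\<kappa> (sub t (sub t (take m g) f) F) = c" using c f(1) by simp
      then show ?thesis using head_sub_last_const[OF w g(1) m] m by (simp add: w_sub)
    qed
    moreover have "rg t (w @ [t + m]) (Suc m)" using rg_append[OF w, of "[t + m]" 1] by simp
    moreover have "length (w @ [t + m]) = Suc N" by (simp add: w_def F)
    ultimately show "\<exists>f C. length f = Suc N \<and> rg t f (Suc m) \<and>
        (\<forall>g. length g = Suc m \<longrightarrow> length (head t g) < Suc m \<longrightarrow>
           \<kappa> (head t (sub t g f)) = C (length (head t g)))"
      by (intro exI[of _ "w @ [t + m]"] exI[of _ "\<lambda>j. if j < m then C j else c"]) simp
  qed
qed

text \<open>
  Replace the parameters whose index is not in \<open>J\<close> by the constant \<open>0\<close>: a head can then end only at an
  index in \<open>J\<close>.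
\<close>

lemma select_levels:
  assumes "0 < t" "J \<subseteq> {..<n}" "card J = m"
  shows "\<exists>h. length h = n \<and> rg t h m \<and>
           (\<forall>g. length g = m \<longrightarrow> length (head t g) < m \<longrightarrow> length (head t (sub t g h)) \<in> J)"
  using assms(2,3)
proof (induction n arbitrary: J m)
  case 0
  then show ?case by (intro exI[of _ "[]"]) auto
next
  case (Suc n)
  have fin: "finite J" using Suc.prems finite_subset by blast
  show ?case
  proof (cases "n \<in> J")
    case True
    then obtain d where d: "m = Suc d" using Suc.prems fin by (cases m) auto
    have "J - {n} \<subseteq> {..<n}" "card (J - {n}) = d" using Suc.prems d True fin by (auto simp: less_Suc_eq)
    from Suc.IH[OF this] obtain h where h: "length h = n" "rg t h d"
      and J: "\<forall>g. length g = d \<longrightarrow> length (head t g) < d \<longrightarrow> length (head t (sub t g h)) \<in> J - {n}"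
      by blast
    have "length (head t (sub t g (h @ [t + d]))) \<in> J"
      if g: "length g = Suc d" "length (head t g) < Suc d" for g
    proof (cases "length (head t g) < d")
      case less: True
      then show ?thesis using head_sub_last[OF h(2) g(1) less] J[rule_format, of "take d g"] g(1) by simp
    next
      case False
      then show ?thesis using head_sub_last_const[OF h(2) g(1)] g h(1) True by simp
    qed
    moreover have "rg t (h @ [t + d]) m" using rg_append[OF h(2), of "[t + d]" 1] d by simp
    ultimately show ?thesis using h d by (intro exI[of _ "h @ [t + d]"]) simp
  next
    case False
    then have "J \<subseteq> {..<n}" using Suc.prems by (auto simp: less_Suc_eq)
    from Suc.IH[OF this Suc.prems(2)] obtain h where h: "length h = n" "rg t h m"
      and J: "\<And>g. length g = m \<Longrightarrow> length (head t g) < m \<Longrightarrow> length (head t (sub t g h)) \<in> J"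
      by blast
    have "head t (sub t g (h @ [0])) = head t (sub t g h)"
      if "length g = m" "length (head t g) < m" for g
      using head_sub_length[OF h(2) that] by (simp add: sub_append head_append)
    moreover have "rg t (h @ [0]) m" using rg_append[OF h(2), of "[0]" 0] assms(1) by simp
    ultimately show ?thesis using h J by (intro exI[of _ "h @ [0]"]) simp
  qed
qed

lemma pigeonhole_classes:
  fixes C :: "nat \<Rightarrow> nat"
  assumes "\<forall>j<r * m + 1. C j < r"
  shows "\<exists>c J. J \<subseteq> {j. j < r * m + 1 \<and> C j = c} \<and> card J = m"
proof -
  have "\<exists>c<r. m \<le> card {j. j < r * m + 1 \<and> C j = c}"
  proof (rule ccontr)
    assume "\<not> ?thesis"
    then have *: "card {j. j < r * m + 1 \<and> C j = c} \<le> m" if "c < r" for c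
      using that nat_le_linear by blast
    have "{..<r * m + 1} = (\<Union>c\<in>{..<r}. {j. j < r * m + 1 \<and> C j = c})" using assms by auto
    then have "r * m + 1 = card (\<Union>c\<in>{..<r}. {j. j < r * m + 1 \<and> C j = c})"
      by (metis card_lessThan)
    also have "\<dots> \<le> (\<Sum>c<r. card {j. j < r * m + 1 \<and> C j = c})" by (rule card_UN_le) simp
    also have "\<dots> \<le> (\<Sum>c<r. m)" by (rule sum_mono) (use * in auto)
    finally show False by simp
  qed
  then obtain c where "m \<le> card {j. j < r * m + 1 \<and> C j = c}" by blast
  then obtain J where "J \<subseteq> {j. j < r * m + 1 \<and> C j = c}" "card J = m"
    by (rule obtain_subset_with_card_n)
  then show ?thesis by blast
qed

text \<open>
  Of sufficiently many homogeneous levels, \<open>m\<close> share their colour, and the other levels can be avoided.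
  If there are no constants, then all heads are empty.
\<close>

lemma heads_homogeneous:
  "\<exists>n. \<forall>\<kappa> :: nat list \<Rightarrow> nat. (\<forall>w. \<kappa> w < r) \<longrightarrow>
     (\<exists>f c. length f = n \<and> rg t f m \<and>
        (\<forall>g. length g = m \<longrightarrow> length (head t g) < m \<longrightarrow> \<kappa> (head t (sub t g f)) = c))"
proof (cases "t = 0")
  case True
  then have "head t w = []" for w by (induction w) auto
  then show ?thesis using rg_upt[of t m]
    by (intro exI[of _ m] allI impI) (rule exI[of _ "[t..<t + m]"], auto)
next
  case False
  then have t: "0 < t" by simp
  define m' where "m' = r * m + 1"
  obtain n where n: "\<forall>\<kappa> :: nat list \<Rightarrow> nat. (\<forall>w. \<kappa> w < r) \<longrightarrow>
     (\<exists>f C. length f = n \<and> rg t f m' \<and>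
        (\<forall>g. length g = m' \<longrightarrow> length (head t g) < m' \<longrightarrow>
           \<kappa> (head t (sub t g f)) = C (length (head t g))))"
    using level_homogeneous by (rule exE)
  show ?thesis
  proof (intro exI[of _ n] allI impI)
    fix \<kappa> :: "nat list \<Rightarrow> nat" assume \<kappa>: "\<forall>w. \<kappa> w < r"
    from n[THEN spec, THEN mp, OF \<kappa>] obtain f C where f: "length f = n" "rg t f m'"
      and C: "\<And>g. length g = m' \<Longrightarrow> length (head t g) < m' \<Longrightarrow>
           \<kappa> (head t (sub t g f)) = C (length (head t g))" by (elim exE conjE) metis
    have "C j < r" if "j < m'" for j
    proof -
      define g where "g = replicate j 0 @ t # replicate (m' - j - 1) t"
      have "head t g = replicate j 0" unfolding g_def by (rule head_stop) (use t in auto)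
      then have "C j = \<kappa> (head t (sub t g f))" using C[of g] that by (simp add: g_def)
      then show ?thesis using \<kappa> by simp
    qed
    then obtain c J where J: "J \<subseteq> {j. j < m' \<and> C j = c}" "card J = m"
      using pigeonhole_classes[of r m C] by (auto simp: m'_def)
    then have "J \<subseteq> {..<m'}" by auto
    from select_levels[OF t this J(2)] obtain h where h: "length h = m'" "rg t h m"
      and hJ: "\<And>g. length g = m \<Longrightarrow> length (head t g) < m \<Longrightarrow> length (head t (sub t g h)) \<in> J"
      by blast
    have "\<kappa> (head t (sub t g (sub t h f))) = c" if g: "length g = m" "length (head t g) < m" for g
    proof -
      have "sub t g (sub t h f) = sub t (sub t g h) f"
        by (rule sub_sub) (use rg_set[OF f(2)] h in simp)
      moreover have "length (head t (sub t g h)) < m'" using hJ[OF g] J by auto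
      ultimately show ?thesis using C[of "sub t g h"] h hJ[OF g] J by auto
    qed
    moreover have "rg t (sub t h f) m" by (rule rg_sub[OF f(2) h])
    ultimately show "\<exists>f c. length f = n \<and> rg t f m \<and>
        (\<forall>g. length g = m \<longrightarrow> length (head t g) < m \<longrightarrow> \<kappa> (head t (sub t g f)) = c)"
      using f by (intro exI[of _ "sub t h f"] exI[of _ c]) simp
  qed
qed

section \<open>The Graham-Rothschild theorem\<close>

text \<open>
  Here \<open>k\<close> is the number of parameters of the words coloured, \<open>m\<close> the dimension of the monochromatic
  subspace, and \<open>r\<close> the number of colours.
\<close>

definition graham_rothschild :: "nat \<Rightarrow> nat \<Rightarrow> bool" where
  "graham_rothschild t k \<longleftrightarrow> (\<forall>m r. \<exists>n. \<forall>\<kappa> :: nat list \<Rightarrow> nat. (\<forall>w. \<kappa> w < r) \<longrightarrow>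
     (\<exists>W c. length W = n \<and> rg t W m \<and>
        (\<forall>g. length g = m \<longrightarrow> rg t g k \<longrightarrow> \<kappa> (sub t g W) = c)))"

text \<open>
  Heads of length below \<open>i\<close> are settled one length after the other. A word with a head \<open>u\<close> of length \<open>i\<close>
  has the form \<open>u @ t # v\<close>, where \<open>v\<close> runs over words with one parameter less and one constant more.
  Colouring \<open>v\<close> by the family of the colours of all these words, for all \<open>u\<close>, the assumption yields a
  subspace of tails on which the colour no longer depends on \<open>v\<close>.
\<close>

lemma colour_determined_by_head:
  assumes GR: "graham_rothschild (Suc t) k"
  shows "\<exists>n. \<forall>\<kappa> :: nat list \<Rightarrow> nat. (\<forall>w. \<kappa> w < r) \<longrightarrow>
     (\<exists>W. length W = n \<and> rg t W (i + m) \<and>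
        (\<forall>g g'. length g = i + m \<longrightarrow> length g' = i + m \<longrightarrow> rg t g (Suc k) \<longrightarrow> rg t g' (Suc k) \<longrightarrow>
           head t g = head t g' \<longrightarrow> length (head t g) < i \<longrightarrow> \<kappa> (sub t g W) = \<kappa> (sub t g' W)))"
proof (induction i arbitrary: m)
  case 0
  show ?case by (intro exI[of _ m] allI impI exI[of _ "[t..<t + m]"]) (use rg_upt in auto)
next
  case (Suc i)
  define D where "D = {w. length w = i \<and> set w \<subseteq> {..<t}}"
  have "finite D" unfolding D_def by (rule finite_words)
  then obtain R h where h: "encodes_families D r R h" using finite_encodes_families by blast
  have "\<exists>M. \<forall>\<kappa> :: nat list \<Rightarrow> nat. (\<forall>w. \<kappa> w < R) \<longrightarrow>
     (\<exists>W c. length W = M \<and> rg (Suc t) W m \<and>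
        (\<forall>g. length g = m \<longrightarrow> rg (Suc t) g k \<longrightarrow> \<kappa> (sub (Suc t) g W) = c))"
    using GR[unfolded graham_rothschild_def, THEN spec, THEN spec] .
  then obtain M where M: "\<forall>\<kappa> :: nat list \<Rightarrow> nat. (\<forall>w. \<kappa> w < R) \<longrightarrow>
     (\<exists>W c. length W = M \<and> rg (Suc t) W m \<and>
        (\<forall>g. length g = m \<longrightarrow> rg (Suc t) g k \<longrightarrow> \<kappa> (sub (Suc t) g W) = c))"
    by (rule exE)
  obtain n where n: "\<forall>\<kappa> :: nat list \<Rightarrow> nat. (\<forall>w. \<kappa> w < r) \<longrightarrow>
     (\<exists>W. length W = n \<and> rg t W (i + Suc M) \<and>
        (\<forall>g g'. length g = i + Suc M \<longrightarrow> length g' = i + Suc M \<longrightarrow> rg t g (Suc k) \<longrightarrow> rg t g' (Suc k) \<longrightarrow>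
           head t g = head t g' \<longrightarrow> length (head t g) < i \<longrightarrow> \<kappa> (sub t g W) = \<kappa> (sub t g' W)))"
    using Suc.IH[of "Suc M"] by (rule exE)
  show ?case
  proof (intro exI[of _ n] allI impI)
    fix \<kappa> :: "nat list \<Rightarrow> nat" assume \<kappa>: "\<forall>w. \<kappa> w < r"
    from n[THEN spec, THEN mp, OF \<kappa>] obtain F where F: "length F = n" "rg t F (i + Suc M)"
      and early: "\<And>g g'. length g = i + Suc M \<Longrightarrow> length g' = i + Suc M \<Longrightarrow> rg t g (Suc k) \<Longrightarrow>
        rg t g' (Suc k) \<Longrightarrow> head t g = head t g' \<Longrightarrow> length (head t g) < i \<Longrightarrow>
        \<kappa> (sub t g F) = \<kappa> (sub t g' F)" by (elim exE conjE) metis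
    have "\<forall>z. h (\<lambda>u. \<kappa> (sub t (u @ t # z) F)) < R" using encodes_families_less[OF h] \<kappa> by simp
    from M[THEN spec, THEN mp, OF this] obtain F' c where F': "length F' = M" "rg (Suc t) F' m"
      and c: "\<And>v. length v = m \<Longrightarrow> rg (Suc t) v k \<Longrightarrow>
        h (\<lambda>u. \<kappa> (sub t (u @ t # sub (Suc t) v F') F)) = c" by (elim exE conjE) metis
    \<comment> \<open>The constant \<open>t\<close> of \<open>F'\<close> stands for the parameter that ends the head, which is number \<open>i\<close> in
      the new word; the parameters of \<open>F'\<close> follow it.\<close>
    define s where "s x = (if x < t then x else x + i)" for x
    define G where "G = [t..<t + Suc i] @ map s F'"
    have G_len: "length G = i + Suc M" by (simp add: G_def F')
    have "rg (t + Suc i) (map s F') m"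
      by (rule rg_map[OF F'(2)]) (auto simp: s_def)
    then have G: "rg t G (Suc i + m)" unfolding G_def by (rule rg_append[OF rg_upt])
    define W where "W = sub t G F"
    have W: "rg t W (Suc i + m)" unfolding W_def by (rule rg_sub[OF F(2) G_len G])
    have W_sub: "sub t g W = sub t (sub t g G) F" for g
      unfolding W_def by (rule sub_sub) (use rg_set[OF F(2)] G_len in simp)
    have init: "sub t g [t..<t + Suc i] = take (Suc i) g" if "length g = Suc i + m" for g
      by (rule nth_equalityI) (use that in \<open>auto simp: sub_def nth_append simp del: upt_Suc\<close>)
    have head_G: "head t (sub t g G) = head t g"
      if g: "length g = Suc i + m" "length (head t g) < Suc i" for g
    proof -
      obtain u x v where x: "g = u @ x # v" "t \<le> x" "head t g = u" "set u \<subseteq> {..<t}"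
        using head_split[of t g] g by auto
      have "take (Suc i) g = u @ x # take (i - length u) v" using g x(1,3)
        by (simp add: Suc_diff_le)
      then have "sub t g G = u @ x # take (i - length u) v @ sub t g (map s F')"
        using init[OF g(1)] by (simp add: G_def sub_append del: upt_Suc)
      then show ?thesis using head_stop[OF x(4) x(2)] x(3) by simp
    qed
    have tail: "sub t g G = u @ t # sub (Suc t) v F'"
      if g: "g = u @ t # v" "length u = i" "length v = m" for g u v
    proof -
      have "sub t g (map s F') = sub (Suc t) v F'" unfolding sub_def map_map
      proof (rule map_cong[OF refl])
        fix x assume "x \<in> set F'"
        then have "x < t + Suc m" using rg_set[OF F'(2)] by auto
        then consider "x < t" | "x = t" | j where "j < m" "x = Suc t + j"
          by (metis add_Suc_shift le_Suc_ex linorder_neqE_nat nat_add_left_cancel_less Suc_leI)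
        then show "((!) ([0..<t] @ g) \<circ> s) x = ([0..<Suc t] @ v) ! x"
          by cases (use g in \<open>auto simp: s_def nth_append simp del: upt_Suc\<close>)
      qed
      moreover have "length g = Suc i + m" using g by simp
      ultimately show ?thesis using init[of g] g by (simp add: G_def sub_append del: upt_Suc)
    qed
    have same: "\<kappa> (sub t g W) = \<kappa> (sub t g' W)"
      if g: "length g = Suc i + m" "length g' = Suc i + m" "rg t g (Suc k)" "rg t g' (Suc k)"
        "head t g = head t g'" "length (head t g) < Suc i" for g g'
    proof (cases "length (head t g) < i")
      case True
      then show ?thesis unfolding W_sub
        using g head_G[of g] head_G[of g'] rg_sub[OF G]
        by (intro early) (auto simp: G_len)
    next
      case False
      obtain u v where v: "g = u @ t # v" "head t g = u" "set u \<subseteq> {..<t}" "rg (Suc t) v k"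
        using rg_head[OF g(3)] by blast
      obtain u' v' where v': "g' = u' @ t # v'" "head t g' = u'" "rg (Suc t) v' k"
        using rg_head[OF g(4)] by blast
      have u: "length u = i" "u' = u" using False g v v' by auto
      then have len: "length v = m" "length v' = m" using g v v' by auto
      have "u \<in> D" using u v by (simp add: D_def)
      have "h (\<lambda>u. \<kappa> (sub t (u @ t # sub (Suc t) v F') F)) =
            h (\<lambda>u. \<kappa> (sub t (u @ t # sub (Suc t) v' F') F))" using c len v v' by simp
      from encodes_families_eq[OF h _ _ this \<open>u \<in> D\<close>] \<kappa>
      have "\<kappa> (sub t (u @ t # sub (Suc t) v F') F) = \<kappa> (sub t (u @ t # sub (Suc t) v' F') F)" by simp
      then show ?thesis unfolding W_sub using tail[OF v(1) u(1) len(1)] tail[of g' u v'] v' u len by simp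
    qed
    have "length W = n" by (simp add: W_def F)
    with W same show "\<exists>W. length W = n \<and> rg t W (Suc i + m) \<and>
        (\<forall>g g'. length g = Suc i + m \<longrightarrow> length g' = Suc i + m \<longrightarrow> rg t g (Suc k) \<longrightarrow> rg t g' (Suc k) \<longrightarrow>
           head t g = head t g' \<longrightarrow> length (head t g) < Suc i \<longrightarrow> \<kappa> (sub t g W) = \<kappa> (sub t g' W))"
      by (intro exI[of _ W] conjI allI impI)
  qed
qed


text \<open>
  Once the colour depends on the head only, it is a colouring of words of constants, and these heads
  are made monochromatic in a further subspace.
\<close>

lemma graham_rothschild_Suc:
  assumes GR: "graham_rothschild (Suc t) k"
  shows "graham_rothschild t (Suc k)"
  unfolding graham_rothschild_def
proof (intro allI)
  fix m r
  show "\<exists>n. \<forall>\<kappa> :: nat list \<Rightarrow> nat. (\<forall>w. \<kappa> w < r) \<longrightarrow>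
     (\<exists>W c. length W = n \<and> rg t W m \<and>
        (\<forall>g. length g = m \<longrightarrow> rg t g (Suc k) \<longrightarrow> \<kappa> (sub t g W) = c))"
  proof -
    obtain M where M: "\<forall>\<kappa> :: nat list \<Rightarrow> nat. (\<forall>w. \<kappa> w < r) \<longrightarrow>
     (\<exists>f c. length f = M \<and> rg t f m \<and>
        (\<forall>g. length g = m \<longrightarrow> length (head t g) < m \<longrightarrow> \<kappa> (head t (sub t g f)) = c))"
      using heads_homogeneous by (rule exE)
    obtain n where n: "\<forall>\<kappa> :: nat list \<Rightarrow> nat. (\<forall>w. \<kappa> w < r) \<longrightarrow>
     (\<exists>W. length W = n \<and> rg t W (M + 0) \<and>
        (\<forall>g g'. length g = M + 0 \<longrightarrow> length g' = M + 0 \<longrightarrow> rg t g (Suc k) \<longrightarrow> rg t g' (Suc k) \<longrightarrow>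
           head t g = head t g' \<longrightarrow> length (head t g) < M \<longrightarrow> \<kappa> (sub t g W) = \<kappa> (sub t g' W)))"
      using colour_determined_by_head[OF GR] by (rule exE)
    show ?thesis
    proof (intro exI[of _ n] allI impI)
      fix \<kappa> :: "nat list \<Rightarrow> nat" assume \<kappa>: "\<forall>w. \<kappa> w < r"
      from n[THEN spec, THEN mp, OF \<kappa>] obtain F where F: "length F = n" "rg t F M"
        and det: "\<And>g g'. length g = M \<Longrightarrow> length g' = M \<Longrightarrow> rg t g (Suc k) \<Longrightarrow>
          rg t g' (Suc k) \<Longrightarrow> head t g = head t g' \<Longrightarrow> length (head t g) < M \<Longrightarrow>
          \<kappa> (sub t g F) = \<kappa> (sub t g' F)" unfolding add_0_right by (elim exE conjE) metis
      \<comment> \<open>Any word with the head \<open>u\<close> may represent it. Such a word exists for the heads considered below,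
        which are heads of words with \<open>Suc k\<close> parameters.\<close>
      define \<kappa>' where "\<kappa>' u = \<kappa> (sub t (SOME g. length g = M \<and> rg t g (Suc k) \<and> head t g = u) F)" for u
      have "\<forall>w. \<kappa>' w < r" using \<kappa> by (simp add: \<kappa>'_def)
      from M[THEN spec, THEN mp, OF this] obtain f c where f: "length f = M" "rg t f m"
        and c: "\<And>g. length g = m \<Longrightarrow> length (head t g) < m \<Longrightarrow> \<kappa>' (head t (sub t g f)) = c"
        by (elim exE conjE) metis
      have "\<kappa> (sub t g (sub t f F)) = c" if g: "length g = m" "rg t g (Suc k)" for g
      proof -
        define h where "h = sub t g f"
        have h: "length h = M" "rg t h (Suc k)" using rg_sub[OF f(2) g] f(1) by (simp_all add: h_def)
        define h' where "h' = (SOME h'. length h' = M \<and> rg t h' (Suc k) \<and> head t h' = head t h)"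
        have h': "length h' = M \<and> rg t h' (Suc k) \<and> head t h' = head t h"
          unfolding h'_def by (rule someI[of _ h]) (use h in simp)
        have "length (head t h) < length h" "length (head t g) < length g"
          using rg_head_length[OF h(2)] rg_head_length[OF g(2)] .
        then have "\<kappa> (sub t h F) = \<kappa> (sub t h' F)" "\<kappa>' (head t h) = c"
          using det[of h h'] h h' c[of g] g(1) by (auto simp: h_def)
        moreover have "sub t g (sub t f F) = sub t h F"
          unfolding h_def by (rule sub_sub) (use rg_set[OF F(2)] f in simp)
        ultimately show ?thesis by (simp add: \<kappa>'_def h'_def)
      qed
      moreover have "rg t (sub t f F) m" by (rule rg_sub[OF F(2) f])
      ultimately show "\<exists>W c. length W = n \<and> rg t W m \<and>
        (\<forall>g. length g = m \<longrightarrow> rg t g (Suc k) \<longrightarrow> \<kappa> (sub t g W) = c)"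
        using F by (intro exI[of _ "sub t f F"] exI[of _ c]) simp
    qed
  qed
qed

theorem Graham_Rothschild: "graham_rothschild t k"
proof (induction k arbitrary: t)
  case 0
  show ?case unfolding graham_rothschild_def by (intro allI Hales_Jewett_multidim)
next
  case (Suc k)
  show ?case by (rule graham_rothschild_Suc[OF Suc.IH])
qed

lemma nth_Cons_less_Suc:
  "(\<exists>q'<Suc q. (x # g) ! q' = c) \<longleftrightarrow> x = c \<or> (\<exists>q'<q. g ! q' = c)"
  by (auto simp: less_Suc_eq_0_disj)

lemma rgI:
  assumes "\<And>q c. q < length g \<Longrightarrow> c < g ! q \<Longrightarrow> c < t \<or> (\<exists>q'<q. g ! q' = c)"
    and "{t..<t + d} \<subseteq> set g" and "set g \<subseteq> {..<t + d}"
  shows "rg t g d"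
  using assms
proof (induction g arbitrary: t d)
  case (Cons x g)
  have "\<not> t < x" using Cons.prems(1)[of 0 t] by auto
  then consider "x < t" | "x = t" by linarith
  then show ?case
  proof cases
    case 1
    have "rg t g d"
    proof (rule Cons.IH)
      fix q c assume "q < length g" "c < g ! q"
      then have "c < t \<or> (\<exists>q'<Suc q. (x # g) ! q' = c)" using Cons.prems(1)[of "Suc q" c] by simp
      then show "c < t \<or> (\<exists>q'<q. g ! q' = c)" using 1 unfolding nth_Cons_less_Suc by auto
    next
      show "{t..<t + d} \<subseteq> set g" "set g \<subseteq> {..<t + d}" using Cons.prems(2,3) 1 by fastforce+
    qed
    then show ?thesis using 1 by simp
  next
    case 2
    then have d: "d > 0" using Cons.prems(3) by auto
    have "rg (Suc t) g (d - 1)"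
    proof (rule Cons.IH)
      fix q c assume "q < length g" "c < g ! q"
      then have "c < t \<or> (\<exists>q'<Suc q. (x # g) ! q' = c)" using Cons.prems(1)[of "Suc q" c] by simp
      then show "c < Suc t \<or> (\<exists>q'<q. g ! q' = c)" using 2 unfolding nth_Cons_less_Suc by auto
    next
      show "{Suc t..<Suc t + (d - 1)} \<subseteq> set g"
      proof
        fix y assume y: "y \<in> {Suc t..<Suc t + (d - 1)}"
        then have "y \<in> {t..<t + d}" by auto
        then have "y \<in> set (x # g)" using Cons.prems(2) by blast
        then show "y \<in> set g" using y 2 by auto
      qed
      show "set g \<subseteq> {..<Suc t + (d - 1)}" using Cons.prems(3) 2 d by auto
    qed
    then show ?thesis using 2 d by simp
  qed
qed simp

lemma rg_earlier:
  assumes "rg t w d" "i < length w" "c < w ! i" "t \<le> c"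
  shows "\<exists>i'<i. w ! i' = c"
  using assms
proof (induction t w d arbitrary: i rule: rg.induct)
  case (2 t x xs d)
  then obtain j where j: "i = Suc j" by (cases i) auto
  show ?case
  proof (cases "x < t")
    case True
    then have "\<exists>i'<j. xs ! i' = c" using 2 j by auto
    then show ?thesis using j by auto
  next
    case False
    then have x: "x = t" "rg (Suc t) xs (d - 1)" using 2(3) by auto
    show ?thesis
    proof (cases "c = t")
      case True
      then show ?thesis using x j by auto
    next
      case False
      then have "\<exists>i'<j. xs ! i' = c" using 2(2)[of j] x 2(4-6) j by simp
      then show ?thesis using j by auto
    qed
  qed
qed simp

lemma rg_occurs: "rg t w d \<Longrightarrow> t \<le> c \<Longrightarrow> c < t + d \<Longrightarrow> c \<in> set w"
  using rg_first_occurrence[of t w d "c - t"] by fastforce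

section \<open>Colexicographic order\<close>

lemma set_encode_less_power: "A \<subseteq> {..<n} \<Longrightarrow> set_encode A < 2 ^ n"
proof -
  assume A: "A \<subseteq> {..<n}"
  have "set_encode A \<le> (\<Sum>i<n. 2 ^ i)" unfolding set_encode_def
    by (rule sum_mono2) (use A in auto)
  also have "\<dots> < 2 ^ n" by (induction n) auto
  finally show ?thesis .
qed

lemma set_encode_mono: "finite B \<Longrightarrow> A \<subseteq> B \<Longrightarrow> set_encode A \<le> set_encode B"
  unfolding set_encode_def by (rule sum_mono2) auto

text \<open>
  Binary codes order the finite sets colexicographically, that is, by the largest element that belongs
  to only one of them: all smaller powers of two together are less than its own.
\<close>

lemma set_encode_colexI:
  assumes fin: "finite A" "finite B" and m: "m \<in> B - A" and above: "\<And>j. m < j \<Longrightarrow> j \<in> A \<longleftrightarrow> j \<in> B"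
  shows "set_encode A < set_encode B"
proof -
  define U where "U = {j \<in> A. m < j}"
  have U: "U = {j \<in> B. m < j}" using above by (auto simp: U_def)
  have A: "A = (A \<inter> {..<m}) \<union> U"
  proof (intro equalityI subsetI)
    fix x assume "x \<in> A"
    moreover from this have "x \<noteq> m" using m by auto
    ultimately show "x \<in> (A \<inter> {..<m}) \<union> U" by (auto simp: U_def)
  qed (auto simp: U_def)
  have "set_encode ((A \<inter> {..<m}) \<union> U) = set_encode (A \<inter> {..<m}) + set_encode U"
    unfolding set_encode_def by (rule sum.union_disjoint) (use fin in \<open>auto simp: U_def\<close>)
  then have "set_encode A = set_encode (A \<inter> {..<m}) + set_encode U" using A by simp
  also have "\<dots> < 2 ^ m + set_encode U" using set_encode_less_power[of "A \<inter> {..<m}" m] by simp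
  also have "\<dots> = set_encode (insert m U)" using fin by (subst set_encode_insert) (auto simp: U_def)
  also have "\<dots> \<le> set_encode B" by (rule set_encode_mono) (use fin U m in auto)
  finally show ?thesis .
qed

lemma set_encode_colexD:
  assumes fin: "finite A" "finite B" and less: "set_encode A < set_encode B"
  shows "\<exists>m\<in>B - A. \<forall>j>m. j \<in> A \<longleftrightarrow> j \<in> B"
proof -
  define D where "D = (A - B) \<union> (B - A)"
  have "A \<noteq> B" using less by auto
  then have D: "finite D" "D \<noteq> {}" using fin by (auto simp: D_def)
  have above: "j \<in> A \<longleftrightarrow> j \<in> B" if "Max D < j" for j
    using that Max_ge[OF D(1), of j] by (auto simp: D_def)
  have "Max D \<notin> A - B"
    using set_encode_colexI[OF fin(2,1), of "Max D"] above less by auto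
  then have "Max D \<in> B - A" using Max_in[OF D] by (auto simp: D_def)
  then show ?thesis using above by blast
qed

section \<open>Complexes and nerves\<close>

text \<open>
  A simplicial complex with the vertices \<open>0, \<dots>, n - 1\<close>. The empty face is included, so that a subset of the
  vertices is a face exactly if its image under an embedding is one. The predicate \<open>ok\<close> stands for the
  bound on the sizes of faces, so that the bounded and the unbounded case can be treated together.
\<close>

definition complex_on :: "(nat \<Rightarrow> bool) \<Rightarrow> nat \<Rightarrow> nat set set \<Rightarrow> bool" where
  "complex_on ok n E \<longleftrightarrow> (\<forall>u\<in>E. u \<subseteq> {..<n} \<and> ok (card u)) \<and> (\<forall>u v. u \<subseteq> v \<longrightarrow> v \<in> E \<longrightarrow> u \<in> E) \<and>
     {} \<in> E \<and> (\<forall>i<n. {i} \<in> E)"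

definition ordered_embedding :: "nat \<Rightarrow> nat set set \<Rightarrow> nat set set \<Rightarrow> (nat \<Rightarrow> nat) \<Rightarrow> bool" where
  "ordered_embedding n E F f \<longleftrightarrow> strict_mono_on {..<n} f \<and> (\<forall>u\<subseteq>{..<n}. u \<in> E \<longleftrightarrow> f ` u \<in> F)"

text \<open>
  The faces in colexicographic order.
\<close>

definition face :: "nat set set \<Rightarrow> nat \<Rightarrow> nat set" where
  "face E q = set_decode (sorted_list_of_set (set_encode ` E) ! q)"

lemma complex_on_mono: "complex_on ok n E \<Longrightarrow> u \<subseteq> v \<Longrightarrow> v \<in> E \<Longrightarrow> u \<in> E"
  unfolding complex_on_def by blast

lemma complex_on_vertices: "complex_on ok n E \<Longrightarrow> u \<in> E \<Longrightarrow> u \<subseteq> {..<n}"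
  unfolding complex_on_def by blast

lemma complex_on_finite: "complex_on ok n E \<Longrightarrow> finite E"
  unfolding complex_on_def by (rule finite_subset[of _ "Pow {..<n}"]) auto

lemma complex_on_face_finite: "complex_on ok n E \<Longrightarrow> u \<in> E \<Longrightarrow> finite u"
  unfolding complex_on_def by (meson finite_lessThan finite_subset)

lemma card_encode:
  assumes "complex_on ok n E"
  shows "card (set_encode ` E) = card E"
proof (rule card_image)
  show "inj_on set_encode E"
    using complex_on_face_finite[OF assms] by (auto intro!: inj_on_subset[OF inj_on_set_encode])
qed

lemma face_in:
  assumes "complex_on ok n E" "q < card E"
  shows "face E q \<in> E"
proof -
  have "sorted_list_of_set (set_encode ` E) ! q \<in> set (sorted_list_of_set (set_encode ` E))"
    using assms card_encode by (intro nth_mem) simp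
  then obtain u where "u \<in> E" "sorted_list_of_set (set_encode ` E) ! q = set_encode u"
    using complex_on_finite[OF assms(1)] by auto
  then show ?thesis using complex_on_face_finite[OF assms(1)] by (simp add: face_def)
qed

lemma face_surj:
  assumes "complex_on ok n E" "u \<in> E"
  shows "\<exists>q<card E. face E q = u"
proof -
  have "set_encode u \<in> set (sorted_list_of_set (set_encode ` E))"
    using complex_on_finite[OF assms(1)] assms by simp
  then obtain q where "q < card E" "sorted_list_of_set (set_encode ` E) ! q = set_encode u"
    using card_encode[OF assms(1)] by (auto simp: in_set_conv_nth)
  then show ?thesis using complex_on_face_finite[OF assms] by (auto simp: face_def)
qed

lemma face_less_iff:
  assumes "complex_on ok n E" "q < card E" "q' < card E"
  shows "q < q' \<longleftrightarrow> set_encode (face E q) < set_encode (face E q')"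
proof -
  let ?l = "sorted_list_of_set (set_encode ` E)"
  have l: "sorted_wrt (<) ?l" "length ?l = card E"
    using card_encode[OF assms(1)] by simp_all
  have "set_encode (face E p) = ?l ! p" for p
    by (simp add: face_def)
  moreover have "?l ! q < ?l ! q'" if "q < q'"
    using sorted_wrt_nth_less[OF l(1) that] l(2) assms by simp
  moreover have "?l ! q' < ?l ! q" if "q' < q"
    using sorted_wrt_nth_less[OF l(1) that] l(2) assms by simp
  ultimately show ?thesis by (cases q q' rule: linorder_cases) auto
qed

lemma ordered_embedding_iff:
  "ordered_embedding n E F f \<Longrightarrow> u \<subseteq> {..<n} \<Longrightarrow> u \<in> E \<longleftrightarrow> f ` u \<in> F"
  by (simp add: ordered_embedding_def)

lemma ordered_embedding_mono: "ordered_embedding n E F f \<Longrightarrow> strict_mono_on {..<n} f"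
  by (simp add: ordered_embedding_def)

definition size_bound :: "(nat \<Rightarrow> bool) \<Rightarrow> bool" where
  "size_bound ok \<longleftrightarrow> ok 1 \<and> (\<forall>m n. m \<le> n \<longrightarrow> ok n \<longrightarrow> ok m)"

text \<open>
  The letters of \<open>w\<close> are numbers of faces of \<open>E\<close>. Such a word describes one set of positions for each
  vertex: those whose letter is a face that contains the vertex.
\<close>

definition cell :: "nat set set \<Rightarrow> nat list \<Rightarrow> nat \<Rightarrow> nat set" where
  "cell E w j = {i. i < length w \<and> j \<in> face E (w ! i)}"

text \<open>
  The set of positions that belongs to a vertex is coded by a number whose order depends on the minimum of
  the set first; modulo the power of two the number is the binary code of the set.
\<close>

definition vert :: "nat set set \<Rightarrow> nat list \<Rightarrow> nat \<Rightarrow> nat" where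
  "vert E w j = Min (cell E w j) * 2 ^ length w + set_encode (cell E w j)"

text \<open>
  Each number below \<open>N * 2 ^ N\<close> is read as a subset of \<open>{..<N}\<close>, its least significant binary digits. This is
  the nerve of the resulting family, restricted to the sizes allowed.
\<close>

definition nerve :: "(nat \<Rightarrow> bool) \<Rightarrow> nat \<Rightarrow> nat set set" where
  "nerve ok N = {u. u \<subseteq> {..<N * 2 ^ N} \<and> ok (card u) \<and>
     (card u \<le> 1 \<or> (\<exists>i. \<forall>v\<in>u. i \<in> set_decode (v mod 2 ^ N)))}"

lemma size_bound_mono:
  assumes "size_bound ok" "m \<le> k" "ok k"
  shows "ok m"
  using assms(1)[unfolded size_bound_def, THEN conjunct2, THEN spec, THEN spec, THEN mp, THEN mp,
    OF assms(2,3)] .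

lemma size_bound_1:
  assumes "size_bound ok"
  shows "ok 1"
  using assms[unfolded size_bound_def, THEN conjunct1] .

lemma complex_on_nerve:
  assumes "size_bound ok"
  shows "complex_on ok (N * 2 ^ N) (nerve ok N)"
proof -
  have "u \<in> nerve ok N" if "u \<subseteq> v" "v \<in> nerve ok N" for u v
  proof -
    have "finite v" using that finite_subset by (auto simp: nerve_def)
    then have "card u \<le> card v" using that card_mono by blast
    then have "ok (card u)" using size_bound_mono[OF assms] that unfolding nerve_def by simp
    moreover have "card u \<le> 1 \<or> (\<exists>i. \<forall>v\<in>u. i \<in> set_decode (v mod 2 ^ N))"
      using that \<open>card u \<le> card v\<close> unfolding nerve_def by fastforce
    ultimately show ?thesis using that unfolding nerve_def by blast
  qed
  then have down: "\<forall>u v. u \<subseteq> v \<longrightarrow> v \<in> nerve ok N \<longrightarrow> u \<in> nerve ok N" by (intro allI impI)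
  have ok1: "ok 1" by (rule size_bound_1[OF assms])
  have "ok 0" by (rule size_bound_mono[OF assms _ ok1]) simp
  then have "{} \<in> nerve ok N" "\<forall>i<N * 2 ^ N. {i} \<in> nerve ok N"
    using ok1 by (simp_all add: nerve_def)
  moreover have "\<forall>u\<in>nerve ok N. u \<subseteq> {..<N * 2 ^ N} \<and> ok (card u)" by (simp add: nerve_def)
  ultimately show ?thesis unfolding complex_on_def using down by (intro conjI)
qed

context
  fixes ok n E w
  assumes E: "complex_on ok n E" and w: "rg 0 w (card E)"
begin

lemma letter_less: "i < length w \<Longrightarrow> w ! i < card E"
  using subsetD[OF rg_set[OF w] nth_mem[of i w]] by simp

lemma cell_subset: "cell E w j \<subseteq> {..<length w}"
  by (auto simp: cell_def)

lemma finite_cell: "finite (cell E w j)"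
  using cell_subset finite_subset by blast

lemma face_occurs:
  assumes "u \<in> E"
  shows "\<exists>i<length w. face E (w ! i) = u"
proof -
  obtain q where "q < card E" "face E q = u" using face_surj[OF E assms] by blast
  moreover from this have "q \<in> set w" using rg_occurs[OF w, of q] by simp
  ultimately show ?thesis by (auto simp: in_set_conv_nth)
qed

lemma cell_nonempty: "j < n \<Longrightarrow> cell E w j \<noteq> {}"
  using face_occurs[of "{j}"] E by (auto simp: complex_on_def cell_def)

lemma Min_cell_less: "j < n \<Longrightarrow> Min (cell E w j) < length w"
  using Min_in[OF finite_cell cell_nonempty] cell_subset by fastforce

text \<open>
  The face \<open>{j}\<close> comes before all faces that contain the larger vertex \<open>j'\<close> in the colexicographic order.
  By restricted growth its number occurs in the word before theirs.
\<close>

lemma Min_cell_mono: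
  assumes "j < j'" "j' < n"
  shows "Min (cell E w j) < Min (cell E w j')"
proof -
  define i' where "i' = Min (cell E w j')"
  have "i' \<in> cell E w j'" unfolding i'_def using assms by (intro Min_in finite_cell cell_nonempty) auto
  then have i': "i' < length w" "j' \<in> face E (w ! i')" by (auto simp: cell_def)
  have "{j} \<in> E" using assms E by (auto simp: complex_on_def)
  from face_surj[OF E this] obtain q where q: "q < card E" "face E q = {j}" by blast
  have fin: "finite (face E (w ! i'))"
    using complex_on_face_finite[OF E face_in[OF E letter_less[OF i'(1)]]] .
  have "set_encode {j} < set_encode {j'}" by (rule set_encode_colexI[of _ _ j']) (use assms in auto)
  also have "\<dots> \<le> set_encode (face E (w ! i'))" by (rule set_encode_mono) (use fin i' in auto)
  finally have "q < w ! i'" using face_less_iff[OF E q(1) letter_less[OF i'(1)]] q(2) by simp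
  then obtain i where i: "i < i'" "w ! i = q" using rg_earlier[OF w i'(1)] by auto
  then have "i \<in> cell E w j" using i'(1) q(2) by (simp add: cell_def)
  then have "Min (cell E w j) \<le> i" using finite_cell by simp
  then show ?thesis using i(1) by (simp add: i'_def)
qed

lemma decode_vert: "set_decode (vert E w j mod 2 ^ length w) = cell E w j"
  using set_encode_less_power[OF cell_subset] finite_cell by (simp add: vert_def)

lemma vert_mono:
  assumes "j < j'" "j' < n"
  shows "vert E w j < vert E w j'"
proof -
  have "vert E w j < Min (cell E w j) * 2 ^ length w + 2 ^ length w"
    using set_encode_less_power[OF cell_subset, of j] by (simp add: vert_def)
  also have "\<dots> = Suc (Min (cell E w j)) * 2 ^ length w" by simp
  also have "\<dots> \<le> Min (cell E w j') * 2 ^ length w"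
    using Min_cell_mono[OF assms] by (intro mult_le_mono1) simp
  also have "\<dots> \<le> vert E w j'" by (simp add: vert_def)
  finally show ?thesis .
qed

lemma vert_less:
  assumes "j < n"
  shows "vert E w j < length w * 2 ^ length w"
proof -
  have "vert E w j < Min (cell E w j) * 2 ^ length w + 2 ^ length w"
    using set_encode_less_power[OF cell_subset, of j] by (simp add: vert_def)
  also have "\<dots> = Suc (Min (cell E w j)) * 2 ^ length w" by simp
  also have "\<dots> \<le> length w * 2 ^ length w"
    using Min_cell_less[OF assms] by (intro mult_le_mono1) simp
  finally show ?thesis .
qed

text \<open>
  A face \<open>u\<close> occurs as a letter, and the position where it does is common to the sets of its vertices.
  Conversely the letter at a common position is a face that contains \<open>u\<close>.
\<close>

lemma vert_embedding: "ordered_embedding n E (nerve ok (length w)) (vert E w)"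
  unfolding ordered_embedding_def
proof (intro conjI allI impI)
  show mono: "strict_mono_on {..<n} (vert E w)"
    by (auto simp: strict_mono_on_def vert_mono)
  fix u assume u: "u \<subseteq> {..<n}"
  have "inj_on (vert E w) u" using strict_mono_on_imp_inj_on[OF mono] u inj_on_subset by blast
  then have card: "card (vert E w ` u) = card u" by (rule card_image)
  show "u \<in> E \<longleftrightarrow> vert E w ` u \<in> nerve ok (length w)"
  proof
    assume "u \<in> E"
    then obtain i where i: "i < length w" "face E (w ! i) = u" using face_occurs by blast
    have "ok (card u)" using \<open>u \<in> E\<close> E by (auto simp: complex_on_def)
    moreover have "\<forall>j\<in>u. i \<in> cell E w j" using i by (simp add: cell_def)
    moreover have "vert E w ` u \<subseteq> {..<length w * 2 ^ length w}" using u vert_less by auto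
    ultimately show "vert E w ` u \<in> nerve ok (length w)"
      unfolding nerve_def by (auto simp: card decode_vert)
  next
    assume "vert E w ` u \<in> nerve ok (length w)"
    then consider "card u \<le> 1" | i where "\<forall>j\<in>u. i \<in> cell E w j"
      unfolding nerve_def by (auto simp: card decode_vert)
    then show "u \<in> E"
    proof cases
      case 1
      have "finite u" using u finite_subset by blast
      then have "u = {} \<or> (\<exists>j. u = {j})" using 1 by (metis One_nat_def card_0_eq card_1_singletonE le_Suc_eq le_zero_eq)
      then show ?thesis using E u by (auto simp: complex_on_def)
    next
      case 2
      show ?thesis
      proof (cases "u = {}")
        case True
        then show ?thesis using E by (simp add: complex_on_def)
      next
        case False
        then have "i < length w" "u \<subseteq> face E (w ! i)" using 2 by (auto simp: cell_def)
        moreover from this have "face E (w ! i) \<in> E" by (intro face_in[OF E] letter_less)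
        ultimately show ?thesis using E by (auto simp: complex_on_def)
      qed
    qed
  qed
qed

end

section \<open>The Ramsey property of ordered complexes\<close>

lemma colex_image_less:
  assumes "strict_mono_on {..<a} f" "u \<subseteq> {..<a}" "v \<subseteq> {..<a}" "set_encode u < set_encode v"
  shows "set_encode (f ` u) < set_encode (f ` v)"
proof -
  have fin: "finite u" "finite v" using assms finite_subset by blast+
  obtain m where m: "m \<in> v - u" "\<forall>j>m. j \<in> u \<longleftrightarrow> j \<in> v"
    using set_encode_colexD[OF fin assms(4)] by blast
  have less: "f i < f j \<longleftrightarrow> i < j" if "i < a" "j < a" for i j
    using that strict_mono_on_less[OF assms(1)] by auto
  have inj: "inj_on f {..<a}" using assms(1) by (rule strict_mono_on_imp_inj_on)
  show ?thesis
  proof (rule set_encode_colexI[of _ _ "f m"])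
    show "f m \<in> f ` v - f ` u"
      using m assms(2,3) inj by (auto dest!: inj_onD)
    fix y assume y: "f m < y"
    have "j \<in> u \<longleftrightarrow> j \<in> v" if "j < a" "y = f j" for j
    proof -
      have "m < j" using less[of m j] y that m(1) assms(3) by auto
      then show ?thesis using m(2) by blast
    qed
    then show "y \<in> f ` u \<longleftrightarrow> y \<in> f ` v" using assms(2,3) by blast
  qed (use fin in auto)
qed

definition face_index :: "nat set set \<Rightarrow> nat set \<Rightarrow> nat" where
  "face_index E u = (SOME q. q < card E \<and> face E q = u)"

lemma face_index:
  assumes "complex_on ok n E" "u \<in> E"
  shows "face_index E u < card E" "face E (face_index E u) = u"
proof -
  have "\<exists>q. q < card E \<and> face E q = u" using face_surj[OF assms] by simp
  then have "face_index E u < card E \<and> face E (face_index E u) = u"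
    unfolding face_index_def by (rule someI_ex)
  then show "face_index E u < card E" "face E (face_index E u) = u" by simp_all
qed

text \<open>
  Preimages under an embedding of \<open>A\<close> in \<open>B\<close> map the faces of \<open>B\<close> to faces of \<open>A\<close>.
\<close>

definition pullback_word :: "nat set set \<Rightarrow> nat \<Rightarrow> nat set set \<Rightarrow> (nat \<Rightarrow> nat) \<Rightarrow> nat list" where
  "pullback_word A a B f =
     map (\<lambda>q. face_index A {i. i < a \<and> f i \<in> face B q}) [0..<card B]"

context
  fixes ok a A b B f
  assumes A: "complex_on ok a A" and B: "complex_on ok b B"
    and f: "ordered_embedding a A B f" and fb: "\<forall>i<a. f i < b"
begin

lemma pullback_face:
  assumes "q < card B"
  shows "pullback_word A a B f ! q < card A"
    and "face A (pullback_word A a B f ! q) = {i. i < a \<and> f i \<in> face B q}"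
proof -
  define u where "u = {i. i < a \<and> f i \<in> face B q}"
  have "f ` u \<in> B" by (rule complex_on_mono[OF B _ face_in[OF B assms]]) (auto simp: u_def)
  moreover have "u \<subseteq> {..<a}" by (auto simp: u_def)
  ultimately have "u \<in> A" using ordered_embedding_iff[OF f] by simp
  moreover have "pullback_word A a B f ! q = face_index A u"
    using assms by (simp add: pullback_word_def u_def)
  ultimately show "pullback_word A a B f ! q < card A"
    "face A (pullback_word A a B f ! q) = {i. i < a \<and> f i \<in> face B q}"
    using face_index[OF A] by (simp_all add: u_def)
qed

lemma pullback_image_face:
  assumes "p < card A"
  shows "\<exists>q<card B. face B q = f ` face A p \<and> pullback_word A a B f ! q = p"
proof -
  have p: "face A p \<in> A" "face A p \<subseteq> {..<a}"
    using face_in[OF A assms] complex_on_vertices[OF A] by auto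
  then have "f ` face A p \<in> B" using ordered_embedding_iff[OF f] by simp
  from face_surj[OF B this] obtain q where q: "q < card B" "face B q = f ` face A p" by blast
  have inj: "inj_on f {..<a}" using strict_mono_on_imp_inj_on[OF ordered_embedding_mono[OF f]] .
  have "face A (pullback_word A a B f ! q) = face A p"
    unfolding pullback_face(2)[OF q(1)] q(2) using p(2) inj by (auto dest: inj_onD)
  then have "pullback_word A a B f ! q = p"
    using face_less_iff[OF A assms pullback_face(1)[OF q(1)]]
      face_less_iff[OF A pullback_face(1)[OF q(1)] assms] by simp
  then show ?thesis using q by blast
qed

text \<open>
  Every face \<open>u\<close> of \<open>A\<close> is the preimage of \<open>f ` u\<close>, which is the first face of \<open>B\<close> with this preimage, and \<open>f\<close>
  preserves the colexicographic order.
\<close>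

lemma rg_pullback: "rg 0 (pullback_word A a B f) (card A)"
proof (rule rgI)
  let ?g = "pullback_word A a B f"
  have len: "length ?g = card B" by (simp add: pullback_word_def)
  fix q p assume q: "q < length ?g" and p: "p < ?g ! q"
  have q': "q < card B" and p': "p < card A" using q p pullback_face(1)[of q] len by auto
  obtain r where r: "r < card B" "face B r = f ` face A p" "?g ! r = p"
    using pullback_image_face[OF p'] by blast
  have sub: "face A c \<subseteq> {..<a}" if "c < card A" for c
    using face_in[OF A that] complex_on_vertices[OF A] by auto
  have "set_encode (face A p) < set_encode (face A (?g ! q))"
    using face_less_iff[OF A p' pullback_face(1)[OF q']] p by simp
  then have "set_encode (f ` face A p) < set_encode (f ` face A (?g ! q))"
    by (intro colex_image_less[OF ordered_embedding_mono[OF f]] sub p' pullback_face(1)[OF q'])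
  also have "\<dots> \<le> set_encode (face B q)"
    by (rule set_encode_mono)
      (use complex_on_face_finite[OF B face_in[OF B q']] pullback_face(2)[OF q'] in auto)
  finally have "r < q" using face_less_iff[OF B r(1) q'] r(2) by simp
  then show "p < 0 \<or> (\<exists>q'<q. ?g ! q' = p)" using r(3) by blast
next
  show "{0..<0 + card A} \<subseteq> set (pullback_word A a B f)"
  proof
    fix p assume "p \<in> {0..<0 + card A}"
    then obtain q where "q < card B" "pullback_word A a B f ! q = p"
      using pullback_image_face[of p] by auto
    moreover have "length (pullback_word A a B f) = card B" by (simp add: pullback_word_def)
    ultimately show "p \<in> set (pullback_word A a B f)" using nth_mem by metis
  qed
  show "set (pullback_word A a B f) \<subseteq> {..<0 + card A}"
    using pullback_face(1) by (auto simp: pullback_word_def)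
qed

lemma vert_pullback:
  assumes "rg 0 w (card B)" "i < a"
  shows "vert A (sub 0 (pullback_word A a B f) w) i = vert B w (f i)"
proof -
  have "w ! q < card B" if "q < length w" for q
    using subsetD[OF rg_set[OF assms(1)] nth_mem[OF that]] by simp
  then have "i \<in> face A (sub 0 (pullback_word A a B f) w ! q) \<longleftrightarrow> f i \<in> face B (w ! q)"
    if "q < length w" for q
    using pullback_face(2)[of "w ! q"] assms(2) that by (simp add: sub_def)
  then have "cell A (sub 0 (pullback_word A a B f) w) i = cell B w (f i)"
    by (auto simp: cell_def)
  then show ?thesis by (simp add: vert_def)
qed

end

text \<open>
  Words of restricted growth over the faces of \<open>A\<close> are copies of \<open>A\<close> in the nerve, so a colouring of the
  copies is a colouring of such words. A monochromatic subspace for it is a word over the faces of \<open>B\<close>, hence a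
  copy of \<open>B\<close>, and its restrictions to \<open>A\<close> are elements of the subspace.
\<close>

theorem Ramsey_ordered_complexes:
  assumes bound: "size_bound ok" and A: "complex_on ok a A" and B: "complex_on ok b B"
  shows "\<exists>c C. complex_on ok c C \<and> (\<forall>\<kappa> :: nat list \<Rightarrow> bool.
     \<exists>h col. ordered_embedding b B C h \<and> (\<forall>i<b. h i < c) \<and>
       (\<forall>f. ordered_embedding a A B f \<longrightarrow> (\<forall>i<a. f i < b) \<longrightarrow> \<kappa> (map (h \<circ> f) [0..<a]) = col))"
proof -
  obtain N where N: "\<forall>\<kappa> :: nat list \<Rightarrow> nat. (\<forall>w. \<kappa> w < 2) \<longrightarrow>
     (\<exists>W c. length W = N \<and> rg 0 W (card B) \<and>
        (\<forall>g. length g = card B \<longrightarrow> rg 0 g (card A) \<longrightarrow> \<kappa> (sub 0 g W) = c))"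
    using Graham_Rothschild[of 0 "card A", unfolded graham_rothschild_def, THEN spec, THEN spec]
    by (rule exE)
  have "\<exists>h col. ordered_embedding b B (nerve ok N) h \<and> (\<forall>i<b. h i < N * 2 ^ N) \<and>
       (\<forall>f. ordered_embedding a A B f \<longrightarrow> (\<forall>i<a. f i < b) \<longrightarrow> \<kappa> (map (h \<circ> f) [0..<a]) = col)"
    for \<kappa> :: "nat list \<Rightarrow> bool"
  proof -
    define \<kappa>' :: "nat list \<Rightarrow> nat" where
      "\<kappa>' w = (if \<kappa> (map (vert A w) [0..<a]) then 1 else 0)" for w
    have "\<forall>w. \<kappa>' w < 2" by (simp add: \<kappa>'_def)
    from N[THEN spec, THEN mp, OF this] obtain W c where W: "length W = N" "rg 0 W (card B)"
      and c: "\<And>g. length g = card B \<Longrightarrow> rg 0 g (card A) \<Longrightarrow> \<kappa>' (sub 0 g W) = c"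
      by (elim exE conjE) metis
    have mono: "\<kappa> (map (vert B W \<circ> f) [0..<a]) = (c = 1)"
      if f: "ordered_embedding a A B f" "\<forall>i<a. f i < b" for f
    proof -
      define g where "g = pullback_word A a B f"
      have "\<kappa>' (sub 0 g W) = c"
        using c[of g] rg_pullback[OF A B f] by (simp add: g_def pullback_word_def)
      moreover have "map (vert A (sub 0 g W)) [0..<a] = map (vert B W \<circ> f) [0..<a]"
        using vert_pullback[OF A B f W(2)] by (simp add: g_def)
      ultimately show ?thesis by (auto simp: \<kappa>'_def split: if_splits)
    qed
    have "ordered_embedding b B (nerve ok N) (vert B W)"
      using vert_embedding[OF B W(2)] W(1) by simp
    moreover have "\<forall>i<b. vert B W i < N * 2 ^ N"
      using vert_less[OF B W(2)] W(1) by simp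
    ultimately show ?thesis
      using mono by (intro exI[of _ "vert B W"]) (rule exI[of _ "c = 1"], intro conjI allI impI, simp_all)
  qed
  then show ?thesis
    by (intro exI[of _ "N * 2 ^ N"]) (rule exI[of _ "nerve ok N"], intro conjI allI complex_on_nerve[OF bound])
qed

section \<open>The ordering property\<close>

lemma linear_orderD:
  assumes "strict_linear_order_on UNIV (Collect p)"
  shows "\<not> p (x, x)" "p (x, y) \<Longrightarrow> p (y, z) \<Longrightarrow> p (x, z)" "x \<noteq> y \<Longrightarrow> p (x, y) \<or> p (y, x)"
    "p (x, y) \<Longrightarrow> \<not> p (y, x)"
proof -
  have t: "trans (Collect p)" and i: "irrefl (Collect p)" and tot: "total (Collect p)"
    using assms by (auto simp: strict_linear_order_on_def)
  show irr: "\<not> p (x, x)" for x using i by (auto simp: irrefl_def)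
  show tr: "p (x, y) \<Longrightarrow> p (y, z) \<Longrightarrow> p (x, z)" for x y z using t by (auto dest: transD)
  show "x \<noteq> y \<Longrightarrow> p (x, y) \<or> p (y, x)" using tot by (auto simp: total_on_def)
  show "p (x, y) \<Longrightarrow> \<not> p (y, x)" using irr tr by blast
qed

lemma finite_order_enumeration:
  assumes p: "strict_linear_order_on UNIV (Collect p)" and F: "finite F"
  shows "\<exists>s. bij_betw s {..<card F} F \<and> (\<forall>j<card F. \<forall>i<j. p (s i, s j))"
proof -
  define rank where "rank x = card {y \<in> F. p (y, x)}" for x
  have less: "rank x < rank y" if "x \<in> F" "y \<in> F" "p (x, y)" for x y
    unfolding rank_def
  proof (rule psubset_card_mono)
    show "{z \<in> F. p (z, x)} \<subset> {z \<in> F. p (z, y)}"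
      using that linear_orderD[OF p] by blast
  qed (use F in simp)
  have inj: "inj_on rank F"
  proof (rule inj_onI, rule ccontr)
    fix x y assume "x \<in> F" "y \<in> F" "rank x = rank y" "x \<noteq> y"
    then show False using less[of x y] less[of y x] linear_orderD(3)[OF p, of x y] by auto
  qed
  have "rank x < card F" if "x \<in> F" for x
    unfolding rank_def by (rule psubset_card_mono) (use F that linear_orderD(1)[OF p] in auto)
  then have "rank ` F \<subseteq> {..<card F}" by auto
  moreover have "card (rank ` F) = card {..<card F}" using card_image[OF inj] by simp
  ultimately have "rank ` F = {..<card F}" using card_subset_eq[of "{..<card F}" "rank ` F"] by simp
  then have rank: "bij_betw rank F {..<card F}" using inj by (simp add: bij_betw_def)
  define s where "s = inv_into F rank"
  have s: "bij_betw s {..<card F} F" unfolding s_def by (rule bij_betw_inv_into[OF rank])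
  have rank_s: "rank (s i) = i" "s i \<in> F" if "i < card F" for i
    using rank that s unfolding s_def by (auto simp: bij_betw_inv_into_right bij_betw_apply)
  have "p (s i, s j)" if "i < j" "j < card F" for i j
  proof (rule ccontr)
    assume "\<not> p (s i, s j)"
    moreover have "s i \<noteq> s j" using rank_s[of i] rank_s[of j] that by auto
    ultimately have "p (s j, s i)" using linear_orderD(3)[OF p] by blast
    then show False using less[of "s j" "s i"] rank_s[of i] rank_s[of j] that by simp
  qed
  then show ?thesis using s by blast
qed

text \<open>
  Everything that is used about a random polyhedron \<open>(\<omega>, S)\<close>: finite partial isomorphisms extend to automorphisms,
  and all finite complexes of the class embed.
\<close>

locale homogeneous_polyhedron =
  fixes S :: "nat set set" and ok :: "nat \<Rightarrow> bool"
  assumes bound: "size_bound ok"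
    and faces_finite: "u \<in> S \<Longrightarrow> finite u"
    and faces_bounded: "u \<in> S \<Longrightarrow> ok (card u)"
    and faces_hereditary: "u \<subseteq> v \<Longrightarrow> v \<in> S \<Longrightarrow> u \<in> S"
    and vertices: "{x} \<in> S"
    and homogeneous: "finite A \<Longrightarrow> inj_on f A \<Longrightarrow> (\<And>u. u \<subseteq> A \<Longrightarrow> u \<in> S \<longleftrightarrow> f ` u \<in> S) \<Longrightarrow>
      \<exists>g. bij g \<and> (\<forall>u. g ` u \<in> S \<longleftrightarrow> u \<in> S) \<and> (\<forall>x\<in>A. g x = f x)"
    and universal: "complex_on ok n E \<Longrightarrow>
      \<exists>e. inj_on e {..<n} \<and> (\<forall>u\<subseteq>{..<n}. u \<in> E \<longleftrightarrow> e ` u \<in> S)"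

lemma complex_on_empty: "complex_on ok n E \<Longrightarrow> {} \<in> E"
  by (simp only: complex_on_def)

lemma complex_on_vertex: "complex_on ok n E \<Longrightarrow> i < n \<Longrightarrow> {i} \<in> E"
  by (simp only: complex_on_def)

lemma card_le_1: "finite u \<Longrightarrow> card u \<le> 1 \<Longrightarrow> u = {} \<or> (\<exists>x. u = {x})"
  by (metis One_nat_def card_0_eq card_1_singletonE le_Suc_eq le_zero_eq)

text \<open>
  Two disjoint copies of \<open>E\<close> at even places, one in the order of \<open>E\<close> and after it one in the reversed order. The
  odd places carry isolated vertices, so that between any two vertices of a copy there is an isolated one.
\<close>

definition spread_and_reversed :: "nat \<Rightarrow> nat set set \<Rightarrow> nat set set" where
  "spread_and_reversed n E = {u. u \<subseteq> {..<4 * n + 1} \<and> card u \<le> 1} \<union>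
     image (\<lambda>i. 2 * i) ` E \<union> image (\<lambda>i. 4 * n - 2 * i) ` E"

lemma complex_on_spread:
  assumes bound: "size_bound ok" and E: "complex_on ok n E"
  shows "complex_on ok (4 * n + 1) (spread_and_reversed n E)"
proof -
  let ?B = "spread_and_reversed n E"
  note ok_mono = size_bound_mono[OF bound]
  have ok1: "ok 1" using size_bound_1[OF bound] .
  have img: "f ` w \<subseteq> {..<4 * n + 1} \<and> ok (card (f ` w)) \<and> (\<forall>u. u \<subseteq> f ` w \<longrightarrow> u \<in> image f ` E)"
    if "w \<in> E" "\<forall>i<n. f i < 4 * n + 1" for f :: "nat \<Rightarrow> nat" and w
  proof (intro conjI allI impI)
    have w: "w \<subseteq> {..<n}" "ok (card w)" "finite w"
      using E that(1) complex_on_vertices[OF E] complex_on_face_finite[OF E] unfolding complex_on_def by auto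
    show "f ` w \<subseteq> {..<4 * n + 1}" using w that(2) by auto
    show "ok (card (f ` w))" using ok_mono[OF card_image_le w(2)] w(3) by simp
    fix u assume "u \<subseteq> f ` w"
    then obtain v where "v \<subseteq> w" "u = f ` v" by (auto simp: subset_image_iff)
    then show "u \<in> image f ` E" using complex_on_mono[OF E _ that(1)] by blast
  qed
  have d: "\<forall>i<n. 2 * i < 4 * n + 1" "\<forall>i<n. 4 * n - 2 * i < 4 * n + 1" by auto
  have dn: "u \<in> ?B" if uv: "u \<subseteq> v" "v \<in> ?B" for u v
  proof -
    consider "v \<subseteq> {..<4 * n + 1}" "card v \<le> 1"
      | w where "w \<in> E" "v = (\<lambda>i. 2 * i) ` w" | w where "w \<in> E" "v = (\<lambda>i. 4 * n - 2 * i) ` w"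
      using uv(2) unfolding spread_and_reversed_def by blast
    then show ?thesis
    proof cases
      case 1
      then have "card u \<le> card v" using that(1) finite_subset by (intro card_mono) auto
      then show ?thesis using 1 that(1) unfolding spread_and_reversed_def by auto
    next
      case 2
      then show ?thesis using img[OF 2(1) d(1)] that(1) unfolding spread_and_reversed_def by auto
    next
      case 3
      then show ?thesis using img[OF 3(1) d(2)] that(1) unfolding spread_and_reversed_def by auto
    qed
  qed
  have "v \<subseteq> {..<4 * n + 1} \<and> ok (card v)" if v: "v \<in> ?B" for v
  proof -
    consider "v \<subseteq> {..<4 * n + 1}" "card v \<le> 1"
      | w where "w \<in> E" "v = (\<lambda>i. 2 * i) ` w" | w where "w \<in> E" "v = (\<lambda>i. 4 * n - 2 * i) ` w"
      using v unfolding spread_and_reversed_def by blast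
    then show ?thesis
    proof cases
      case 1
      then show ?thesis using ok_mono[OF _ ok1] by blast
    next
      case 2
      then show ?thesis using img[OF 2(1) d(1)] by simp
    next
      case 3
      then show ?thesis using img[OF 3(1) d(2)] by simp
    qed
  qed
  moreover have "{} \<in> ?B" "\<forall>i<4 * n + 1. {i} \<in> ?B" by (auto simp: spread_and_reversed_def)
  ultimately show ?thesis unfolding complex_on_def using dn by blast
qed

lemma spread_iff:
  assumes E: "complex_on ok n E" and u: "u \<subseteq> {..<n}"
  shows "(\<lambda>i. 2 * i) ` u \<in> spread_and_reversed n E \<longleftrightarrow> u \<in> E"
    and "(\<lambda>i. 4 * n - 2 * i) ` u \<in> spread_and_reversed n E \<longleftrightarrow> u \<in> E"
proof -
  let ?d = "\<lambda>i. 2 * i" and ?r = "\<lambda>i. 4 * n - 2 * i"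
  have fin: "finite u" using u finite_subset by blast
  have inj: "inj_on ?d {..<n}" "inj_on ?r {..<n}" by (auto simp: inj_on_def)
  have small: "u \<in> E" if "card u \<le> 1"
    using card_le_1[OF fin that] E u by (auto simp: complex_on_def)
  have E_sub: "w \<subseteq> {..<n}" if "w \<in> E" for w using complex_on_vertices[OF E that] .
  have mixed: "v = {}" if "?d ` v = ?r ` w" "v \<subseteq> {..<n}" "w \<subseteq> {..<n}" for v w
  proof (rule ccontr)
    assume "v \<noteq> {}"
    then obtain x where "x \<in> v" by blast
    then have "2 * x \<in> ?r ` w" using that(1) by blast
    then obtain y where "y \<in> w" "2 * x = 4 * n - 2 * y" by blast
    moreover have "x < n" "y < n" using that(2,3) \<open>x \<in> v\<close> \<open>y \<in> w\<close> by auto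
    ultimately show False by linarith
  qed
  have empty: "{} \<in> E" using E by (simp add: complex_on_def)
  have card: "card (?d ` u) = card u" "card (?r ` u) = card u"
    using card_image[OF inj_on_subset[OF inj(1) u]] card_image[OF inj_on_subset[OF inj(2) u]] by auto
  show "?d ` u \<in> spread_and_reversed n E \<longleftrightarrow> u \<in> E"
  proof
    assume "?d ` u \<in> spread_and_reversed n E"
    then consider "card u \<le> 1" | w where "w \<in> E" "?d ` u = ?d ` w" | w where "w \<in> E" "?d ` u = ?r ` w"
      unfolding spread_and_reversed_def using card by auto
    then show "u \<in> E"
    proof cases
      case 2
      then have "u = w" using inj_on_image_eq_iff[OF inj(1) u E_sub] by blast
      then show ?thesis using 2 by simp
    next
      case 3
      then show ?thesis using mixed[OF 3(2) u E_sub] empty by simp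
    qed (rule small)
  qed (simp add: spread_and_reversed_def)
  show "?r ` u \<in> spread_and_reversed n E \<longleftrightarrow> u \<in> E"
  proof
    assume "?r ` u \<in> spread_and_reversed n E"
    then consider "card u \<le> 1" | w where "w \<in> E" "?r ` u = ?d ` w" | w where "w \<in> E" "?r ` u = ?r ` w"
      unfolding spread_and_reversed_def using card by auto
    then show "u \<in> E"
    proof cases
      case 2
      then have "w = {}" using mixed[of w u] u E_sub by simp
      then show ?thesis using 2 empty by simp
    next
      case 3
      then have "u = w" using inj_on_image_eq_iff[OF inj(2) u E_sub] by blast
      then show ?thesis using 3 by simp
    qed (rule small)
  qed (simp add: spread_and_reversed_def)
qed

lemma spread_isolated:
  assumes "x \<noteq> y" "odd x \<or> odd y"
  shows "{x, y} \<notin> spread_and_reversed n E"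
proof
  assume *: "{x, y} \<in> spread_and_reversed n E"
  have "\<not> card {x, y} \<le> 1" using assms(1) by simp
  then consider w where "{x, y} = (\<lambda>i. 2 * i) ` w" | w where "{x, y} = (\<lambda>i. 4 * n - 2 * i) ` w"
    using * unfolding spread_and_reversed_def by blast
  then show False
  proof cases
    case 1
    have "even z" if "z \<in> {x, y}" for z using that unfolding 1 by auto
    then show ?thesis using assms(2) by blast
  next
    case 2
    have "even z" if "z \<in> {x, y}" for z using that unfolding 2 by auto
    then show ?thesis using assms(2) by blast
  qed
qed

context homogeneous_polyhedron
begin

text \<open>
  Take two copies of \<open>E\<close> as above, and colour the pairs of non-adjacent vertices by their order under \<open>p\<close>. In a
  monochromatic copy \<open>p\<close> agrees on such pairs with the given order, or always with its reverse. As two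
  vertices of a copy of \<open>E\<close> are separated by an isolated one, transitivity extends this to all pairs in
  that copy; so the first copy is ordered correctly by \<open>p\<close>, or else the second one is.
\<close>

lemma every_order_universal:
  assumes p: "strict_linear_order_on UNIV (Collect p)" and E: "complex_on ok n E"
  shows "\<exists>e. (\<forall>j<n. \<forall>i<j. p (e i, e j)) \<and> (\<forall>u\<subseteq>{..<n}. u \<in> E \<longleftrightarrow> e ` u \<in> S)"
proof -
  \<comment> \<open>The copies of this complex are the non-adjacent pairs.\<close>
  define A :: "nat set set" where "A = {{}, {0}, {1}}"
  have ok1: "ok 1" using size_bound_1[OF bound] .
  have ok0: "ok 0" using size_bound_mono[OF bound _ ok1] by simp
  have A_down: "u \<in> A" if "u \<subseteq> v" "v \<in> A" for u v
    using that unfolding A_def by (auto simp: subset_singleton_iff)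
  have "\<forall>u\<in>A. u \<subseteq> {..<2} \<and> ok (card u)" using ok0 ok1 by (simp add: A_def)
  moreover have "{} \<in> A" "\<forall>i<2. {i} \<in> A" by (auto simp: A_def less_2_cases_iff)
  ultimately have A: "complex_on ok 2 A" unfolding complex_on_def using A_down by blast
  define B where "B = spread_and_reversed n E"
  have B: "complex_on ok (4 * n + 1) B" unfolding B_def by (rule complex_on_spread[OF bound E])
  obtain c C where C: "complex_on ok c C" and Ramsey: "\<forall>\<kappa> :: nat list \<Rightarrow> bool.
     \<exists>h col. ordered_embedding (4 * n + 1) B C h \<and> (\<forall>i<4 * n + 1. h i < c) \<and>
       (\<forall>f. ordered_embedding 2 A B f \<longrightarrow> (\<forall>i<2. f i < 4 * n + 1) \<longrightarrow> \<kappa> (map (h \<circ> f) [0..<2]) = col)"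
    using Ramsey_ordered_complexes[OF bound A B] by (elim exE conjE)
  obtain e where e: "inj_on e {..<c}" "\<forall>u\<subseteq>{..<c}. u \<in> C \<longleftrightarrow> e ` u \<in> S" using universal[OF C] by blast
  obtain h col where h: "ordered_embedding (4 * n + 1) B C h" "\<forall>i<4 * n + 1. h i < c"
    and mono: "\<forall>f. ordered_embedding 2 A B f \<longrightarrow> (\<forall>i<2. f i < 4 * n + 1) \<longrightarrow>
      p (e (map (h \<circ> f) [0..<2] ! 0), e (map (h \<circ> f) [0..<2] ! 1)) = col"
    using Ramsey[THEN spec, of "\<lambda>l. p (e (l ! 0), e (l ! 1))"] by (elim exE conjE)
  have pair: "p (e (h x), e (h y)) = col" if "x < y" "y < 4 * n + 1" "{x, y} \<notin> B" for x y
  proof -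
    define f where "f i = (if i = 0 then x else y)" for i :: nat
    have xy: "{x} \<in> B" "{y} \<in> B" "{} \<in> B"
      using complex_on_vertex[OF B] complex_on_empty[OF B] that by auto
    have "u \<in> A \<longleftrightarrow> f ` u \<in> B" if u: "u \<subseteq> {..<2}" for u
    proof -
      have "{..<2} = {0, 1::nat}" by auto
      then have "u \<in> Pow {0, 1}" using u by simp
      then have "u \<in> {{}, {0}, {1}, {0, 1}}" by (auto simp: Pow_insert)
      moreover have "f ` {0, 1} = {x, y}" "f ` {0} = {x}" "f ` {1} = {y}" by (auto simp: f_def)
      moreover have "{0, 1} \<notin> A" by (simp add: A_def)
      ultimately show ?thesis using xy \<open>{x, y} \<notin> B\<close> by (elim insertE) (simp_all add: A_def)
    qed
    moreover have "strict_mono_on {..<2} f" using that(1) by (auto simp: strict_mono_on_def f_def)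
    ultimately have "ordered_embedding 2 A B f" by (simp add: ordered_embedding_def)
    moreover have "\<forall>i<2. f i < 4 * n + 1" using that by (simp add: f_def)
    ultimately have "p (e (map (h \<circ> f) [0..<2] ! 0), e (map (h \<circ> f) [0..<2] ! 1)) = col"
      using mono by blast
    then show ?thesis by (simp add: f_def)
  qed
  have faces: "u \<in> B \<longleftrightarrow> (\<lambda>i. e (h i)) ` u \<in> S" if "u \<subseteq> {..<4 * n + 1}" for u
  proof -
    have "h ` u \<subseteq> {..<c}" using h(2) that by auto
    then have "h ` u \<in> C \<longleftrightarrow> e ` h ` u \<in> S" using e(2) by blast
    then show ?thesis using ordered_embedding_iff[OF h(1) that] by (simp add: image_image)
  qed
  show ?thesis
  proof (cases col)
    case True
    show ?thesis
    proof (intro exI[of _ "\<lambda>i. e (h (2 * i))"] conjI allI impI)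
      fix i j assume ij: "i < j" "j < n"
      have "p (e (h (2 * i)), e (h (2 * i + 1)))"
        using pair[of "2 * i" "2 * i + 1"] spread_isolated[of "2 * i" "2 * i + 1"] True ij by (simp add: B_def)
      moreover have "p (e (h (2 * i + 1)), e (h (2 * j)))"
        using pair[of "2 * i + 1" "2 * j"] spread_isolated[of "2 * i + 1" "2 * j"] True ij by (simp add: B_def)
      ultimately show "p (e (h (2 * i)), e (h (2 * j)))" by (rule linear_orderD(2)[OF p])
    next
      fix u assume u: "u \<subseteq> {..<n}"
      have "(\<lambda>i. 2 * i) ` u \<subseteq> {..<4 * n + 1}" using u by auto
      from faces[OF this] show "u \<in> E \<longleftrightarrow> (\<lambda>i. e (h (2 * i))) ` u \<in> S"
        using spread_iff(1)[OF E u] by (simp add: B_def image_image)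
    qed
  next
    case False
    have rev: "p (e (h y), e (h x))" if "x < y" "y < 4 * n + 1" "{x, y} \<notin> B" for x y
    proof -
      have "h x < h y" using that ordered_embedding_mono[OF h(1)] by (auto simp: strict_mono_on_def)
      then have "e (h x) \<noteq> e (h y)" using e(1) h(2) that by (auto dest: inj_onD)
      then show ?thesis using pair[OF that] False linear_orderD(3)[OF p] by blast
    qed
    show ?thesis
    proof (intro exI[of _ "\<lambda>i. e (h (4 * n - 2 * i))"] conjI allI impI)
      fix i j assume ij: "i < j" "j < n"
      define x z where "x = 4 * n - 2 * j" and "z = 4 * n - 2 * i"
      have xz: "x + 1 < z" "z < 4 * n + 1" "odd (x + 1)" using ij by (auto simp: x_def z_def)
      have "p (e (h (x + 1)), e (h x))"
        by (rule rev) (use xz spread_isolated[of x "x + 1"] in \<open>auto simp: B_def\<close>)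
      moreover have "p (e (h z), e (h (x + 1)))"
        by (rule rev) (use xz spread_isolated[of "x + 1" z] in \<open>auto simp: B_def\<close>)
      ultimately show "p (e (h (4 * n - 2 * i)), e (h (4 * n - 2 * j)))"
        using linear_orderD(2)[OF p] unfolding x_def z_def by blast
    next
      fix u assume u: "u \<subseteq> {..<n}"
      have "(\<lambda>i. 4 * n - 2 * i) ` u \<subseteq> {..<4 * n + 1}" using u by auto
      from faces[OF this] show "u \<in> E \<longleftrightarrow> (\<lambda>i. e (h (4 * n - 2 * i))) ` u \<in> S"
        using spread_iff(2)[OF E u] by (simp add: B_def image_image)
    qed
  qed
qed

definition auts :: "(nat \<Rightarrow> nat) set" where
  "auts = {g. bij g \<and> (\<forall>u. g ` u \<in> S \<longleftrightarrow> u \<in> S)}"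

lemma auts_inv: "g \<in> auts \<Longrightarrow> inv_into UNIV g \<in> auts"
proof -
  assume g: "g \<in> auts"
  then have b: "bij g" by (simp add: auts_def)
  have "inv_into UNIV g ` u \<in> S \<longleftrightarrow> u \<in> S" for u
  proof -
    have "g ` inv_into UNIV g ` u = u" using b by (simp add: image_image bij_is_surj surj_f_inv_f)
    moreover have "g ` inv_into UNIV g ` u \<in> S \<longleftrightarrow> inv_into UNIV g ` u \<in> S"
      using g by (simp only: auts_def mem_Collect_eq)
    ultimately show ?thesis by (simp only:)
  qed
  then show ?thesis using b by (simp add: auts_def bij_imp_bij_inv)
qed

lemma auts_comp:
  assumes "g \<in> auts" "h \<in> auts"
  shows "g \<circ> h \<in> auts"
proof -
  have "(g \<circ> h) ` u = g ` h ` u" for u by (rule image_comp[symmetric])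
  then show ?thesis using assms bij_comp[of h g] by (simp only: auts_def mem_Collect_eq) simp
qed

lemma complex_on_induced:
  assumes "inj_on s {..<n}"
  shows "complex_on ok n {u. u \<subseteq> {..<n} \<and> s ` u \<in> S}"
proof -
  have "ok (card u)" if "u \<subseteq> {..<n}" "s ` u \<in> S" for u
    using faces_bounded[OF that(2)] card_image[OF inj_on_subset[OF assms that(1)]] by simp
  moreover have "u \<subseteq> {..<n} \<and> s ` u \<in> S" if "u \<subseteq> v" "v \<subseteq> {..<n} \<and> s ` v \<in> S" for u v
    using faces_hereditary[OF image_mono[OF that(1)]] that by blast
  moreover have "{} \<in> S" using faces_hereditary[OF _ vertices] by blast
  ultimately show ?thesis unfolding complex_on_def mem_Collect_eq
    by (intro conjI ballI allI impI) (simp_all add: vertices)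
qed

text \<open>
  The set \<open>F\<close>, ordered by \<open>q\<close>, has a copy inside \<open>p\<close>, and by homogeneity an automorphism moves \<open>F\<close> there.
\<close>

lemma realise_order:
  assumes p: "strict_linear_order_on UNIV (Collect p)" and q: "strict_linear_order_on UNIV (Collect q)"
    and F: "finite F"
  shows "\<exists>g\<in>auts. \<forall>x\<in>F. \<forall>y\<in>F. p (inv_into UNIV g x, inv_into UNIV g y) \<longleftrightarrow> q (x, y)"
proof -
  obtain s where s: "bij_betw s {..<card F} F" and sq: "\<forall>j<card F. \<forall>i<j. q (s i, s j)"
    using finite_order_enumeration[OF q F] by blast
  have inj: "inj_on s {..<card F}" using s by (rule bij_betw_imp_inj_on)
  obtain e where ep: "\<forall>j<card F. \<forall>i<j. p (e i, e j)"
    and e: "\<forall>u\<subseteq>{..<card F}. u \<in> {u. u \<subseteq> {..<card F} \<and> s ` u \<in> S} \<longleftrightarrow> e ` u \<in> S"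
    using every_order_universal[OF p complex_on_induced[OF inj]] by blast
  define f where "f x = e (inv_into {..<card F} s x)" for x
  have f_s: "f (s i) = e i" if "i < card F" for i
    using that inj by (simp add: f_def inv_into_f_f)
  have F_s: "s ` {..<card F} = F" using s by (simp add: bij_betw_def)
  have iff: "p (f x, f y) \<longleftrightarrow> q (x, y)" if "x \<in> F" "y \<in> F" for x y
  proof -
    have "x \<in> s ` {..<card F}" "y \<in> s ` {..<card F}" using that by (simp_all only: F_s)
    then obtain i j where ij: "x = s i" "y = s j" "i < card F" "j < card F" by blast
    show ?thesis
    proof (cases i j rule: linorder_cases)
      case less
      then show ?thesis using ep sq ij f_s by simp
    next
      case equal
      then show ?thesis using ij linear_orderD(1)[OF p] linear_orderD(1)[OF q] by simp
    next
      case greater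
      then have "p (f y, f x)" "q (y, x)" using ep sq ij f_s by simp_all
      then show ?thesis using linear_orderD(4)[OF p] linear_orderD(4)[OF q] by blast
    qed
  qed
  have "inj_on f F"
  proof (rule inj_onI, rule ccontr)
    fix x y assume "x \<in> F" "y \<in> F" "f x = f y" "x \<noteq> y"
    then show False using iff[of x y] iff[of y x] linear_orderD(3)[OF q, of x y] linear_orderD(1)[OF p] by auto
  qed
  moreover have "u \<in> S \<longleftrightarrow> f ` u \<in> S" if "u \<subseteq> F" for u
  proof -
    have "u \<subseteq> s ` {..<card F}" using that by (simp only: F_s)
    then obtain v where v: "v \<subseteq> {..<card F}" "u = s ` v" unfolding subset_image_iff by blast
    have "f ` u = e ` v" unfolding v(2) image_image
      by (rule image_cong[OF refl]) (use f_s v(1) in auto)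
    then show ?thesis using e[THEN spec, THEN mp, OF v(1)] v by simp
  qed
  ultimately obtain g where g: "bij g" "\<forall>u. g ` u \<in> S \<longleftrightarrow> u \<in> S" "\<forall>x\<in>F. g x = f x"
    using homogeneous[OF F, of f] by blast
  then have "inv_into UNIV g \<in> auts" by (intro auts_inv) (simp add: auts_def)
  moreover have "\<forall>x\<in>F. \<forall>y\<in>F. p (inv_into UNIV (inv_into UNIV g) x, inv_into UNIV (inv_into UNIV g) y) \<longleftrightarrow> q (x, y)"
    using g(1,3) iff by (simp add: inv_inv_eq)
  ultimately show ?thesis by blast
qed

end

section \<open>Isomorphisms of polyhedra\<close>

text \<open>
  The tuples of all arities together determine precisely the nonempty faces, by listing their elements.
\<close>

lemma structure_iso_polyhedron:
  assumes T: "\<And>u. u \<in> T \<Longrightarrow> finite u \<and> u \<subseteq> A" and U: "\<And>u. u \<in> U \<Longrightarrow> finite u \<and> u \<subseteq> B"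
    and empty: "{} \<in> T" "{} \<in> U"
  shows "structure_iso f (polyhedron_structure A T) (polyhedron_structure B U) \<longleftrightarrow>
           bij_betw f A B \<and> (\<forall>u\<subseteq>A. u \<in> T \<longleftrightarrow> f ` u \<in> U)"
    (is "?iso \<longleftrightarrow> ?R")
proof
  assume ?iso
  then have f: "bij_betw f A B"
    and eq: "\<And>n. {xs. length xs = Suc n \<and> distinct xs \<and> set xs \<in> U} =
               map f ` {xs. length xs = Suc n \<and> distinct xs \<and> set xs \<in> T}"
    by (simp_all add: structure_iso_def polyhedron_structure_def)
  have inj: "inj_on f A" using f by (rule bij_betw_imp_inj_on)
  have "u \<in> T \<longleftrightarrow> f ` u \<in> U" if u: "u \<subseteq> A" for u
  proof (cases "finite u \<and> u \<noteq> {}")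
    case True
    then obtain xs where xs: "set xs = u" "distinct xs" using finite_distinct_list by blast
    then obtain n where n: "length xs = Suc n" using True by (cases xs) auto
    have inj_u: "inj_on f (set xs)" using inj_on_subset[OF inj] u xs by simp
    have "map f xs \<in> {xs. length xs = Suc n \<and> distinct xs \<and> set xs \<in> U} \<longleftrightarrow>
          xs \<in> {xs. length xs = Suc n \<and> distinct xs \<and> set xs \<in> T}"
    proof
      assume "map f xs \<in> {xs. length xs = Suc n \<and> distinct xs \<and> set xs \<in> U}"
      then obtain ys where ys: "map f xs = map f ys" "length ys = Suc n" "distinct ys" "set ys \<in> T"
        unfolding eq by blast
      have "set xs \<union> set ys \<subseteq> A" using T[OF ys(4)] u xs by simp
      then have "xs = ys" using ys(1) inj_on_map_eq_map[OF inj_on_subset[OF inj]] by blast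
      then show "xs \<in> {xs. length xs = Suc n \<and> distinct xs \<and> set xs \<in> T}" using ys by simp
    next
      assume "xs \<in> {xs. length xs = Suc n \<and> distinct xs \<and> set xs \<in> T}"
      then show "map f xs \<in> {xs. length xs = Suc n \<and> distinct xs \<and> set xs \<in> U}"
        unfolding eq by (rule imageI)
    qed
    then show ?thesis using xs n inj_u by (simp add: distinct_map)
  next
    case False
    show ?thesis
    proof (cases "u = {}")
      case infinite: False
      then have "infinite u" using False by simp
      moreover from this have "infinite (f ` u)" using finite_imageD inj_on_subset[OF inj u] by blast
      ultimately show ?thesis using T U by blast
    qed (simp add: empty)
  qed
  then show ?R using f by simp
next
  assume ?R
  then have f: "bij_betw f A B" and faces: "\<And>u. u \<subseteq> A \<Longrightarrow> u \<in> T \<longleftrightarrow> f ` u \<in> U" by simp_all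
  have inj: "inj_on f A" and img: "f ` A = B" using f by (simp_all add: bij_betw_def)
  have "{xs. length xs = Suc n \<and> distinct xs \<and> set xs \<in> U} =
               map f ` {xs. length xs = Suc n \<and> distinct xs \<and> set xs \<in> T}" for n
  proof (intro equalityI subsetI)
    fix ys assume ys: "ys \<in> {xs. length xs = Suc n \<and> distinct xs \<and> set xs \<in> U}"
    define xs where "xs = map (inv_into A f) ys"
    have ysB: "set ys \<subseteq> f ` A" using U[of "set ys"] ys img by simp
    have map_xs: "map f xs = ys" unfolding xs_def map_map
      by (rule map_idI) (simp add: f_inv_into_f subsetD[OF ysB])
    have "inv_into A f y \<in> A" if "y \<in> set ys" for y
      using inv_into_into[OF subsetD[OF ysB that]] .
    then have xsA: "set xs \<subseteq> A" by (auto simp: xs_def)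
    have "f ` set xs = set ys" unfolding map_xs[symmetric] by simp
    then have "set xs \<in> T" using faces[OF xsA] ys by simp
    moreover have "length xs = Suc n" using ys by (simp add: xs_def)
    moreover have "distinct xs"
      using ys inj_on_inv_into[OF ysB] by (simp add: xs_def distinct_map)
    ultimately have "xs \<in> {xs. length xs = Suc n \<and> distinct xs \<and> set xs \<in> T}" by simp
    then show "ys \<in> map f ` {xs. length xs = Suc n \<and> distinct xs \<and> set xs \<in> T}"
      unfolding map_xs[symmetric] by (rule imageI)
  next
    fix ys assume "ys \<in> map f ` {xs. length xs = Suc n \<and> distinct xs \<and> set xs \<in> T}"
    then obtain xs where xs: "ys = map f xs" "length xs = Suc n" "distinct xs" "set xs \<in> T" by blast
    have "set xs \<subseteq> A" using T[OF xs(4)] by simp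
    then show "ys \<in> {xs. length xs = Suc n \<and> distinct xs \<and> set xs \<in> U}"
      using xs faces[of "set xs"] inj_on_subset[OF inj] by (simp add: distinct_map)
  qed
  then show ?iso using f by (simp add: structure_iso_def polyhedron_structure_def)
qed

lemma substructure_on_polyhedron:
  "substructure_on (polyhedron_structure X S) A = polyhedron_structure A {u \<in> S. u \<subseteq> A}"
  by (auto simp: substructure_on_def polyhedron_structure_def)

section \<open>Powers of discrete spaces\<close>

text \<open>
  Both the automorphism group and the space of orders are subspaces of a power of a discrete space, so
  openness and continuity can be checked with finitely many coordinates.
\<close>

abbreviation functions_topology :: "('i \<Rightarrow> 'b) topology" where
  "functions_topology \<equiv> product_topology (\<lambda>_. discrete_topology UNIV) UNIV"

lemma openin_determined_finitely:
  fixes Q :: "('i \<Rightarrow> 'b) set"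
  assumes "finite Z" "\<And>p q. p \<in> Q \<Longrightarrow> \<forall>z\<in>Z. q z = p z \<Longrightarrow> q \<in> Q"
  shows "openin functions_topology Q"
proof (subst openin_subopen, intro ballI)
  fix p assume p: "p \<in> Q"
  have "openin functions_topology {q :: 'i \<Rightarrow> 'b. q z = p z}" for z
  proof -
    have "continuous_map functions_topology (discrete_topology UNIV) (\<lambda>q :: 'i \<Rightarrow> 'b. q z)"
      by (rule continuous_map_product_projection) simp
    from openin_continuous_map_preimage[OF this, of "{p z}"] show ?thesis by (simp add: singleton_iff)
  qed
  then have "openin functions_topology ((\<Inter>z\<in>Z. {q. q z = p z}) \<inter> topspace functions_topology)"
    by (intro openin_INT[OF assms(1)])
  moreover have "(\<Inter>z\<in>Z. {q. q z = p z}) \<subseteq> Q" using assms(2)[OF p] by auto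
  ultimately show "\<exists>T. openin functions_topology T \<and> p \<in> T \<and> T \<subseteq> Q"
    by (intro exI[of _ "(\<Inter>z\<in>Z. {q. q z = p z}) \<inter> topspace functions_topology"]) auto
qed

lemma openin_contains_cylinder:
  assumes "openin functions_topology Q" "p \<in> Q"
  shows "\<exists>Z. finite Z \<and> (\<forall>q. (\<forall>z\<in>Z. q z = p z) \<longrightarrow> q \<in> Q)"
proof -
  obtain X where X: "p \<in> (\<Pi>\<^sub>E i\<in>UNIV. X i)" "finite {i. X i \<noteq> topspace (discrete_topology UNIV)}"
    "(\<Pi>\<^sub>E i\<in>UNIV. X i) \<subseteq> Q" using product_topology_open_contains_basis[OF assms] by blast
  have "q \<in> Q" if "\<forall>z\<in>{i. X i \<noteq> topspace (discrete_topology UNIV)}. q z = p z" for q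
  proof -
    have "p i \<in> X i" for i using PiE_mem[OF X(1)] by simp
    then have "q i \<in> X i" for i using that by (cases "X i = UNIV") simp_all
    then have "q \<in> (\<Pi>\<^sub>E i\<in>UNIV. X i)" by (intro PiE_I) simp_all
    then show ?thesis using X(3) by blast
  qed
  then show ?thesis using X(2) by blast
qed

lemma continuous_map_into_functions:
  assumes C: "\<And>w. w \<in> topspace W \<Longrightarrow> f w \<in> C"
    and loc: "\<And>w z. w \<in> topspace W \<Longrightarrow> \<exists>N. openin W N \<and> w \<in> N \<and> (\<forall>w'\<in>N. f w' z = f w z)"
  shows "continuous_map W (subtopology functions_topology C) f"
proof -
  have "continuous_map W (discrete_topology UNIV) (\<lambda>w. f w z)" for z
  proof -
    have "openin W {w \<in> topspace W. f w z \<in> V}" for V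
    proof (subst openin_subopen, intro ballI)
      fix w assume w: "w \<in> {w \<in> topspace W. f w z \<in> V}"
      then have "w \<in> topspace W" by simp
      from loc[OF this, of z] obtain N where N: "openin W N" "w \<in> N" "\<forall>w'\<in>N. f w' z = f w z"
        by (elim exE conjE)
      have "N \<subseteq> {w \<in> topspace W. f w z \<in> V}"
        using openin_subset[OF N(1)] N(3) w by auto
      then show "\<exists>T. openin W T \<and> w \<in> T \<and> T \<subseteq> {w \<in> topspace W. f w z \<in> V}"
        using N by (intro exI[of _ N] conjI)
    qed
    then show ?thesis unfolding continuous_map_def by simp
  qed
  moreover have "f \<in> topspace W \<rightarrow> C" using C by blast
  ultimately show ?thesis
    unfolding continuous_map_in_subtopology continuous_map_componentwise_UNIV by blast
qed

section \<open>Compactness\<close>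

lemma compact_space_directed:
  fixes C :: "'i set \<Rightarrow> 'y set"
  assumes "compact_space Y"
    and C: "\<And>I. finite I \<Longrightarrow> closedin Y (C I)" "\<And>I. finite I \<Longrightarrow> C I \<noteq> {}"
    and anti: "\<And>I J. finite J \<Longrightarrow> I \<subseteq> J \<Longrightarrow> C J \<subseteq> C I"
  shows "\<exists>y\<in>topspace Y. \<forall>I. finite I \<longrightarrow> y \<in> C I"
proof -
  have "\<Inter>(C ` Collect finite) \<noteq> {}"
  proof (rule assms(1)[unfolded compact_space_fip, THEN spec, THEN mp], intro conjI ballI allI impI)
    fix D assume "D \<in> C ` Collect finite"
    then show "closedin Y D" using C by blast
  next
    fix \<F> assume F: "finite \<F> \<and> \<F> \<subseteq> C ` Collect finite"
    then obtain \<G> where G: "finite \<G>" "\<G> \<subseteq> Collect finite" "\<F> = C ` \<G>"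
      using finite_subset_image[of \<F> C "Collect finite"] by auto
    then have fin: "finite (\<Union>\<G>)" by blast
    then have "C (\<Union>\<G>) \<subseteq> \<Inter>\<F>" using anti[OF fin] G(3) by (simp add: le_INF_iff Union_upper)
    then show "\<Inter>\<F> \<noteq> {}" using C(2)[OF fin] by blast
  qed
  then obtain y where y: "y \<in> \<Inter>(C ` Collect finite)" by blast
  then have "y \<in> C {}" by blast
  then have "y \<in> topspace Y" using closedin_subset[OF C(1)[of "{}"]] by blast
  then show ?thesis using y by blast
qed

section \<open>The space of linear orders\<close>

definition linear_orders :: "(nat \<times> nat \<Rightarrow> bool) set" where
  "linear_orders = {p. strict_linear_order_on UNIV (Collect p)}"

lemma linear_orders_iff:
  "p \<in> linear_orders \<longleftrightarrow> (\<forall>x. \<not> p (x, x)) \<and> (\<forall>x y z. p (x, y) \<longrightarrow> p (y, z) \<longrightarrow> p (x, z)) \<and>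
     (\<forall>x y. x \<noteq> y \<longrightarrow> p (x, y) \<or> p (y, x))"
  unfolding linear_orders_def strict_linear_order_on_def trans_def irrefl_def total_on_def by auto

lemma closedin_linear_orders: "closedin functions_topology linear_orders"
proof -
  have "openin functions_topology (- linear_orders)"
  proof (subst openin_subopen, intro ballI)
    fix p assume "p \<in> - linear_orders"
    then consider x where "p (x, x)" | x y z where "p (x, y)" "p (y, z)" "\<not> p (x, z)"
      | x y where "x \<noteq> y" "\<not> p (x, y)" "\<not> p (y, x)"
      unfolding linear_orders_iff Compl_iff by blast
    then obtain Z where Z: "finite Z" "\<And>q. \<forall>z\<in>Z. q z = p z \<Longrightarrow> q \<notin> linear_orders"
    proof cases
      case 1
      show ?thesis by (rule that[of "{(x, x)}"]) (use 1 in \<open>auto simp: linear_orders_iff\<close>)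
    next
      case 2
      show ?thesis
      proof (rule that[of "{(x, y), (y, z), (x, z)}"])
        fix q assume "\<forall>w\<in>{(x, y), (y, z), (x, z)}. q w = p w"
        then have "q (x, y)" "q (y, z)" "\<not> q (x, z)" using 2 by simp_all
        then show "q \<notin> linear_orders" unfolding linear_orders_iff by blast
      qed simp
    next
      case 3
      show ?thesis
      proof (rule that[of "{(x, y), (y, x)}"])
        fix q assume "\<forall>w\<in>{(x, y), (y, x)}. q w = p w"
        then have "\<not> q (x, y)" "\<not> q (y, x)" using 3 by simp_all
        then show "q \<notin> linear_orders" using 3(1) unfolding linear_orders_iff by blast
      qed simp
    qed
    have "openin functions_topology {q. \<forall>z\<in>Z. q z = p z}"
      by (rule openin_determined_finitely[OF Z(1)]) simp
    then show "\<exists>T. openin functions_topology T \<and> p \<in> T \<and> T \<subseteq> - linear_orders"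
      using Z(2) by (intro exI[of _ "{q. \<forall>z\<in>Z. q z = p z}"]) auto
  qed
  then show ?thesis by (simp add: closedin_def Compl_eq_Diff_UNIV)
qed

abbreviation linear_orders_topology :: "(nat \<times> nat \<Rightarrow> bool) topology" where
  "linear_orders_topology \<equiv> subtopology functions_topology linear_orders"

lemma topspace_linear_orders: "topspace linear_orders_topology = linear_orders"
  by simp

lemma compact_space_linear_orders: "compact_space linear_orders_topology"
proof -
  have "compact_space (functions_topology :: (nat \<times> nat \<Rightarrow> bool) topology)"
    by (simp add: compact_space_product_topology compact_space_discrete_topology)
  then show ?thesis using closedin_linear_orders
    by (intro compact_space_subtopology closedin_compact_space)
qed

lemma Hausdorff_space_linear_orders: "Hausdorff_space linear_orders_topology"
  by (intro Hausdorff_space_subtopology) (simp add: Hausdorff_space_product_topology)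

lemma metrizable_space_linear_orders: "metrizable_space linear_orders_topology"
  by (intro metrizable_space_subtopology) (simp add: metrizable_space_product_topology)

lemma less_linear_order: "(\<lambda>(x, y). x < y) \<in> linear_orders"
  unfolding linear_orders_iff prod.case by (intro conjI allI impI) (simp_all add: linorder_neq_iff)

lemma openin_cylinder:
  assumes "finite Z"
  shows "openin (subtopology functions_topology C) {q \<in> C. \<forall>z\<in>Z. q z = p z}"
proof -
  have "openin functions_topology {q. \<forall>z\<in>Z. q z = p z}"
    by (rule openin_determined_finitely[OF assms]) simp
  moreover have "{q \<in> C. \<forall>z\<in>Z. q z = p z} = C \<inter> {q. \<forall>z\<in>Z. q z = p z}" by blast
  ultimately show ?thesis by (simp only: openin_subtopology_Int2)
qed

lemma openin_subtopology_contains_cylinder: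
  assumes "openin (subtopology functions_topology C) Q" "p \<in> Q"
  shows "\<exists>Z. finite Z \<and> {q \<in> C. \<forall>z\<in>Z. q z = p z} \<subseteq> Q"
proof -
  obtain U where U: "openin functions_topology U" "Q = U \<inter> C"
    using assms(1) unfolding openin_subtopology by blast
  then have "p \<in> U" using assms(2) by blast
  from openin_contains_cylinder[OF U(1) this] show ?thesis unfolding U(2) by blast
qed

section \<open>The flow of linear orders\<close>

text \<open>
  The order that \<open>g\<close> makes of \<open>p\<close>: it compares \<open>x\<close> and \<open>y\<close> as \<open>p\<close> compares their preimages.
\<close>

definition pull :: "(nat \<Rightarrow> nat) \<Rightarrow> (nat \<times> nat \<Rightarrow> bool) \<Rightarrow> (nat \<times> nat \<Rightarrow> bool)" where
  "pull g p = (\<lambda>(x, y). p (inv_into UNIV g x, inv_into UNIV g y))"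

lemma pull_apply: "pull g p (x, y) = p (inv_into UNIV g x, inv_into UNIV g y)"
  by (simp add: pull_def)

lemma pull_comp:
  assumes "bij g" "bij h"
  shows "pull (g \<circ> h) p = pull g (pull h p)"
  by (simp add: pull_def o_inv_distrib[OF assms])

lemma pull_id: "pull id p = p"
  by (simp add: pull_def)

lemma pull_linear_orders:
  assumes g: "bij g" and p: "p \<in> linear_orders"
  shows "pull g p \<in> linear_orders"
proof -
  note d = linear_orderD[OF p[unfolded linear_orders_def mem_Collect_eq]]
  have "inv_into UNIV g x \<noteq> inv_into UNIV g y" if "x \<noteq> y" for x y
    using inj_eq[OF bij_is_inj[OF bij_imp_bij_inv[OF g]]] that by simp
  then show ?thesis unfolding linear_orders_iff pull_apply
    using d(1,3) by (intro conjI allI impI) (simp, erule (1) d(2), blast)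
qed

context homogeneous_polyhedron
begin

abbreviation complex_structure :: "(nat, nat) rel_structure" where
  "complex_structure \<equiv> polyhedron_structure UNIV S"

abbreviation aut_group :: "(nat \<Rightarrow> nat) monoid" where
  "aut_group \<equiv> Aut complex_structure"

abbreviation aut_top :: "(nat \<Rightarrow> nat) topology" where
  "aut_top \<equiv> Aut_topology complex_structure"

lemma autsD: "g \<in> auts \<Longrightarrow> bij g"
  by (simp add: auts_def)

lemma universe_complex: "universe complex_structure = UNIV"
  by (simp add: polyhedron_structure_def)

lemma structure_iso_auts: "structure_iso g complex_structure complex_structure \<longleftrightarrow> g \<in> auts"
proof -
  have "{} \<in> S" using faces_hereditary[OF _ vertices] by blast
  then have "structure_iso g complex_structure complex_structure \<longleftrightarrow>
      bij_betw g UNIV UNIV \<and> (\<forall>u\<subseteq>UNIV. u \<in> S \<longleftrightarrow> g ` u \<in> S)"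
    using faces_finite by (intro structure_iso_polyhedron) auto
  also have "\<dots> \<longleftrightarrow> g \<in> auts" unfolding auts_def by (simp add: eq_commute)
  finally show ?thesis .
qed

lemma carrier_Aut: "carrier aut_group = auts"
proof -
  have "{g \<in> Bij UNIV. g \<in> auts} = auts" by (auto simp: Bij_def autsD)
  then show ?thesis unfolding Aut_def universe_complex structure_iso_auts by simp
qed

lemma mult_Aut: "g \<in> auts \<Longrightarrow> h \<in> auts \<Longrightarrow> g \<otimes>\<^bsub>aut_group\<^esub> h = g \<circ> h"
  unfolding Aut_def universe_complex
  by (simp add: BijGroup_def Bij_def autsD compose_def comp_def restrict_def)

lemma one_Aut: "\<one>\<^bsub>aut_group\<^esub> = id"
  unfolding Aut_def universe_complex by (simp add: BijGroup_def restrict_def id_def)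

lemma auts_id: "id \<in> auts"
  by (simp add: auts_def)

lemma inv_left: "g \<in> auts \<Longrightarrow> inv_into UNIV g \<circ> g = id"
  using bij_is_inj[OF autsD] by (simp add: inv_o_cancel)

lemma group_Aut: "group aut_group"
proof (rule groupI, unfold carrier_Aut)
  show "\<one>\<^bsub>aut_group\<^esub> \<in> auts" by (simp add: one_Aut auts_id)
  fix g h assume gh: "g \<in> auts" "h \<in> auts"
  then show "g \<otimes>\<^bsub>aut_group\<^esub> h \<in> auts" by (simp add: mult_Aut auts_comp)
  show "\<one>\<^bsub>aut_group\<^esub> \<otimes>\<^bsub>aut_group\<^esub> g = g" using gh by (simp add: one_Aut mult_Aut auts_id)
  show "\<exists>k\<in>auts. k \<otimes>\<^bsub>aut_group\<^esub> g = \<one>\<^bsub>aut_group\<^esub>"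
    using gh by (intro bexI[of _ "inv_into UNIV g"]) (simp_all add: one_Aut mult_Aut auts_inv inv_left)
  fix k assume "k \<in> auts"
  then show "g \<otimes>\<^bsub>aut_group\<^esub> h \<otimes>\<^bsub>aut_group\<^esub> k = g \<otimes>\<^bsub>aut_group\<^esub> (h \<otimes>\<^bsub>aut_group\<^esub> k)"
    using gh by (simp add: mult_Aut auts_comp o_assoc)
qed

lemma inv_Aut: "g \<in> auts \<Longrightarrow> inv\<^bsub>aut_group\<^esub> g = inv_into UNIV g"
  by (rule group.inv_equality[OF group_Aut])
    (simp_all add: carrier_Aut one_Aut mult_Aut auts_inv inv_left)

lemma aut_top_eq: "aut_top = subtopology functions_topology auts"
  unfolding Aut_topology_def universe_complex carrier_Aut ..

lemma topspace_aut_top: "topspace aut_top = auts"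
  by (simp add: aut_top_eq)

lemma inv_apply_eq: "g \<in> auts \<Longrightarrow> inv_into UNIV g x = y \<longleftrightarrow> g y = x"
  using autsD[of g] by (metis bij_inv_eq_iff)

lemma openin_aut_cylinder:
  assumes "finite Z"
  shows "openin aut_top {g' \<in> auts. \<forall>z\<in>Z. g' z = g z}"
  unfolding aut_top_eq by (rule openin_cylinder[OF assms])

lemma topological_group_Aut: "topological_group aut_group aut_top"
  unfolding topological_group_def
proof (intro conjI group_Aut)
  show "topspace aut_top = carrier aut_group" by (simp add: topspace_aut_top carrier_Aut)
  show "continuous_map (prod_topology aut_top aut_top) aut_top (\<lambda>(g, h). g \<otimes>\<^bsub>aut_group\<^esub> h)"
    unfolding aut_top_eq
  proof (rule continuous_map_into_functions, unfold aut_top_eq[symmetric] topspace_prod_topology topspace_aut_top)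
    fix w assume "w \<in> auts \<times> auts"
    then obtain g h where w: "w = (g, h)" "g \<in> auts" "h \<in> auts" by blast
    show "(case w of (g, h) \<Rightarrow> g \<otimes>\<^bsub>aut_group\<^esub> h) \<in> auts" using w by (simp add: mult_Aut auts_comp)
    fix z
    let ?U = "{g' \<in> auts. \<forall>z\<in>{h z}. g' z = g z}"
    let ?V = "{h' \<in> auts. \<forall>z\<in>{z}. h' z = h z}"
    have "openin aut_top ?U" "openin aut_top ?V"
      by (rule openin_aut_cylinder, simp)+
    then have "openin (prod_topology aut_top aut_top) (?U \<times> ?V)"
      by (simp only: openin_prod_Times_iff simp_thms)
    moreover have "(case w' of (g, h) \<Rightarrow> g \<otimes>\<^bsub>aut_group\<^esub> h) z = (case w of (g, h) \<Rightarrow> g \<otimes>\<^bsub>aut_group\<^esub> h) z"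
      if w': "w' \<in> ?U \<times> ?V" for w'
    proof -
      obtain g' h' where "w' = (g', h')" "g' \<in> auts" "h' \<in> auts" "g' (h z) = g (h z)" "h' z = h z"
        using w' by (elim SigmaE) simp
      then show ?thesis using w by (simp add: mult_Aut)
    qed
    moreover have "w \<in> ?U \<times> ?V" using w by simp
    ultimately show "\<exists>N. openin (prod_topology aut_top aut_top) N \<and> w \<in> N \<and>
      (\<forall>w'\<in>N. (case w' of (g, h) \<Rightarrow> g \<otimes>\<^bsub>aut_group\<^esub> h) z = (case w of (g, h) \<Rightarrow> g \<otimes>\<^bsub>aut_group\<^esub> h) z)"
      by (intro exI[of _ "?U \<times> ?V"] conjI ballI)
  qed
  show "continuous_map aut_top aut_top (\<lambda>g. inv\<^bsub>aut_group\<^esub> g)"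
    unfolding aut_top_eq
  proof (rule continuous_map_into_functions, unfold aut_top_eq[symmetric] topspace_aut_top)
    fix g assume g: "g \<in> auts"
    show "inv\<^bsub>aut_group\<^esub> g \<in> auts" using g by (simp add: inv_Aut auts_inv)
    fix z
    let ?N = "{g' \<in> auts. \<forall>z\<in>{inv_into UNIV g z}. g' z = g z}"
    have gz: "g (inv_into UNIV g z) = z" using inv_apply_eq[OF g] by blast
    have "(inv\<^bsub>aut_group\<^esub> g') z = (inv\<^bsub>aut_group\<^esub> g) z" if g': "g' \<in> ?N" for g'
    proof -
      have "g' \<in> auts" "g' (inv_into UNIV g z) = z" using g' gz by simp_all
      then show ?thesis using g inv_apply_eq[of g' z "inv_into UNIV g z"] by (simp add: inv_Aut)
    qed
    moreover have "openin aut_top ?N" by (rule openin_aut_cylinder) simp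
    moreover have "g \<in> ?N" using g by simp
    ultimately show "\<exists>N. openin aut_top N \<and> g \<in> N \<and> (\<forall>g'\<in>N. (inv\<^bsub>aut_group\<^esub> g') z = (inv\<^bsub>aut_group\<^esub> g) z)"
      by (intro exI[of _ ?N] conjI ballI)
  qed
qed

text \<open>
  The action on admissible orderings in the case that these are all linear orders.
\<close>

definition order_action :: "(nat \<Rightarrow> nat) \<Rightarrow> (nat \<times> nat \<Rightarrow> bool) \<Rightarrow> (nat \<times> nat \<Rightarrow> bool)" where
  "order_action g = (\<lambda>p\<in>linear_orders. \<lambda>(x, y). p ((inv\<^bsub>aut_group\<^esub> g) x, (inv\<^bsub>aut_group\<^esub> g) y))"

lemma order_action_eq: "g \<in> auts \<Longrightarrow> p \<in> linear_orders \<Longrightarrow> order_action g p = pull g p"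
  by (simp add: order_action_def pull_def inv_Aut)

lemma order_action_closed: "g \<in> auts \<Longrightarrow> p \<in> linear_orders \<Longrightarrow> order_action g p \<in> linear_orders"
  by (simp add: order_action_eq pull_linear_orders autsD)

lemma order_action_comp:
  "g \<in> auts \<Longrightarrow> h \<in> auts \<Longrightarrow> p \<in> linear_orders \<Longrightarrow>
     order_action (g \<circ> h) p = order_action g (order_action h p)"
  by (simp add: order_action_eq auts_comp pull_linear_orders autsD pull_comp)

lemma inv_right: "g \<in> auts \<Longrightarrow> g \<circ> inv_into UNIV g = id"
  using bij_is_surj[OF autsD] by (simp add: surj_iff)

lemma order_action_Bij:
  assumes "g \<in> auts"
  shows "order_action g \<in> Bij linear_orders"
proof -
  have "order_action (inv_into UNIV g) (order_action g p) = p" "order_action g (order_action (inv_into UNIV g) p) = p"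
    if "p \<in> linear_orders" for p
    using that assms order_action_comp[symmetric, of "inv_into UNIV g" g p]
      order_action_comp[symmetric, of g "inv_into UNIV g" p]
    by (simp_all add: auts_inv inv_left inv_right order_action_eq auts_id pull_id)
  then have "bij_betw (order_action g) linear_orders linear_orders"
    by (intro bij_betw_byWitness[of _ "order_action (inv_into UNIV g)"])
      (auto simp: order_action_closed assms auts_inv)
  moreover have "order_action g \<in> extensional linear_orders" by (simp add: order_action_def)
  ultimately show ?thesis by (simp add: Bij_def)
qed

lemma group_action_orders: "group_action aut_group linear_orders order_action"
proof (intro group_action.intro group_hom.intro group_Aut group_BijGroup group_hom_axioms.intro homI)
  fix g assume "g \<in> carrier aut_group"
  then have g: "g \<in> auts" by (simp add: carrier_Aut)
  then show "order_action g \<in> carrier (BijGroup linear_orders)"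
    by (simp add: BijGroup_def order_action_Bij)
  fix h assume "h \<in> carrier aut_group"
  then have h: "h \<in> auts" by (simp add: carrier_Aut)
  have "order_action (g \<circ> h) = compose linear_orders (order_action g) (order_action h)"
  proof
    fix p show "order_action (g \<circ> h) p = compose linear_orders (order_action g) (order_action h) p"
    proof (cases "p \<in> linear_orders")
      case True
      then show ?thesis using g h by (simp add: compose_def order_action_comp)
    next
      case False
      then show ?thesis by (simp add: compose_def order_action_def)
    qed
  qed
  then show "order_action (g \<otimes>\<^bsub>aut_group\<^esub> h) =
      order_action g \<otimes>\<^bsub>BijGroup linear_orders\<^esub> order_action h"
    using g h by (simp add: mult_Aut BijGroup_def order_action_Bij)
qed

lemma flow_orders: "flow aut_group aut_top linear_orders_topology order_action"
  unfolding flow_def topspace_linear_orders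
proof (intro conjI topological_group_Aut compact_space_linear_orders Hausdorff_space_linear_orders
    group_action_orders continuous_map_into_functions)
  fix w assume "w \<in> topspace (prod_topology aut_top linear_orders_topology)"
  then obtain g p where w: "w = (g, p)" "g \<in> auts" "p \<in> linear_orders"
    by (auto simp: topspace_aut_top)
  show "(case w of (g, x) \<Rightarrow> order_action g x) \<in> linear_orders"
    using w by (simp add: order_action_closed)
  fix z :: "nat \<times> nat"
  obtain x y where z: "z = (x, y)" by (cases z)
  let ?a = "inv_into UNIV g x" and ?b = "inv_into UNIV g y"
  let ?N = "{g' \<in> auts. \<forall>z\<in>{?a, ?b}. g' z = g z} \<times> {q \<in> linear_orders. \<forall>z\<in>{(?a, ?b)}. q z = p z}"
  have "openin aut_top {g' \<in> auts. \<forall>z\<in>{?a, ?b}. g' z = g z}"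
    "openin linear_orders_topology {q \<in> linear_orders. \<forall>z\<in>{(?a, ?b)}. q z = p z}"
    by (rule openin_aut_cylinder, simp, rule openin_cylinder, simp)
  then have "openin (prod_topology aut_top linear_orders_topology) ?N"
    by (simp only: openin_prod_Times_iff simp_thms)
  moreover have "(case w' of (g, x) \<Rightarrow> order_action g x) z = (case w of (g, x) \<Rightarrow> order_action g x) z"
    if w': "w' \<in> ?N" for w'
  proof -
    obtain g' p' where gp: "w' = (g', p')" "g' \<in> auts" "p' \<in> linear_orders"
      "g' ?a = g ?a" "g' ?b = g ?b" "p' (?a, ?b) = p (?a, ?b)" using w' by (elim SigmaE) simp
    have "g ?a = x" "g ?b = y" using inv_apply_eq[OF w(2)] by blast+
    then have "inv_into UNIV g' x = ?a" "inv_into UNIV g' y = ?b"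
      using gp inv_apply_eq[OF gp(2)] by simp_all
    then show ?thesis using gp w by (simp add: order_action_eq z pull_apply)
  qed
  ultimately show "\<exists>N. openin (prod_topology aut_top linear_orders_topology) N \<and> w \<in> N \<and>
      (\<forall>w'\<in>N. (case w' of (g, x) \<Rightarrow> order_action g x) z = (case w of (g, x) \<Rightarrow> order_action g x) z)"
    using w by (intro exI[of _ ?N] conjI ballI) simp_all
qed

lemma realise_order_cylinder:
  assumes "p \<in> linear_orders" "q \<in> linear_orders" "finite Z"
  shows "\<exists>g\<in>auts. \<forall>z\<in>Z. pull g p z = q z"
proof -
  have "finite (fst ` Z \<union> snd ` Z)" using assms(3) by simp
  from realise_order[OF assms(1,2)[unfolded linear_orders_def mem_Collect_eq] this]
  obtain g where g: "g \<in> auts" "\<forall>x\<in>fst ` Z \<union> snd ` Z. \<forall>y\<in>fst ` Z \<union> snd ` Z.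
    p (inv_into UNIV g x, inv_into UNIV g y) \<longleftrightarrow> q (x, y)" by blast
  have "pull g p z = q z" if "z \<in> Z" for z
  proof -
    obtain x y where z: "z = (x, y)" by (cases z)
    have "x \<in> fst ` Z" "y \<in> snd ` Z" using that z by force+
    then show ?thesis using g(2) by (simp add: z pull_apply)
  qed
  then show ?thesis using g(1) by blast
qed

text \<open>
  A neighbourhood of \<open>q\<close> fixes the order of a finite set only, and there the orbit of \<open>p\<close> attains every order.
\<close>

lemma minimal_flow_orders: "minimal_flow aut_group aut_top linear_orders_topology order_action"
  unfolding minimal_flow_def topspace_linear_orders
proof (intro conjI flow_orders ballI)
  show "linear_orders \<noteq> {}" using less_linear_order by blast
  fix p assume p: "p \<in> linear_orders"
  have "q \<in> linear_orders_topology closure_of orbit aut_group order_action p" if q: "q \<in> linear_orders" for q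
    unfolding in_closure_of
  proof (intro conjI allI impI)
    show "q \<in> topspace linear_orders_topology" using q by (simp only: topspace_linear_orders)
    fix U assume U: "q \<in> U \<and> openin linear_orders_topology U"
    then obtain Z where Z: "finite Z" "{r \<in> linear_orders. \<forall>z\<in>Z. r z = q z} \<subseteq> U"
      using openin_subtopology_contains_cylinder[of linear_orders U q] by blast
    obtain g where g: "g \<in> auts" "\<forall>z\<in>Z. pull g p z = q z"
      using realise_order_cylinder[OF p q Z(1)] by blast
    have "pull g p \<in> U" using Z(2) g pull_linear_orders[OF autsD[OF g(1)] p] by blast
    moreover have "pull g p \<in> orbit aut_group order_action p"
      unfolding orbit_def carrier_Aut using g(1) order_action_eq[OF g(1) p] by (intro CollectI exI[of _ g]) simp
    ultimately show "\<exists>y. y \<in> orbit aut_group order_action p \<and> y \<in> U" by blast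
  qed
  moreover have "linear_orders_topology closure_of orbit aut_group order_action p \<subseteq> linear_orders"
    using closure_of_subset_topspace[of linear_orders_topology] by (simp only: topspace_linear_orders)
  ultimately show "linear_orders_topology closure_of orbit aut_group order_action p = linear_orders" by blast
qed

end

context homogeneous_polyhedron
begin

subsection \<open>Maps onto minimal flows\<close>

context
  fixes Y :: "'y topology" and \<psi> :: "(nat \<Rightarrow> nat) \<Rightarrow> 'y \<Rightarrow> 'y"
  assumes flow: "flow aut_group aut_top Y \<psi>"
begin

lemma flow_compact: "compact_space Y" and flow_Hausdorff: "Hausdorff_space Y"
  and flow_action: "group_action aut_group (topspace Y) \<psi>"
  and flow_continuous: "continuous_map (prod_topology aut_top Y) Y (\<lambda>(g, y). \<psi> g y)"
  using flow by (simp_all add: flow_def)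

lemma flow_closed: "g \<in> auts \<Longrightarrow> y \<in> topspace Y \<Longrightarrow> \<psi> g y \<in> topspace Y"
  using group_action.element_image[OF flow_action] by (simp add: carrier_Aut)

lemma flow_comp: "g \<in> auts \<Longrightarrow> h \<in> auts \<Longrightarrow> y \<in> topspace Y \<Longrightarrow> \<psi> (g \<circ> h) y = \<psi> g (\<psi> h y)"
  using group_action.composition_rule[OF flow_action, of y g h] by (simp add: carrier_Aut mult_Aut)

lemma flow_id: "y \<in> topspace Y \<Longrightarrow> \<psi> id y = y"
  using fun_cong[OF group_action.id_eq_one[OF flow_action], of y] by (simp add: one_Aut)

lemma flow_continuous_at: 
  assumes "g \<in> auts"
  shows "continuous_map Y Y (\<psi> g)"
proof -
  have "continuous_map Y (prod_topology aut_top Y) (\<lambda>y. (g, y))"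
    using assms by (intro continuous_map_pairedI) (simp_all add: topspace_aut_top)
  from continuous_map_compose[OF this flow_continuous] show ?thesis by (simp add: comp_def)
qed

text \<open>
  The automorphisms that change the value of \<open>\<phi>\<close> somewhere by at least \<open>\<epsilon>\<close> form the projection of a closed
  set along the compact space \<open>Y\<close>. This projection is closed and does not contain the identity, so it misses
  the stabiliser of a finite set.
\<close>

lemma stabiliser_almost_invariant:
  assumes \<phi>: "continuous_map Y euclideanreal \<phi>" and \<epsilon>: "0 < \<epsilon>"
  shows "\<exists>F. finite F \<and> (\<forall>u\<in>auts. (\<forall>x\<in>F. u x = x) \<longrightarrow>
           (\<forall>y\<in>topspace Y. \<bar>\<phi> (\<psi> u y) - \<phi> y\<bar> < \<epsilon>))"
proof -
  let ?P = "prod_topology aut_top Y"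
  let ?d = "\<lambda>w. \<phi> (case w of (g, y) \<Rightarrow> \<psi> g y) - \<phi> (snd w)"
  have "continuous_map ?P euclideanreal ?d"
    using continuous_map_compose[OF flow_continuous \<phi>] continuous_map_compose[OF continuous_map_snd \<phi>]
    by (intro continuous_map_diff) (simp_all add: comp_def)
  moreover have "closedin euclideanreal (- {- \<epsilon><..<\<epsilon>})" by (simp add: closed_Compl)
  ultimately have "closedin ?P {w \<in> topspace ?P. ?d w \<in> - {- \<epsilon><..<\<epsilon>}}"
    by (rule closedin_continuous_map_preimage)
  then have "closedin aut_top (fst ` {w \<in> topspace ?P. ?d w \<in> - {- \<epsilon><..<\<epsilon>}})"
    using closed_map_fst[OF flow_compact, of aut_top] unfolding closed_map_def by blast
  moreover define K where "K = fst ` {w \<in> topspace ?P. ?d w \<in> - {- \<epsilon><..<\<epsilon>}}"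
  ultimately have closed: "closedin aut_top K" by simp
  have mem: "u \<in> K" if "u \<in> auts" "y \<in> topspace Y" "\<not> \<bar>\<phi> (\<psi> u y) - \<phi> y\<bar> < \<epsilon>" for u y
    unfolding K_def by (rule image_eqI[of _ _ "(u, y)"]) (use that in \<open>auto simp: topspace_aut_top\<close>)
  have "id \<notin> K"
  proof
    assume "id \<in> K"
    then obtain u y where w: "y \<in> topspace Y" "\<phi> (\<psi> u y) - \<phi> y \<in> - {- \<epsilon><..<\<epsilon>}" "id = u"
      unfolding K_def by auto
    then show False using flow_id[OF w(1)] \<epsilon> by simp
  qed
  then have id: "id \<in> auts - K" using auts_id by simp
  have "openin aut_top (auts - K)" using closed by (simp add: closedin_def topspace_aut_top)
  then have "openin (subtopology functions_topology auts) (auts - K)" unfolding aut_top_eq .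
  from openin_subtopology_contains_cylinder[OF this id]
  obtain Z where Z: "finite Z" "{u \<in> auts. \<forall>z\<in>Z. u z = id z} \<subseteq> auts - K" by (elim exE conjE)
  have "\<bar>\<phi> (\<psi> u y) - \<phi> y\<bar> < \<epsilon>" if "u \<in> auts" "\<forall>x\<in>Z. u x = x" "y \<in> topspace Y" for u y
  proof (rule ccontr)
    assume "\<not> ?thesis"
    then have "u \<in> K" using mem that by blast
    moreover have "u \<in> {u \<in> auts. \<forall>z\<in>Z. u z = id z}" using that by simp
    ultimately show False using Z(2) by blast
  qed
  then show ?thesis using Z(1) by blast
qed

definition almost_stabilised :: "('y \<Rightarrow> real) \<Rightarrow> nat list \<Rightarrow> bool" where
  "almost_stabilised \<phi> s \<longleftrightarrow> (\<forall>u\<in>auts. (\<forall>x\<in>set s. u x = x) \<longrightarrow>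
     (\<forall>y\<in>topspace Y. \<bar>\<phi> (\<psi> u y) - \<phi> y\<bar> < 1 / 8))"

text \<open>
  The automorphism \<open>g\<close> carries the usual order to one that lists the elements of \<open>s\<close> in the order of the list.
  The set \<open>B\<close> bounds the part of \<open>\<omega>\<close> from which this order is taken.
\<close>

definition increasing_into :: "nat list \<Rightarrow> nat set \<Rightarrow> (nat \<Rightarrow> nat) \<Rightarrow> bool" where
  "increasing_into s B g \<longleftrightarrow> g \<in> auts \<and> sorted_wrt (<) (map (inv_into UNIV g) s) \<and> inv_into UNIV g ` set s \<subseteq> B"

text \<open>
  At \<open>z\<close> the function \<open>\<phi>\<close> does not distinguish clearly between automorphisms that induce the same order on the
  elements of \<open>s\<close>. For fixed \<open>B\<close> and \<open>\<phi>\<close> this is a closed condition on \<open>z\<close>.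
\<close>

definition order_blind :: "('y \<Rightarrow> real) \<Rightarrow> nat list \<Rightarrow> nat set \<Rightarrow> 'y \<Rightarrow> bool" where
  "order_blind \<phi> s B z \<longleftrightarrow> (\<forall>g h. increasing_into s B g \<longrightarrow> increasing_into s B h \<longrightarrow>
     \<not> (\<phi> (\<psi> g z) < 1 / 4 \<and> 3 / 4 < \<phi> (\<psi> h z)))"

lemma increasing_into_mono: "B \<subseteq> B' \<Longrightarrow> increasing_into s B g \<Longrightarrow> increasing_into s B' g"
  unfolding increasing_into_def by auto

lemma order_blindD:
  assumes "order_blind \<phi> s B z" "increasing_into s B g" "increasing_into s B h"
  shows "\<not> (\<phi> (\<psi> g z) < 1 / 4 \<and> 3 / 4 < \<phi> (\<psi> h z))"
  using assms(1)[unfolded order_blind_def, THEN spec, THEN spec, THEN mp, THEN mp, OF assms(2,3)] .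

lemma order_blind_mono:
  assumes "B \<subseteq> B'" "order_blind \<phi> s B' z"
  shows "order_blind \<phi> s B z"
  unfolding order_blind_def
  by (intro allI impI order_blindD[OF assms(2)] increasing_into_mono[OF assms(1)])

lemma inv_comp_auts:
  assumes "g \<in> auts" "m \<in> auts"
  shows "inv_into UNIV (g \<circ> inv_into UNIV m) = m \<circ> inv_into UNIV g"
  unfolding o_inv_distrib[OF autsD[OF assms(1)] bij_imp_bij_inv[OF autsD[OF assms(2)]]]
    inv_inv_eq[OF autsD[OF assms(2)]] ..

lemma increasing_into_translate:
  assumes g: "increasing_into s B g" and m: "m \<in> auts" "\<forall>x\<in>B. \<forall>y\<in>B. x < y \<longrightarrow> m x < m y" "m ` B \<subseteq> B'"
  shows "increasing_into s B' (g \<circ> inv_into UNIV m)"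
proof -
  have ga: "g \<in> auts" and sorted: "sorted_wrt (<) (map (inv_into UNIV g) s)"
    and sub: "inv_into UNIV g ` set s \<subseteq> B" using g by (simp_all add: increasing_into_def)
  have "sorted_wrt (<) (map (m \<circ> inv_into UNIV g) s)"
    using sorted unfolding sorted_wrt_map
    by (rule sorted_wrt_mono_rel[rotated]) (use m(2) sub in \<open>simp add: image_subset_iff\<close>)
  moreover have "(m \<circ> inv_into UNIV g) ` set s \<subseteq> B'" using sub m(3) by (auto simp: image_subset_iff)
  ultimately show ?thesis
    using ga m(1) by (simp add: increasing_into_def inv_comp_auts auts_comp auts_inv)
qed

text \<open>
  An automorphism \<open>g\<close> that is increasing into \<open>B\<close> amounts, on the elements of \<open>s\<close>, to an ordered embedding of these
  elements in \<open>B\<close>, and up to \<open>1 / 8\<close> the value of \<open>\<phi>\<close> at \<open>g z\<close> depends on this embedding only. Colour the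
  embeddings by whether this value is below \<open>1 / 2\<close>. In a sufficiently large \<open>B'\<close> there is a copy of \<open>B\<close>, ordered as
  \<open>B\<close> is, inside which the colour is constant. Moving \<open>z\<close> by an automorphism that takes this copy to \<open>B\<close> turns this
  into a statement about \<open>B\<close>. The set \<open>B'\<close> does not depend on \<open>z\<close>, which allows to treat several functions in turn.
\<close>

lemma order_blind_Ramsey_step:
  assumes stab: "almost_stabilised \<phi> s" and B: "finite B"
  shows "\<exists>B'. finite B' \<and> (\<forall>z\<in>topspace Y. \<exists>m\<in>auts. (\<forall>x\<in>B. \<forall>y\<in>B. x < y \<longrightarrow> m x < m y) \<and>
           m ` B \<subseteq> B' \<and> order_blind \<phi> s B (\<psi> (inv_into UNIV m) z))"
proof (cases "distinct s")
  case False
  have "\<not> sorted_wrt (<) (map (inv_into UNIV g) s)" for g :: "nat \<Rightarrow> nat"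
    using False distinct_map[of "inv_into UNIV g" s] strict_sorted_iff[of "map (inv_into UNIV g) s"] by blast
  then have "order_blind \<phi> s B z" for z by (simp add: order_blind_def increasing_into_def)
  then show ?thesis using B auts_id by (intro exI[of _ B] conjI ballI bexI[of _ id]) auto
next
  case True
  define a b where "a = length s" and "b = card B"
  define \<beta> where "\<beta> = nth (sorted_list_of_set B)"
  have \<beta>_less: "\<beta> i < \<beta> j" if "i < j" "j < b" for i j
    using that sorted_wrt_nth_less[OF strict_sorted_list_of_set[of B] that(1)] by (simp add: \<beta>_def b_def)
  have \<beta>_less_iff: "\<beta> i < \<beta> j \<longleftrightarrow> i < j" if "i < b" "j < b" for i j
    using \<beta>_less[of i j] \<beta>_less[of j i] that by (cases i j rule: linorder_cases) auto
  have \<beta>_inj: "inj_on \<beta> {..<b}" 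
  proof (rule linorder_inj_onI')
    fix i j assume "i \<in> {..<b}" "j \<in> {..<b}" "i < j"
    then show "\<beta> i \<noteq> \<beta> j" using \<beta>_less[of i j] by simp
  qed
  have \<beta>_img: "\<beta> ` {..<b} = B"
    using B nth_image[of b "sorted_list_of_set B"] by (simp add: \<beta>_def b_def lessThan_atLeast0)
  define A where "A = {u. u \<subseteq> {..<a} \<and> nth s ` u \<in> S}"
  define E where "E = {u. u \<subseteq> {..<b} \<and> \<beta> ` u \<in> S}"
  have A: "complex_on ok a A" unfolding A_def a_def
    by (rule complex_on_induced) (rule inj_on_nth[OF True], simp)
  have E: "complex_on ok b E" unfolding E_def by (rule complex_on_induced[OF \<beta>_inj])
  obtain c C where C: "complex_on ok c C" and Ramsey: "\<forall>\<kappa> :: nat list \<Rightarrow> bool.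
     \<exists>h col. ordered_embedding b E C h \<and> (\<forall>i<b. h i < c) \<and>
       (\<forall>f. ordered_embedding a A E f \<longrightarrow> (\<forall>i<a. f i < b) \<longrightarrow> \<kappa> (map (h \<circ> f) [0..<a]) = col)"
    using Ramsey_ordered_complexes[OF bound A E] by (elim exE conjE)
  obtain \<gamma> where \<gamma>_less: "\<forall>j<c. \<forall>i<j. \<gamma> i < \<gamma> j" and \<gamma>: "\<forall>u\<subseteq>{..<c}. u \<in> C \<longleftrightarrow> \<gamma> ` u \<in> S"
    using every_order_universal[OF less_linear_order[unfolded linear_orders_def mem_Collect_eq] C]
    unfolding prod.case by (elim exE conjE)
  define B' where "B' = \<gamma> ` {..<c}"
  have "\<exists>m\<in>auts. (\<forall>x\<in>B. \<forall>y\<in>B. x < y \<longrightarrow> m x < m y) \<and>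
           m ` B \<subseteq> B' \<and> order_blind \<phi> s B (\<psi> (inv_into UNIV m) z)" if z: "z \<in> topspace Y" for z
  proof -
    define \<kappa> where "\<kappa> es \<longleftrightarrow> (\<exists>g\<in>auts. map (inv_into UNIV g) s = map \<gamma> es \<and> \<phi> (\<psi> g z) < 1 / 2)" for es
    obtain h col where h: "ordered_embedding b E C h" "\<forall>i<b. h i < c"
      and mono: "\<forall>f. ordered_embedding a A E f \<longrightarrow> (\<forall>i<a. f i < b) \<longrightarrow> \<kappa> (map (h \<circ> f) [0..<a]) = col"
      using Ramsey[THEN spec, of \<kappa>] by (elim exE conjE)
    \<comment> \<open>The ordered isomorphism of \<open>B\<close> with its monochromatic copy.\<close>
    define \<theta> where "\<theta> x = \<gamma> (h (inv_into {..<b} \<beta> x))" for x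
    have \<theta>_\<beta>: "\<theta> (\<beta> i) = \<gamma> (h i)" if "i < b" for i
      using that \<beta>_inj by (simp add: \<theta>_def inv_into_f_f)
    have \<theta>_less: "\<theta> x < \<theta> y" if xy: "x \<in> B" "y \<in> B" "x < y" for x y
    proof -
      have "x \<in> \<beta> ` {..<b}" "y \<in> \<beta> ` {..<b}" using xy by (simp_all only: \<beta>_img)
      then obtain i j where ij: "x = \<beta> i" "y = \<beta> j" "i < b" "j < b" by blast
      then have "i < j" using xy(3) \<beta>_less_iff by simp
      then have "h i < h j" using ordered_embedding_mono[OF h(1)] ij by (auto simp: strict_mono_on_def)
      then show ?thesis using \<gamma>_less h(2) ij \<theta>_\<beta> by simp
    qed
    have "inj_on \<theta> B" 
    proof (rule linorder_inj_onI')
      fix x y assume "x \<in> B" "y \<in> B" "x < y"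
      then show "\<theta> x \<noteq> \<theta> y" using \<theta>_less[of x y] by simp
    qed
    moreover have "u \<in> S \<longleftrightarrow> \<theta> ` u \<in> S" if "u \<subseteq> B" for u
    proof -
      have "u \<subseteq> \<beta> ` {..<b}" using that by (simp only: \<beta>_img)
      then obtain v where v: "v \<subseteq> {..<b}" "u = \<beta> ` v" unfolding subset_image_iff by blast
      have "\<theta> ` u = \<gamma> ` h ` v" unfolding v(2) image_image
        by (rule image_cong[OF refl]) (use \<theta>_\<beta> v(1) in auto)
      moreover have "h ` v \<subseteq> {..<c}" using v(1) h(2) by auto
      ultimately show ?thesis
        using ordered_embedding_iff[OF h(1) v(1)] \<gamma>[THEN spec, THEN mp, of "h ` v"] v by (simp add: E_def)
    qed
    ultimately obtain m where m: "bij m" "\<forall>u. m ` u \<in> S \<longleftrightarrow> u \<in> S" "\<forall>x\<in>B. m x = \<theta> x"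
      using homogeneous[OF B, of \<theta>] by blast
    have ma: "m \<in> auts" using m by (simp add: auts_def)
    have m_less: "\<forall>x\<in>B. \<forall>y\<in>B. x < y \<longrightarrow> m x < m y" using m(3) \<theta>_less by simp
    have m_B: "m ` B \<subseteq> B'" unfolding \<beta>_img[symmetric] B'_def using m(3) \<theta>_\<beta> h(2) \<beta>_img by force
    have side: "if col then \<phi> (\<psi> g (\<psi> (inv_into UNIV m) z)) < 5 / 8 else 1 / 2 \<le> \<phi> (\<psi> g (\<psi> (inv_into UNIV m) z))"
      if g: "increasing_into s B g" for g
    proof -
      have ga: "g \<in> auts" and sorted: "sorted_wrt (<) (map (inv_into UNIV g) s)"
        and sub: "inv_into UNIV g ` set s \<subseteq> B" using g by (simp_all add: increasing_into_def)
      \<comment> \<open>The automorphism to be applied to \<open>z\<close> itself. On the elements of \<open>s\<close> its inverse takes values in the copy.\<close>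
      define k where "k = g \<circ> inv_into UNIV m"
      have ka: "k \<in> auts" by (simp add: k_def auts_comp auts_inv ma ga)
      have k_inv: "inv_into UNIV k = m \<circ> inv_into UNIV g" unfolding k_def by (rule inv_comp_auts[OF ga ma])
      have k_eq: "\<psi> g (\<psi> (inv_into UNIV m) z) = \<psi> k z"
        unfolding k_def by (rule flow_comp[OF ga auts_inv[OF ma] z, symmetric])
      define f where "f i = inv_into {..<b} \<beta> (inv_into UNIV g (s ! i))" for i
      have in_B: "inv_into UNIV g (s ! i) \<in> \<beta> ` {..<b}" if "i < a" for i
        unfolding \<beta>_img using sub that by (auto simp: a_def)
      have f_less: "f i < b" and \<beta>_f: "\<beta> (f i) = inv_into UNIV g (s ! i)" if "i < a" for i
        using inv_into_into[OF in_B[OF that]] f_inv_into_f[OF in_B[OF that]] by (simp_all add: f_def)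
      have "ordered_embedding a A E f" unfolding ordered_embedding_def
      proof (intro conjI allI impI)
        show "strict_mono_on {..<a} f"
        proof (rule strict_mono_onI)
          fix i j assume ij: "i \<in> {..<a}" "j \<in> {..<a}" "i < j"
          then have "inv_into UNIV g (s ! i) < inv_into UNIV g (s ! j)"
            using sorted_wrt_nth_less[OF sorted ij(3)] by (simp add: a_def)
          then show "f i < f j" using \<beta>_less_iff[of "f i" "f j"] \<beta>_f f_less ij by simp
        qed
        fix u assume u: "u \<subseteq> {..<a}"
        have "\<beta> ` f ` u = inv_into UNIV g ` nth s ` u" unfolding image_image
          by (rule image_cong[OF refl]) (use \<beta>_f u in auto)
        moreover have "inv_into UNIV g ` nth s ` u \<in> S \<longleftrightarrow> nth s ` u \<in> S"
          using auts_inv[OF ga] by (simp only: auts_def mem_Collect_eq)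
        moreover have "f ` u \<subseteq> {..<b}" using u f_less by auto
        ultimately show "u \<in> A \<longleftrightarrow> f ` u \<in> E" using u by (simp add: A_def E_def)
      qed
      then have col: "\<kappa> (map (h \<circ> f) [0..<a]) = col" using mono f_less by blast
      have word: "map (inv_into UNIV k) s = map \<gamma> (map (h \<circ> f) [0..<a])"
      proof (rule nth_equalityI)
        fix i assume "i < length (map (inv_into UNIV k) s)"
        then have i: "i < a" by (simp add: a_def)
        have "\<beta> (f i) \<in> B" using \<beta>_img f_less[OF i] by blast
        then have "m (inv_into UNIV g (s ! i)) = \<gamma> (h (f i))"
          using m(3) \<theta>_\<beta>[OF f_less[OF i]] \<beta>_f[OF i] by simp
        then show "map (inv_into UNIV k) s ! i = map \<gamma> (map (h \<circ> f) [0..<a]) ! i"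
          using i by (simp add: k_inv a_def)
      qed (simp add: a_def)
      show ?thesis
      proof (cases col)
        case True
        then obtain g' where g': "g' \<in> auts" "map (inv_into UNIV g') s = map (inv_into UNIV k) s" "\<phi> (\<psi> g' z) < 1 / 2"
          using col word unfolding \<kappa>_def by auto
        \<comment> \<open>The colour is witnessed by some \<open>g'\<close> that agrees with \<open>k\<close> up to an automorphism fixing the elements of \<open>s\<close>.\<close>
        define u where "u = k \<circ> inv_into UNIV g'"
        have ua: "u \<in> auts" by (simp add: u_def auts_comp auts_inv ka g'(1))
        have "u x = x" if "x \<in> set s" for x
        proof -
          have "inv_into UNIV g' x = inv_into UNIV k x" using g'(2) that by simp
          then show ?thesis using inv_apply_eq[OF ka, of x "inv_into UNIV k x"] by (simp add: u_def)
        qed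
        then have "\<bar>\<phi> (\<psi> u (\<psi> g' z)) - \<phi> (\<psi> g' z)\<bar> < 1 / 8"
          using stab ua flow_closed[OF g'(1) z] unfolding almost_stabilised_def by simp
        moreover have "\<psi> u (\<psi> g' z) = \<psi> k z"
        proof -
          have "u \<circ> g' = k" unfolding u_def comp_assoc inv_left[OF g'(1)] by simp
          then show ?thesis using flow_comp[OF ua g'(1) z] by simp
        qed
        ultimately have "\<bar>\<phi> (\<psi> k z) - \<phi> (\<psi> g' z)\<bar> < 1 / 8" by (simp only:)
        then have "\<phi> (\<psi> k z) < 5 / 8" using g'(3) unfolding abs_less_iff by linarith
        then show ?thesis using True by (simp add: k_eq)
      next
        case False
        then have "\<not> \<phi> (\<psi> k z) < 1 / 2" using col word ka unfolding \<kappa>_def by blast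
        then show ?thesis using False by (simp add: k_eq)
      qed
    qed
    have "order_blind \<phi> s B (\<psi> (inv_into UNIV m) z)" unfolding order_blind_def
    proof (intro allI impI notI)
      fix g h assume gh: "increasing_into s B g" "increasing_into s B h"
        "\<phi> (\<psi> g (\<psi> (inv_into UNIV m) z)) < 1 / 4 \<and> 3 / 4 < \<phi> (\<psi> h (\<psi> (inv_into UNIV m) z))"
      show False using side[OF gh(1)] side[OF gh(2)] gh(3) by (cases col) simp_all
    qed
    then show ?thesis using ma m_less m_B by blast
  qed
  then show ?thesis by (intro exI[of _ B']) (simp add: B'_def)
qed

text \<open>
  Satisfy the other conditions on the larger set \<open>B'\<close> first. The last step moves the point by an automorphism that
  embeds \<open>B\<close> in \<open>B'\<close> monotonically, so these conditions survive on \<open>B\<close>.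
\<close>

lemma order_blind_finitely_many:
  assumes y: "y \<in> topspace Y" and "finite \<Phi>" "\<forall>(\<phi>, s)\<in>\<Phi>. almost_stabilised \<phi> s" "finite B"
  shows "\<exists>k\<in>auts. \<forall>(\<phi>, s)\<in>\<Phi>. order_blind \<phi> s B (\<psi> k y)"
  using assms(2-4)
proof (induction arbitrary: B)
  case empty
  show ?case using auts_id by auto
next
  case (insert w \<Phi>)
  obtain \<phi> s where w: "w = (\<phi>, s)" by (cases w)
  have "almost_stabilised \<phi> s" using insert.prems(1) w by simp
  from order_blind_Ramsey_step[OF this insert.prems(2)]
  obtain B' where B': "finite B'" and step: "\<And>z. z \<in> topspace Y \<Longrightarrow>
    \<exists>m\<in>auts. (\<forall>x\<in>B. \<forall>y\<in>B. x < y \<longrightarrow> m x < m y) \<and>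
           m ` B \<subseteq> B' \<and> order_blind \<phi> s B (\<psi> (inv_into UNIV m) z)" by (elim exE conjE) simp
  have "\<forall>(\<phi>, s)\<in>\<Phi>. almost_stabilised \<phi> s" using insert.prems(1) by simp
  from insert.IH[OF this B'] obtain k where k: "k \<in> auts"
    "\<forall>(\<phi>, s)\<in>\<Phi>. order_blind \<phi> s B' (\<psi> k y)" by (elim bexE)
  have z: "\<psi> k y \<in> topspace Y" by (rule flow_closed[OF k(1) y])
  from step[OF z] obtain m where m: "m \<in> auts" "\<forall>x\<in>B. \<forall>y\<in>B. x < y \<longrightarrow> m x < m y" "m ` B \<subseteq> B'"
    "order_blind \<phi> s B (\<psi> (inv_into UNIV m) (\<psi> k y))" by (elim bexE conjE)
  have eq: "\<psi> (inv_into UNIV m \<circ> k) y = \<psi> (inv_into UNIV m) (\<psi> k y)"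
    by (rule flow_comp[OF auts_inv[OF m(1)] k(1) y])
  have old: "order_blind \<phi>' s' B (\<psi> (inv_into UNIV m) (\<psi> k y))" if "(\<phi>', s') \<in> \<Phi>" for \<phi>' s'
    unfolding order_blind_def
  proof (intro allI impI)
    fix g h assume gh: "increasing_into s' B g" "increasing_into s' B h"
    have blind: "order_blind \<phi>' s' B' (\<psi> k y)" using k(2) that by blast
    have ga: "g \<in> auts" "h \<in> auts" using gh by (simp_all add: increasing_into_def)
    show "\<not> (\<phi>' (\<psi> g (\<psi> (inv_into UNIV m) (\<psi> k y))) < 1 / 4 \<and>
      3 / 4 < \<phi>' (\<psi> h (\<psi> (inv_into UNIV m) (\<psi> k y))))"
      using order_blindD[OF blind increasing_into_translate[OF gh(1) m(1-3)]
          increasing_into_translate[OF gh(2) m(1-3)]]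
      unfolding flow_comp[OF ga(1) auts_inv[OF m(1)] z] flow_comp[OF ga(2) auts_inv[OF m(1)] z] .
  qed
  show ?case
  proof (intro bexI[of _ "inv_into UNIV m \<circ> k"] ballI)
    show "inv_into UNIV m \<circ> k \<in> auts" by (rule auts_comp[OF auts_inv[OF m(1)] k(1)])
    fix v assume "v \<in> insert w \<Phi>"
    then show "case v of (\<phi>, s) \<Rightarrow> order_blind \<phi> s B (\<psi> (inv_into UNIV m \<circ> k) y)"
      unfolding eq using m(4) old w by (cases v) auto
  qed
qed

lemma closedin_order_blind:
  assumes \<phi>: "continuous_map Y euclideanreal \<phi>"
  shows "closedin Y {z \<in> topspace Y. order_blind \<phi> s B z}"
proof -
  have "openin Y (topspace Y - {z \<in> topspace Y. order_blind \<phi> s B z})"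
  proof (subst openin_subopen, intro ballI)
    fix z assume "z \<in> topspace Y - {z \<in> topspace Y. order_blind \<phi> s B z}"
    then have z: "z \<in> topspace Y" "\<not> order_blind \<phi> s B z" by simp_all
    then obtain g h where gh: "increasing_into s B g" "increasing_into s B h"
      "\<phi> (\<psi> g z) < 1 / 4" "3 / 4 < \<phi> (\<psi> h z)" unfolding order_blind_def by auto
    have ga: "g \<in> auts" "h \<in> auts" using gh by (simp_all add: increasing_into_def)
    define U where "U = {z \<in> topspace Y. (\<phi> \<circ> \<psi> g) z \<in> {..<1 / 4}}"
    define V where "V = {z \<in> topspace Y. (\<phi> \<circ> \<psi> h) z \<in> {3 / 4<..}}"
    have "openin Y U" unfolding U_def
      by (rule openin_continuous_map_preimage[OF continuous_map_compose[OF flow_continuous_at[OF ga(1)] \<phi>]])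
        simp
    moreover have "openin Y V" unfolding V_def
      by (rule openin_continuous_map_preimage[OF continuous_map_compose[OF flow_continuous_at[OF ga(2)] \<phi>]])
        simp
    ultimately have "openin Y (U \<inter> V)" by (rule openin_Int)
    moreover have "z \<in> U \<inter> V" using z gh by (simp add: U_def V_def)
    moreover have "U \<inter> V \<subseteq> topspace Y - {z \<in> topspace Y. order_blind \<phi> s B z}"
    proof
      fix w assume w: "w \<in> U \<inter> V"
      then have "\<not> order_blind \<phi> s B w" using order_blindD[OF _ gh(1,2), of \<phi> w] by (auto simp: U_def V_def)
      then show "w \<in> topspace Y - {z \<in> topspace Y. order_blind \<phi> s B z}" using w by (simp add: U_def)
    qed
    ultimately show "\<exists>T. openin Y T \<and> z \<in> T \<and> T \<subseteq> topspace Y - {z \<in> topspace Y. order_blind \<phi> s B z}"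
      by (intro exI[of _ "U \<inter> V"] conjI)
  qed
  then show ?thesis by (simp add: closedin_def)
qed

text \<open>
  The conditions are closed, and finitely many of them are satisfiable; now \<open>Y\<close> is compact.
\<close>

lemma order_blind_point:
  assumes ne: "topspace Y \<noteq> {}"
  shows "\<exists>y\<in>topspace Y. \<forall>\<phi> s B. continuous_map Y euclideanreal \<phi> \<longrightarrow> almost_stabilised \<phi> s \<longrightarrow>
           finite B \<longrightarrow> order_blind \<phi> s B y"
proof -
  define T where "T = {(\<phi>, s). continuous_map Y euclideanreal \<phi> \<and> almost_stabilised \<phi> s}"
  define D where "D i = (case i of ((\<phi>, s), n) \<Rightarrow>
    if (\<phi>, s) \<in> T then {z \<in> topspace Y. order_blind \<phi> s {..<n :: nat} z} else topspace Y)" for i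
  have D_closed: "closedin Y (D i)" for i
    by (cases i rule: prod.exhaust; rename_tac w n; case_tac w)
      (simp add: D_def T_def closedin_order_blind)
  obtain y where y: "y \<in> topspace Y" using ne by blast
  have "\<exists>y\<in>topspace Y. \<forall>I. finite I \<longrightarrow> y \<in> \<Inter>(insert (topspace Y) (D ` I))"
  proof (rule compact_space_directed[OF flow_compact])
    fix I :: "((('y \<Rightarrow> real) \<times> nat list) \<times> nat) set" assume I: "finite I"
    show "closedin Y (\<Inter>(insert (topspace Y) (D ` I)))"
      using D_closed by (intro closedin_Inter) auto
    define \<Phi> where "\<Phi> = fst ` I \<inter> T"
    define N where "N = Max (insert 0 (snd ` I))"
    have "finite \<Phi>" using I by (simp add: \<Phi>_def)
    moreover have "\<forall>(\<phi>, s)\<in>\<Phi>. almost_stabilised \<phi> s" by (auto simp: \<Phi>_def T_def)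
    ultimately obtain k where k: "k \<in> auts" "\<forall>(\<phi>, s)\<in>\<Phi>. order_blind \<phi> s {..<N} (\<psi> k y)"
      using order_blind_finitely_many[OF y _ _ finite_lessThan[of N]] by blast
    have ky: "\<psi> k y \<in> topspace Y" by (rule flow_closed[OF k(1) y])
    have "\<psi> k y \<in> D i" if i: "i \<in> I" for i
    proof -
      obtain \<phi> s n where i': "i = ((\<phi>, s), n)" by (metis surj_pair)
      have "n \<in> insert 0 (snd ` I)" using i i' by force
      then have "n \<le> N" unfolding N_def using I by (intro Max_ge) simp_all
      then have sub: "{..<n} \<subseteq> {..<N}" by auto
      show ?thesis
      proof (cases "(\<phi>, s) \<in> T")
        case True
        then have "(\<phi>, s) \<in> \<Phi>" using i i' by (force simp: \<Phi>_def)
        then have "order_blind \<phi> s {..<N} (\<psi> k y)" using k(2) by blast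
        then show ?thesis using True ky order_blind_mono[OF sub] by (simp add: D_def i')
      next
        case False
        then show ?thesis using ky by (simp add: D_def i')
      qed
    qed
    then show "\<Inter>(insert (topspace Y) (D ` I)) \<noteq> {}" using ky by blast
  next
    fix I J :: "((('y \<Rightarrow> real) \<times> nat list) \<times> nat) set" assume "finite J" "I \<subseteq> J"
    then show "\<Inter>(insert (topspace Y) (D ` J)) \<subseteq> \<Inter>(insert (topspace Y) (D ` I))" by blast
  qed
  then obtain y0 where y0: "y0 \<in> topspace Y"
    and all: "\<forall>I. finite I \<longrightarrow> y0 \<in> \<Inter>(insert (topspace Y) (D ` I))" by (elim bexE)
  have "order_blind \<phi> s B y0"
    if t: "continuous_map Y euclideanreal \<phi>" "almost_stabilised \<phi> s" "finite B" for \<phi> s B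
  proof -
    obtain n where n: "B \<subseteq> {..<n}" using finite_nat_iff_bounded t(3) by blast
    have "y0 \<in> \<Inter>(insert (topspace Y) (D ` {((\<phi>, s), n)}))"
      using all[THEN spec, THEN mp, of "{((\<phi>, s), n)}"] by simp
    then have "y0 \<in> D ((\<phi>, s), n)" by simp
    moreover have "(\<phi>, s) \<in> T" using t by (simp add: T_def)
    ultimately have "order_blind \<phi> s {..<n} y0" by (simp add: D_def)
    then show ?thesis by (rule order_blind_mono[OF n])
  qed
  then show ?thesis using y0 by blast
qed

text \<open>
  The closure of the points \<open>g y0\<close> for which the order \<open>g <\<close> agrees with \<open>x\<close> on \<open>Z\<close>. As \<open>Z\<close> grows, these sets shrink to
  the limit points of \<open>g y0\<close> as \<open>g <\<close> tends to \<open>x\<close>.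
\<close>

definition limit_set :: "'y \<Rightarrow> (nat \<times> nat \<Rightarrow> bool) \<Rightarrow> (nat \<times> nat) set \<Rightarrow> 'y set" where
  "limit_set y0 x Z = Y closure_of {\<psi> g y0 | g. g \<in> auts \<and> (\<forall>z\<in>Z. pull g (\<lambda>(a, b). a < b) z = x z)}"

lemma limit_set_closed: "closedin Y (limit_set y0 x Z)"
  by (simp add: limit_set_def)

lemma limit_set_anti: "Z \<subseteq> Z' \<Longrightarrow> limit_set y0 x Z' \<subseteq> limit_set y0 x Z"
  unfolding limit_set_def by (rule closure_of_mono) blast

lemma limit_set_cong: "\<forall>z\<in>Z. x z = x' z \<Longrightarrow> limit_set y0 x Z = limit_set y0 x' Z"
  unfolding limit_set_def by simp

lemma limit_set_nonempty:
  assumes y0: "y0 \<in> topspace Y" and x: "x \<in> linear_orders" and Z: "finite Z"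
  shows "limit_set y0 x Z \<noteq> {}"
proof -
  obtain g where g: "g \<in> auts" "\<forall>z\<in>Z. pull g (\<lambda>(a, b). a < b) z = x z"
    using realise_order_cylinder[OF less_linear_order x Z] by (elim bexE)
  let ?A = "{\<psi> g y0 | g. g \<in> auts \<and> (\<forall>z\<in>Z. pull g (\<lambda>(a, b). a < b) z = x z)}"
  have "\<psi> g y0 \<in> ?A" using g by blast
  moreover have "?A \<subseteq> topspace Y" using flow_closed[OF _ y0] by blast
  ultimately have "\<psi> g y0 \<in> limit_set y0 x Z"
    unfolding limit_set_def using closure_of_subset[of ?A Y] by blast
  then show ?thesis by blast
qed

lemma limit_set_witness:
  assumes y: "y \<in> limit_set y0 x Z" and \<phi>: "continuous_map Y euclideanreal \<phi>" and V: "open V" "\<phi> y \<in> V"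
  shows "\<exists>g\<in>auts. (\<forall>z\<in>Z. pull g (\<lambda>(a, b). a < b) z = x z) \<and> \<phi> (\<psi> g y0) \<in> V"
proof -
  have yY: "y \<in> topspace Y" using subsetD[OF closedin_subset[OF limit_set_closed] y] .
  define W where "W = {w \<in> topspace Y. \<phi> w \<in> V}"
  have "openin Y W" unfolding W_def
    by (rule openin_continuous_map_preimage[OF \<phi>]) (simp add: V(1))
  moreover have "y \<in> W" using yY V(2) by (simp add: W_def)
  ultimately have "y \<in> W \<and> openin Y W" by (intro conjI)
  from y[unfolded limit_set_def in_closure_of, THEN conjunct2, THEN spec, THEN mp, OF this]
  obtain w where
    w: "w \<in> {\<psi> g y0 | g. g \<in> auts \<and> (\<forall>z\<in>Z. pull g (\<lambda>(a, b). a < b) z = x z)}" "w \<in> W"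
    by (elim exE conjE)
  from w(1) obtain g where g: "w = \<psi> g y0" "g \<in> auts" "\<forall>z\<in>Z. pull g (\<lambda>(a, b). a < b) z = x z"
    by (elim CollectE exE conjE)
  have "\<phi> (\<psi> g y0) \<in> V" using w(2) unfolding W_def g(1) by simp
  then show ?thesis using g(2,3) by (intro bexI[of _ g] conjI)
qed

text \<open>
  Two different limit points are separated by a continuous function. It is almost invariant under the stabiliser of
  a finite set \<open>F\<close>. Near the two points there are \<open>g y0\<close> and \<open>h y0\<close> such that \<open>g <\<close> and \<open>h <\<close> both agree
  with \<open>x\<close> on \<open>F\<close>, which contradicts the choice of \<open>y0\<close>.
\<close>

lemma limit_point_unique:
  assumes blind: "\<forall>\<phi> s B. continuous_map Y euclideanreal \<phi> \<longrightarrow> almost_stabilised \<phi> s \<longrightarrow>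
           finite B \<longrightarrow> order_blind \<phi> s B y0"
    and x: "x \<in> linear_orders"
    and y: "\<forall>Z. finite Z \<longrightarrow> y \<in> limit_set y0 x Z" and y': "\<forall>Z. finite Z \<longrightarrow> y' \<in> limit_set y0 x Z"
  shows "y = y'"
proof (rule ccontr)
  assume ne: "y \<noteq> y'"
  have top: "y \<in> topspace Y" "y' \<in> topspace Y"
    using y[THEN spec, THEN mp, of "{}"] y'[THEN spec, THEN mp, of "{}"]
      closedin_subset[OF limit_set_closed[of y0 x "{}"]] by auto
  have "normal_space Y"
    by (rule compact_Hausdorff_or_regular_imp_normal_space) (simp_all add: flow_compact flow_Hausdorff)
  moreover have "closedin Y {y}" "closedin Y {y'}"
    using top closedin_Hausdorff_singleton[OF flow_Hausdorff] by auto
  moreover have "disjnt {y} {y'}" using ne by simp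
  ultimately obtain \<phi> where \<phi>: "continuous_map Y euclideanreal \<phi>" "\<phi> ` {y} \<subseteq> {0::real}" "\<phi> ` {y'} \<subseteq> {1}"
    by (rule Urysohn_lemma_alt)
  obtain F where F: "finite F" and stab: "\<forall>u\<in>auts. (\<forall>x\<in>F. u x = x) \<longrightarrow>
           (\<forall>y\<in>topspace Y. \<bar>\<phi> (\<psi> u y) - \<phi> y\<bar> < 1 / 8)"
    using stabiliser_almost_invariant[OF \<phi>(1), of "1 / 8"] by auto
  obtain e where e: "bij_betw e {..<card F} F" "\<forall>j<card F. \<forall>i<j. x (e i, e j)"
    using finite_order_enumeration[OF x[unfolded linear_orders_def mem_Collect_eq] F] by (elim exE conjE)
  define s where "s = map e [0..<card F]"
  have set_s: "set s = F" using e(1) by (auto simp: s_def bij_betw_def lessThan_atLeast0)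
  have st: "almost_stabilised \<phi> s" using stab by (simp only: almost_stabilised_def set_s)
  have sorted: "sorted_wrt (<) (map (inv_into UNIV g) s)"
    if g: "\<forall>z\<in>F \<times> F. pull g (\<lambda>(a, b). a < b) z = x z" for g
    unfolding s_def map_map sorted_wrt_iff_nth_less
  proof (intro allI impI)
    fix i j assume ij: "i < j" "j < length (map (inv_into UNIV g \<circ> e) [0..<card F])"
    then have j: "i < card F" "j < card F" by simp_all
    then have "(e i, e j) \<in> F \<times> F" using bij_betw_apply[OF e(1)] by simp
    then have "pull g (\<lambda>(a, b). a < b) (e i, e j)" using g e(2) ij(1) j by simp
    then show "map (inv_into UNIV g \<circ> e) [0..<card F] ! i < map (inv_into UNIV g \<circ> e) [0..<card F] ! j"
      using j by (simp add: pull_apply)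
  qed
  have FF: "finite (F \<times> F)" using F by simp
  obtain g where g: "g \<in> auts" "\<forall>z\<in>F \<times> F. pull g (\<lambda>(a, b). a < b) z = x z" "\<phi> (\<psi> g y0) \<in> {..<1 / 4}"
    using limit_set_witness[OF y[THEN spec, THEN mp, OF FF] \<phi>(1), of "{..<1 / 4}"] \<phi>(2) by auto
  obtain h where h: "h \<in> auts" "\<forall>z\<in>F \<times> F. pull h (\<lambda>(a, b). a < b) z = x z" "\<phi> (\<psi> h y0) \<in> {3 / 4<..}"
    using limit_set_witness[OF y'[THEN spec, THEN mp, OF FF] \<phi>(1), of "{3 / 4<..}"] \<phi>(3) by auto
  define B where "B = inv_into UNIV g ` set s \<union> inv_into UNIV h ` set s"
  have "increasing_into s B g" "increasing_into s B h"
    using g(1) h(1) sorted[OF g(2)] sorted[OF h(2)] by (auto simp: increasing_into_def B_def)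
  moreover have "order_blind \<phi> s B y0" using blind \<phi>(1) st by (simp add: B_def)
  ultimately have "\<not> (\<phi> (\<psi> g y0) < 1 / 4 \<and> 3 / 4 < \<phi> (\<psi> h y0))" using order_blindD by blast
  then show False using g(3) h(3) by simp
qed

text \<open>
  The limit exists by compactness. It depends continuously on \<open>x\<close>, because an open set that contains the limit contains
  one of the sets shrinking to it, and this set depends on \<open>x\<close> through finitely many values. The image is closed and
  invariant, so by minimality it is all of \<open>Y\<close>.
\<close>

theorem orders_map_onto:
  assumes min: "minimal_flow aut_group aut_top Y \<psi>"
  shows "\<exists>f. flow_hom aut_group linear_orders_topology order_action Y \<psi> f \<and>
           f ` topspace linear_orders_topology = topspace Y"
proof -
  have ne: "topspace Y \<noteq> {}" and dense: "\<forall>y\<in>topspace Y. Y closure_of orbit aut_group \<psi> y = topspace Y"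
    using min by (simp_all add: minimal_flow_def)
  obtain y0 where y0: "y0 \<in> topspace Y" and blind: "\<forall>\<phi> s B. continuous_map Y euclideanreal \<phi> \<longrightarrow>
    almost_stabilised \<phi> s \<longrightarrow> finite B \<longrightarrow> order_blind \<phi> s B y0"
    using order_blind_point[OF ne] by (elim bexE)
  define f where "f x = (SOME y. y \<in> topspace Y \<and> (\<forall>Z. finite Z \<longrightarrow> y \<in> limit_set y0 x Z))" for x
  have f: "f x \<in> topspace Y \<and> (\<forall>Z. finite Z \<longrightarrow> f x \<in> limit_set y0 x Z)" if x: "x \<in> linear_orders" for x
  proof -
    have "\<exists>y\<in>topspace Y. \<forall>Z. finite Z \<longrightarrow> y \<in> limit_set y0 x Z"
      by (rule compact_space_directed[OF flow_compact limit_set_closed limit_set_nonempty[OF y0 x] limit_set_anti])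
    then have "\<exists>y. y \<in> topspace Y \<and> (\<forall>Z. finite Z \<longrightarrow> y \<in> limit_set y0 x Z)" by (elim bexE) (intro exI conjI)
    then show ?thesis unfolding f_def by (rule someI_ex)
  qed
  have unique: "y = f x" if "x \<in> linear_orders" "\<forall>Z. finite Z \<longrightarrow> y \<in> limit_set y0 x Z" for x y
    using limit_point_unique[OF blind that(1) that(2)] f[OF that(1)] by simp
  have near: "\<exists>Z. finite Z \<and> limit_set y0 x Z \<subseteq> U" if x: "x \<in> linear_orders" and U: "openin Y U" "f x \<in> U" for x U
  proof (rule ccontr)
    assume no: "\<not> ?thesis"
    have "\<exists>y\<in>topspace Y. \<forall>Z. finite Z \<longrightarrow> y \<in> limit_set y0 x Z - U"
    proof (rule compact_space_directed[OF flow_compact])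
      fix Z :: "(nat \<times> nat) set" assume "finite Z"
      then show "limit_set y0 x Z - U \<noteq> {}" using no by blast
      show "closedin Y (limit_set y0 x Z - U)" by (rule closedin_diff[OF limit_set_closed U(1)])
    next
      fix Z Z' :: "(nat \<times> nat) set" assume "Z \<subseteq> Z'"
      then show "limit_set y0 x Z' - U \<subseteq> limit_set y0 x Z - U" using limit_set_anti by blast
    qed
    then obtain y where y: "\<forall>Z. finite Z \<longrightarrow> y \<in> limit_set y0 x Z - U" by (elim bexE)
    then have "y = f x" by (intro unique[OF x]) simp
    moreover have "y \<notin> U" using y[THEN spec, THEN mp, of "{}"] by simp
    ultimately show False using U(2) by simp
  qed
  have cont: "continuous_map linear_orders_topology Y f"
    unfolding continuous_map_def topspace_linear_orders
  proof (intro conjI allI impI)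
    show "f \<in> linear_orders \<rightarrow> topspace Y" using f by blast
    fix U assume U: "openin Y U"
    show "openin linear_orders_topology {x \<in> linear_orders. f x \<in> U}"
    proof (subst openin_subopen, intro ballI)
      fix x assume "x \<in> {x \<in> linear_orders. f x \<in> U}"
      then have x: "x \<in> linear_orders" "f x \<in> U" by simp_all
      obtain Z where Z: "finite Z" "limit_set y0 x Z \<subseteq> U" using near[OF x(1) U x(2)] by (elim exE conjE)
      have "f q \<in> U" if q: "q \<in> linear_orders" "\<forall>z\<in>Z. q z = x z" for q
      proof -
        have "f q \<in> limit_set y0 q Z" using f[OF q(1)] Z(1) by simp
        then show ?thesis using limit_set_cong[OF q(2), of y0] Z(2) by blast
      qed
      then have "{q \<in> linear_orders. \<forall>z\<in>Z. q z = x z} \<subseteq> {x \<in> linear_orders. f x \<in> U}" by blast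
      moreover have "x \<in> {q \<in> linear_orders. \<forall>z\<in>Z. q z = x z}" using x(1) by simp
      ultimately show "\<exists>T. openin linear_orders_topology T \<and> x \<in> T \<and> T \<subseteq> {x \<in> linear_orders. f x \<in> U}"
        using openin_cylinder[OF Z(1), of linear_orders x] by blast
    qed
  qed
  have equi: "f (order_action g x) = \<psi> g (f x)" if g: "g \<in> auts" and x: "x \<in> linear_orders" for g x
  proof -
    have gx: "pull g x \<in> linear_orders" by (rule pull_linear_orders[OF autsD[OF g] x])
    have "\<psi> g (f x) \<in> limit_set y0 (pull g x) Z" if Z: "finite Z" for Z
    proof -
      define Z' where "Z' = (\<lambda>(a, b). (inv_into UNIV g a, inv_into UNIV g b)) ` Z"
      let ?A = "{\<psi> h y0 | h. h \<in> auts \<and> (\<forall>z\<in>Z'. pull h (\<lambda>(a, b). a < b) z = x z)}"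
      let ?B = "{\<psi> h y0 | h. h \<in> auts \<and> (\<forall>z\<in>Z. pull h (\<lambda>(a, b). a < b) z = pull g x z)}"
      have "\<psi> g (\<psi> h y0) \<in> ?B"
        if h: "h \<in> auts" "\<forall>z\<in>Z'. pull h (\<lambda>(a, b). a < b) z = x z" for h
      proof -
        have "pull (g \<circ> h) (\<lambda>(a, b). a < b) z = pull g x z" if z: "z \<in> Z" for z
        proof -
          obtain a b where ab: "z = (a, b)" by (cases z)
          have "(inv_into UNIV g a, inv_into UNIV g b) \<in> Z'"
            unfolding Z'_def by (rule image_eqI[of _ _ z]) (simp_all add: ab z[unfolded ab])
          then have "pull h (\<lambda>(a, b). a < b) (inv_into UNIV g a, inv_into UNIV g b) =
              x (inv_into UNIV g a, inv_into UNIV g b)" using h(2) by blast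
          then show ?thesis unfolding pull_comp[OF autsD[OF g] autsD[OF h(1)]] ab pull_apply[of g] .
        qed
        then show ?thesis using auts_comp[OF g h(1)] flow_comp[OF g h(1) y0]
          by (intro CollectI exI[of _ "g \<circ> h"]) simp
      qed
      then have "\<psi> g ` ?A \<subseteq> ?B" by blast
      then have "Y closure_of (\<psi> g ` ?A) \<subseteq> Y closure_of ?B" by (rule closure_of_mono)
      moreover have "\<psi> g ` (Y closure_of ?A) \<subseteq> Y closure_of (\<psi> g ` ?A)"
        by (rule continuous_map_image_closure_subset[OF flow_continuous_at[OF g]])
      moreover have "f x \<in> Y closure_of ?A"
      proof -
        have "finite Z'" unfolding Z'_def by (rule finite_imageI[OF Z])
        then have "f x \<in> limit_set y0 x Z'" using f[OF x] by simp
        then show ?thesis unfolding limit_set_def .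
      qed
      ultimately show ?thesis unfolding limit_set_def by blast
    qed
    then have "\<forall>Z. finite Z \<longrightarrow> \<psi> g (f x) \<in> limit_set y0 (pull g x) Z" by (intro allI impI)
    from unique[OF gx this] show ?thesis by (simp only: order_action_eq[OF g x])
  qed
  have hom: "flow_hom aut_group linear_orders_topology order_action Y \<psi> f"
    unfolding flow_hom_def carrier_Aut topspace_linear_orders using cont equi by simp
  have sub: "f ` linear_orders \<subseteq> topspace Y" using f by blast
  have "compactin linear_orders_topology linear_orders"
    using compact_space_linear_orders unfolding compact_space_def topspace_linear_orders .
  then have "closedin Y (f ` linear_orders)"
    using compactin_imp_closedin[OF flow_Hausdorff] image_compactin[OF _ cont] by blast
  moreover define y1 where "y1 = f (\<lambda>(a, b). a < b)"
  have "orbit aut_group \<psi> y1 \<subseteq> f ` linear_orders"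
  proof
    fix y assume "y \<in> orbit aut_group \<psi> y1"
    then obtain g where g: "g \<in> auts" "y = \<psi> g y1" unfolding orbit_def carrier_Aut by blast
    then have "y = f (order_action g (\<lambda>(a, b). a < b))"
      using equi[OF g(1) less_linear_order] by (simp add: y1_def)
    then show "y \<in> f ` linear_orders" using order_action_closed[OF g(1) less_linear_order] by blast
  qed
  ultimately have "Y closure_of orbit aut_group \<psi> y1 \<subseteq> f ` linear_orders" by (intro closure_of_minimal)
  moreover have "y1 \<in> topspace Y" using f[OF less_linear_order] by (simp add: y1_def)
  ultimately have "topspace Y \<subseteq> f ` linear_orders" using dense by simp
  then show ?thesis using hom sub unfolding topspace_linear_orders by blast
qed

end

lemma universal_minimal_flow_orders:
  "universal_minimal_flow TYPE('y) aut_group aut_top linear_orders_topology order_action"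
  unfolding universal_minimal_flow_def
proof (intro conjI minimal_flow_orders allI impI)
  fix Y :: "'y topology" and \<psi> assume min: "minimal_flow aut_group aut_top Y \<psi>"
  then have "flow aut_group aut_top Y \<psi>" by (simp add: minimal_flow_def)
  from orders_map_onto[OF this min]
  show "\<exists>f. flow_hom aut_group linear_orders_topology order_action Y \<psi> f \<and>
           f ` topspace linear_orders_topology = topspace Y" .
qed

end

section \<open>Random polyhedra\<close>

text \<open>
  Both classes of ordered polyhedra at once.
\<close>

definition sized_polyhedra :: "(nat \<Rightarrow> bool) \<Rightarrow> (nat with_order, nat) rel_structure set" where
  "sized_polyhedra ok = {expand_order (polyhedron_structure A S) r | A S r.
     finite A \<and> abstract_polyhedron A S \<and> (\<forall>u\<in>S. ok (card u)) \<and> r \<subseteq> A \<times> A \<and> strict_linear_order_on A r}"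

lemma KP_sized: "KP = sized_polyhedra (\<lambda>_. True)"
  by (simp add: KP_def sized_polyhedra_def)

lemma KP_bounded_sized: "KP_bounded k = sized_polyhedra (\<lambda>n. n \<le> k)"
  by (simp add: KP_bounded_def sized_polyhedra_def)

lemma drop_expand: "drop_order (expand_order M r) = M"
  by (cases M) (simp add: drop_order_def expand_order_def)

lemma sized_polyhedra_unordered:
  "drop_order ` sized_polyhedra ok =
     {polyhedron_structure A T | A T. finite A \<and> abstract_polyhedron A T \<and> (\<forall>u\<in>T. ok (card u))}"
    (is "?L = ?R")
proof (intro equalityI subsetI)
  fix M assume "M \<in> ?L"
  then obtain N where N: "N \<in> sized_polyhedra ok" "M = drop_order N" by (elim imageE)
  from N(1) obtain A T r where "N = expand_order (polyhedron_structure A T) r" "finite A"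
    "abstract_polyhedron A T" "\<forall>u\<in>T. ok (card u)" unfolding sized_polyhedra_def by (elim CollectE exE conjE)
  then show "M \<in> ?R" using N(2) by (intro CollectI exI[of _ A] exI[of _ T]) (simp add: drop_expand)
next
  fix M assume "M \<in> ?R"
  then obtain A T where M: "M = polyhedron_structure A T" "finite A" "abstract_polyhedron A T"
    "\<forall>u\<in>T. ok (card u)" by (elim CollectE exE conjE)
  define r where "r = {(x, y). x \<in> A \<and> y \<in> A \<and> x < y}"
  have "strict_linear_order_on A r"
    by (auto simp: r_def strict_linear_order_on_def trans_def irrefl_def total_on_def)
  moreover have "r \<subseteq> A \<times> A" by (auto simp: r_def)
  ultimately have "expand_order M r \<in> sized_polyhedra ok"
    unfolding sized_polyhedra_def M(1) using M(2-4) by (intro CollectI exI[of _ A] exI[of _ T] exI[of _ r] conjI refl)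
  then show "M \<in> ?L" using drop_expand[of M r] by (intro image_eqI[of _ _ "expand_order M r"]) simp_all
qed

lemma abstract_polyhedronD:
  assumes "abstract_polyhedron A S"
  shows "u \<in> S \<Longrightarrow> finite u" and "u \<subseteq> v \<Longrightarrow> v \<in> S \<Longrightarrow> u \<in> S" and "\<Union>S = A"
  using assms by (simp_all only: abstract_polyhedron_def)

lemma abstract_polyhedron_vertex:
  assumes "abstract_polyhedron UNIV S"
  shows "{x} \<in> S"
proof -
  have "x \<in> \<Union>S" unfolding abstract_polyhedronD(3)[OF assms] by simp
  then obtain u where "u \<in> S" "x \<in> u" by (elim UnionE)
  then show ?thesis using abstract_polyhedronD(2)[OF assms, of "{x}" u] by simp
qed

lemma abstract_polyhedron_induced:
  assumes "abstract_polyhedron UNIV S" "finite A"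
  shows "abstract_polyhedron A {u \<in> S. u \<subseteq> A}"
proof -
  note D = abstract_polyhedronD[OF assms(1)]
  have "\<Union>{u \<in> S. u \<subseteq> A} = A"
  proof (intro equalityI subsetI)
    fix x assume "x \<in> A"
    then have "{x} \<in> {u \<in> S. u \<subseteq> A}" using abstract_polyhedron_vertex[OF assms(1), of x] by simp
    then show "x \<in> \<Union>{u \<in> S. u \<subseteq> A}" by (rule UnionI) simp
  qed auto
  moreover have "\<forall>u v. u \<subseteq> v \<and> v \<in> {u \<in> S. u \<subseteq> A} \<longrightarrow> u \<in> {u \<in> S. u \<subseteq> A}"
  proof (intro allI impI)
    fix u v assume "u \<subseteq> v \<and> v \<in> {u \<in> S. u \<subseteq> A}"
    then have "u \<subseteq> v" "v \<in> S" "v \<subseteq> A" by simp_all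
    then show "u \<in> {u \<in> S. u \<subseteq> A}" using D(2)[of u v] by simp
  qed
  moreover have "\<forall>u\<in>{u \<in> S. u \<subseteq> A}. finite u" using D(1) by simp
  ultimately show ?thesis unfolding abstract_polyhedron_def
    using countable_finite[OF assms(2)] by (intro conjI)
qed

lemma polyhedron_structure_eqD:
  assumes "polyhedron_structure A T = polyhedron_structure B U" "u \<in> T" "finite u" "u \<noteq> {}"
  shows "u \<in> U"
proof -
  obtain xs where xs: "set xs = u" "distinct xs" using finite_distinct_list[OF assms(3)] by blast
  then obtain n where n: "length xs = Suc n" using assms(4) by (cases xs) auto
  have "xs \<in> interp (polyhedron_structure A T) n"
    using xs n assms(2) by (simp add: polyhedron_structure_def)
  then have "xs \<in> interp (polyhedron_structure B U) n" by (simp only: assms(1))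
  then show ?thesis using xs(1) by (simp add: polyhedron_structure_def)
qed

text \<open>
  The sizes of faces are bounded because a face with all its subsets belongs to the age.
\<close>

lemma Fraisse_limit_homogeneous_polyhedron:
  assumes bound: "size_bound ok" and S: "abstract_polyhedron UNIV S"
    and lim: "is_Fraisse_limit (drop_order ` sized_polyhedra ok) (polyhedron_structure UNIV S)"
  shows "homogeneous_polyhedron S ok"
proof -
  let ?P = "polyhedron_structure UNIV S"
  note fin = abstract_polyhedronD(1)[OF S] and down = abstract_polyhedronD(2)[OF S]
    and vertex = abstract_polyhedron_vertex[OF S]
  have empty: "{} \<in> S" using down[OF _ vertex] by blast
  have uni: "universe ?P = UNIV" by (simp add: polyhedron_structure_def)
  have hom: "ultrahomogeneous ?P" and age: "age ?P = drop_order ` sized_polyhedra ok"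
    using lim by (simp_all add: is_Fraisse_limit_def)
  have iso_sub: "structure_iso f (substructure_on ?P A) (polyhedron_structure B U) \<longleftrightarrow>
      bij_betw f A B \<and> (\<forall>u\<subseteq>A. u \<in> {u \<in> S. u \<subseteq> A} \<longleftrightarrow> f ` u \<in> U)"
    if "\<And>u. u \<in> U \<Longrightarrow> finite u \<and> u \<subseteq> B" "{} \<in> U" for f A and B :: "nat set" and U
    unfolding substructure_on_polyhedron
    by (rule structure_iso_polyhedron) (use fin empty that in auto)
  show ?thesis
  proof
    fix u assume u: "u \<in> S"
    show "ok (card u)"
    proof (cases "u = {}")
      case True
      then show ?thesis using size_bound_mono[OF bound _ size_bound_1[OF bound]] by simp
    next
      case False
      let ?M = "polyhedron_structure u {v \<in> S. v \<subseteq> u}"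
      have "structure_iso id (substructure_on ?P u) ?M"
        by (subst iso_sub) (use fin empty in auto)
      then have "?M \<in> age ?P" unfolding age_def uni using fin[OF u] by blast
      then obtain A T where "?M = polyhedron_structure A T" "\<forall>u\<in>T. ok (card u)"
        unfolding age sized_polyhedra_unordered by (elim CollectE exE conjE)
      then show ?thesis using polyhedron_structure_eqD[of u _ A T u] u False fin by simp
    qed
  next
    fix A :: "nat set" and f :: "nat \<Rightarrow> nat"
    assume A: "finite A" and inj: "inj_on f A" and faces: "\<And>u. u \<subseteq> A \<Longrightarrow> u \<in> S \<longleftrightarrow> f ` u \<in> S"
    have "structure_iso f (substructure_on ?P A) (polyhedron_structure (f ` A) {u \<in> S. u \<subseteq> f ` A})"
    proof (subst iso_sub)
      show "bij_betw f A (f ` A) \<and> (\<forall>u\<subseteq>A. u \<in> {u \<in> S. u \<subseteq> A} \<longleftrightarrow> f ` u \<in> {u \<in> S. u \<subseteq> f ` A})"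
        using inj faces by (auto simp: bij_betw_def)
    qed (use fin empty in auto)
    then have "structure_iso f (substructure_on ?P A) (substructure_on ?P (f ` A))"
      by (simp only: substructure_on_polyhedron[of _ _ "f ` A"])
    then have "\<exists>g. structure_iso g ?P ?P \<and> (\<forall>x\<in>A. g x = f x)"
      using hom A unfolding ultrahomogeneous_def uni by blast
    then obtain g where g: "structure_iso g ?P ?P" "\<forall>x\<in>A. g x = f x" by (elim exE conjE)
    have "bij_betw g UNIV UNIV \<and> (\<forall>u\<subseteq>UNIV. u \<in> S \<longleftrightarrow> g ` u \<in> S)"
      using g(1) by (subst (asm) structure_iso_polyhedron) (use fin empty in auto)
    then show "\<exists>g. bij g \<and> (\<forall>u. g ` u \<in> S \<longleftrightarrow> u \<in> S) \<and> (\<forall>x\<in>A. g x = f x)"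
      using g(2) by (intro exI[of _ g]) simp
  next
    fix n E assume E: "complex_on ok n E"
    have "\<Union>E = {..<n}"
      using complex_on_vertices[OF E] complex_on_vertex[OF E] by blast
    moreover have "\<forall>u\<in>E. finite u" using complex_on_face_finite[OF E] by blast
    moreover have "\<forall>u v. u \<subseteq> v \<and> v \<in> E \<longrightarrow> u \<in> E" using complex_on_mono[OF E] by blast
    ultimately have "abstract_polyhedron {..<n} E" by (simp add: abstract_polyhedron_def countable_finite)
    moreover have "\<forall>u\<in>E. ok (card u)" using E[unfolded complex_on_def, THEN conjunct1] by simp
    ultimately have "polyhedron_structure {..<n} E \<in> age ?P"
      unfolding age sized_polyhedra_unordered
      by (intro CollectI exI[of _ "{..<n}"] exI[of _ E]) simp
    then obtain A f where f: "structure_iso f (substructure_on ?P A) (polyhedron_structure {..<n} E)"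
      unfolding age_def by blast
    have "bij_betw f A {..<n} \<and> (\<forall>u\<subseteq>A. u \<in> {u \<in> S. u \<subseteq> A} \<longleftrightarrow> f ` u \<in> E)"
      using f by (subst (asm) iso_sub)
        (use complex_on_face_finite[OF E] complex_on_vertices[OF E] complex_on_empty[OF E] in auto)
    then have bij: "bij_betw f A {..<n}" and faces: "\<And>u. u \<subseteq> A \<Longrightarrow> u \<in> S \<longleftrightarrow> f ` u \<in> E" by auto
    define e where "e = inv_into A f"
    have e: "bij_betw e {..<n} A" unfolding e_def by (rule bij_betw_inv_into[OF bij])
    have "u \<in> E \<longleftrightarrow> e ` u \<in> S" if u: "u \<subseteq> {..<n}" for u
    proof -
      have "f ` e ` u = u" unfolding e_def
        by (rule image_inv_into_cancel[OF bij_betw_imp_surj_on[OF bij] u])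
      moreover have "e ` u \<subseteq> A" using u bij_betw_imp_surj_on[OF e] by blast
      ultimately show ?thesis using faces[of "e ` u"] by simp
    qed
    then show "\<exists>e. inj_on e {..<n} \<and> (\<forall>u\<subseteq>{..<n}. u \<in> E \<longleftrightarrow> e ` u \<in> S)"
      using bij_betw_imp_inj_on[OF e] by blast
  qed (use bound fin down vertex in auto)
qed

text \<open>
  Membership in the class puts no condition on the order of a finite polyhedron.
\<close>

lemma admissible_orderings_all:
  assumes S: "abstract_polyhedron UNIV S" and ok: "\<forall>u\<in>S. ok (card u)"
  shows "admissible_orderings (sized_polyhedra ok) (polyhedron_structure UNIV S) = linear_orders"
proof -
  have "expand_order (substructure_on (polyhedron_structure UNIV S) A) (Collect p \<inter> A \<times> A) \<in> sized_polyhedra ok"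
    if p: "strict_linear_order_on UNIV (Collect p)" and A: "finite A" for p and A :: "nat set"
  proof -
    have "strict_linear_order_on A (Collect p \<inter> A \<times> A)"
      using p unfolding strict_linear_order_on_def trans_def irrefl_def total_on_def by blast
    then show ?thesis
      unfolding substructure_on_polyhedron sized_polyhedra_def
      using A ok abstract_polyhedron_induced[OF S A]
      by (intro CollectI exI[of _ A] exI[of _ "{u \<in> S. u \<subseteq> A}"] exI[of _ "Collect p \<inter> A \<times> A"]) simp
  qed
  then show ?thesis unfolding admissible_orderings_def linear_orders_def by blast
qed

lemma universal_minimal_flow_admissible:
  assumes bound: "size_bound ok" and S: "abstract_polyhedron UNIV S"
    and lim: "is_Fraisse_limit (drop_order ` sized_polyhedra ok) (polyhedron_structure UNIV S)"
  defines "P \<equiv> polyhedron_structure UNIV S" and "K \<equiv> sized_polyhedra ok"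
  shows "metrizable_space (admissible_topology K P) \<and>
    universal_minimal_flow TYPE('y) (Aut P) (Aut_topology P) (admissible_topology K P) (admissible_action K P)"
proof -
  interpret homogeneous_polyhedron S ok
    by (rule Fraisse_limit_homogeneous_polyhedron[OF bound S lim])
  have adm: "admissible_orderings K P = linear_orders"
    unfolding K_def P_def using faces_bounded by (intro admissible_orderings_all[OF S]) simp
  have top: "admissible_topology K P = linear_orders_topology"
    unfolding admissible_topology_def adm ..
  have act: "admissible_action K P = order_action"
    by (intro ext) (simp only: admissible_action_def adm order_action_def, simp only: P_def)
  show ?thesis unfolding top act unfolding P_def
    by (intro conjI metrizable_space_linear_orders universal_minimal_flow_orders)
qed

theorem theorem7p0p4:
  shows "(\<forall>S. random_polyhedron S \<longrightarrow>
            (let P0 = polyhedron_structure UNIV S in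
             metrizable_space (admissible_topology KP P0) \<and>
             universal_minimal_flow TYPE('y) (Aut P0) (Aut_topology P0)
               (admissible_topology KP P0) (admissible_action KP P0)))
       \<and> (\<forall>k S. k \<noteq> 0 \<and> random_k_polyhedron k S \<longrightarrow>
            (let P0k = polyhedron_structure UNIV S in
             metrizable_space (admissible_topology (KP_bounded k) P0k) \<and>
             universal_minimal_flow TYPE('y) (Aut P0k) (Aut_topology P0k)
               (admissible_topology (KP_bounded k) P0k) (admissible_action (KP_bounded k) P0k)))"
proof (intro conjI allI impI)
  fix S assume "random_polyhedron S"
  then have S: "abstract_polyhedron UNIV S"
    "is_Fraisse_limit (drop_order ` sized_polyhedra (\<lambda>_. True)) (polyhedron_structure UNIV S)"
    by (simp_all only: random_polyhedron_def KP0_def KP_sized)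
  show "let P0 = polyhedron_structure UNIV S in
             metrizable_space (admissible_topology KP P0) \<and>
             universal_minimal_flow TYPE('y) (Aut P0) (Aut_topology P0)
               (admissible_topology KP P0) (admissible_action KP P0)"
    unfolding Let_def KP_sized
    by (rule universal_minimal_flow_admissible[OF _ S]) (simp add: size_bound_def)
next
  fix k S assume "k \<noteq> 0 \<and> random_k_polyhedron k S"
  then have k: "k \<noteq> 0" and S: "abstract_polyhedron UNIV S"
    "is_Fraisse_limit (drop_order ` sized_polyhedra (\<lambda>n. n \<le> k)) (polyhedron_structure UNIV S)"
    unfolding random_k_polyhedron_def KP0_bounded_def KP_bounded_sized by blast+
  show "let P0k = polyhedron_structure UNIV S in
             metrizable_space (admissible_topology (KP_bounded k) P0k) \<and>
             universal_minimal_flow TYPE('y) (Aut P0k) (Aut_topology P0k)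
               (admissible_topology (KP_bounded k) P0k) (admissible_action (KP_bounded k) P0k)"
    unfolding Let_def KP_bounded_sized
    by (rule universal_minimal_flow_admissible[OF _ S]) (use k in \<open>simp add: size_bound_def\<close>)
qed

end
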